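(* Let $X$ be a locally compact, separable, metrizable space, $m$ a positive Radon measure on $X$ with full support, and $(\mathcal{E},\mathcal{F})$ a strong local regular Dirichlet form on $L^2(X;m)$ whose index $p$ satisfies $1\le p<\infty$. Let $\nu$ be a minimal energy-dominant measure and $p(x)$ the pointwise index. Equip $\mathcal{F}^p$ (the $p$-fold product of $\mathcal{F}$) with the product topology, where $\mathcal{F}$ carries the Hilbert norm from $(f,g)_{\mathcal{F}}=\mathcal{E}(f,g)+\int_X fg\,dm$. Define $$\mathcal{G}=\Big\{(g_1,\dots,g_p)\in\mathcal{F}^p : \text{for }\nu\text{-a.e. }x\in X,\ \text{the } p(x)\times p(x)\text{ matrix }\Big(\tfrac{d\mu_{\langle g_i,g_j\rangle}}{d\nu}(x)\Big)_{i,j=1}^{p(x)}\text{ is invertible}\Big\},$$ $$\hat{\mathcal{G}}=\{(g_1,\dots,g_p)\in\mathcal{G} : \mu_{\langle g_i\rangle}\text{ is a minimal energy-dominant measure for every } i=1,\dots,p\}.$$ Then $\mathcal{G}$ and $\hat{\mathcal{G}}$ are dense in $\mathcal{F}^p$.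
   Context: Strong locality: $\mathcal{E}(f,g)=0$ whenever $f,g\in\mathcal{F}$ have compact supports and $g$ is constant on a neighborhood of $\mathrm{supp}[f]$ (the support of $|f|\cdot m$). For bounded $f\in\mathcal{F}$, the energy measure $\mu_{\langle f\rangle}$ is the Borel measure with $\int_X\varphi\,d\mu_{\langle f\rangle}=2\mathcal{E}(f\varphi,f)-\mathcal{E}(\varphi,f^2)$ for all $\varphi\in\mathcal{F}\cap C_c(X)$; it extends to all $f\in\mathcal{F}$ by approximation, and $\mu_{\langle f,g\rangle}=\frac12(\mu_{\langle f+g\rangle}-\mu_{\langle f\rangle}-\mu_{\langle g\rangle})$. A $\sigma$-finite Borel measure $\nu$ is a minimal energy-dominant measure (m.e.d.m.) if (a) $\mu_{\langle f\rangle}\ll\nu$ for every $f\in\mathcal{F}$, and (b) every $\sigma$-finite Borel measure $\nu'$ satisfying (a) satisfies $\nu\ll\nu'$. The pointwise index $p(x)$ is the $\nu$-a.e. smallest $\nu$-measurable $\mathbb{Z}_+\cup\{+\infty\}$-valued function such that for all $N$ and $f_1,\dots,f_N\in\mathcal{F}$, $\mathrm{rank}\big(\frac{d\mu_{\langle f_i,f_j\rangle}}{d\nu}(x)\big)_{i,j=1}^N\le p(x)$ for $\nu$-a.e. $x$; the index is $p=\nu\text{-}\operatorname{ess\,sup}_x p(x)$. These notions do not depend on the choice of $\nu$. *)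

theory Defs
  imports "HOL-Analysis.Analysis" "HOL-Probability.Probability" "Jordan_Normal_Form.DL_Rank"
begin

definition L2fun :: "'a measure \<Rightarrow> ('a \<Rightarrow> real) \<Rightarrow> bool" where
  "L2fun m f \<longleftrightarrow> f \<in> borel_measurable m \<and> integrable m (\<lambda>x. (f x)^2)"

definition Cc :: "('a::topological_space \<Rightarrow> real) \<Rightarrow> bool" where
  "Cc f \<longleftrightarrow> continuous_on UNIV f \<and> compact (closure {x. f x \<noteq> 0})"

definition msupp :: "'a::topological_space measure \<Rightarrow> ('a \<Rightarrow> real) \<Rightarrow> 'a set" where
  "msupp m f = {x. \<forall>U. open U \<and> x \<in> U \<longrightarrow> (\<integral>\<^sup>+ y\<in>U. ennreal \<bar>f y\<bar> \<partial>m) > 0}"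

definition E1norm :: "'a measure \<Rightarrow> (('a \<Rightarrow> real) \<Rightarrow> ('a \<Rightarrow> real) \<Rightarrow> real) \<Rightarrow> ('a \<Rightarrow> real) \<Rightarrow> real" where
  "E1norm m E h = sqrt (E h h + integral\<^sup>L m (\<lambda>x. (h x)^2))"

text \<open>Elements of L^2(X;m) are represented by functions; F is required to be closed
  under m-a.e. modification and E to only depend on the m-a.e. class.\<close>
definition dirichlet_form ::
  "'a measure \<Rightarrow> ('a \<Rightarrow> real) set \<Rightarrow> (('a \<Rightarrow> real) \<Rightarrow> ('a \<Rightarrow> real) \<Rightarrow> real) \<Rightarrow> bool" where
  "dirichlet_form m F E \<longleftrightarrow>
     (\<forall>f\<in>F. L2fun m f) \<and>
     (\<forall>f g. f \<in> F \<longrightarrow> g \<in> borel_measurable m \<longrightarrow> (AE x in m. f x = g x) \<longrightarrow>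
        g \<in> F \<and> (\<forall>h\<in>F. E g h = E f h \<and> E h g = E h f)) \<and>
     (\<lambda>x. 0) \<in> F \<and>
     (\<forall>f\<in>F. \<forall>g\<in>F. (\<lambda>x. f x + g x) \<in> F) \<and>
     (\<forall>f\<in>F. \<forall>c::real. (\<lambda>x. c * f x) \<in> F) \<and>
     (\<forall>f. L2fun m f \<longrightarrow> (\<forall>\<epsilon>>0. \<exists>g\<in>F. integral\<^sup>L m (\<lambda>x. (f x - g x)^2) < \<epsilon>)) \<and>
     (\<forall>f\<in>F. \<forall>g\<in>F. E f g = E g f) \<and>
     (\<forall>f\<in>F. \<forall>g\<in>F. \<forall>h\<in>F. E (\<lambda>x. f x + g x) h = E f h + E g h) \<and>
     (\<forall>f\<in>F. \<forall>g\<in>F. \<forall>c::real. E (\<lambda>x. c * f x) g = c * E f g) \<and>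
     (\<forall>f\<in>F. E f f \<ge> 0) \<and>
     \<comment> \<open>closedness: (F, E_1) is complete\<close>
     (\<forall>u::nat \<Rightarrow> ('a \<Rightarrow> real). (\<forall>n. u n \<in> F) \<longrightarrow>
        (\<forall>\<epsilon>>0. \<exists>N. \<forall>i\<ge>N. \<forall>j\<ge>N. E1norm m E (\<lambda>x. u i x - u j x) < \<epsilon>) \<longrightarrow>
        (\<exists>f\<in>F. (\<lambda>n. E1norm m E (\<lambda>x. u n x - f x)) \<longlonglongrightarrow> 0)) \<and>
     \<comment> \<open>Markov property (unit contraction)\<close>
     (\<forall>f\<in>F. (\<lambda>x. min 1 (max 0 (f x))) \<in> F \<and>
        E (\<lambda>x. min 1 (max 0 (f x))) (\<lambda>x. min 1 (max 0 (f x))) \<le> E f f)"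

definition regular_df ::
  "'a::topological_space measure \<Rightarrow> ('a \<Rightarrow> real) set \<Rightarrow> (('a \<Rightarrow> real) \<Rightarrow> ('a \<Rightarrow> real) \<Rightarrow> real) \<Rightarrow> bool" where
  "regular_df m F E \<longleftrightarrow>
     (\<forall>f\<in>F. \<forall>\<epsilon>>0. \<exists>g\<in>F. Cc g \<and> E1norm m E (\<lambda>x. f x - g x) < \<epsilon>) \<and>
     (\<forall>f. Cc f \<longrightarrow> (\<forall>\<epsilon>>0. \<exists>g\<in>F. Cc g \<and> (\<forall>x. \<bar>f x - g x\<bar> < \<epsilon>)))"

definition strong_local ::
  "'a::topological_space measure \<Rightarrow> ('a \<Rightarrow> real) set \<Rightarrow> (('a \<Rightarrow> real) \<Rightarrow> ('a \<Rightarrow> real) \<Rightarrow> real) \<Rightarrow> bool" where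
  "strong_local m F E \<longleftrightarrow>
     (\<forall>f\<in>F. \<forall>g\<in>F. compact (msupp m f) \<and> compact (msupp m g) \<and>
        (\<exists>U c. open U \<and> msupp m f \<subseteq> U \<and> (AE x in m. x \<in> U \<longrightarrow> g x = c)) \<longrightarrow> E f g = 0)"

definition emeas_bdd ::
  "('a::topological_space \<Rightarrow> real) set \<Rightarrow> (('a \<Rightarrow> real) \<Rightarrow> ('a \<Rightarrow> real) \<Rightarrow> real) \<Rightarrow> ('a \<Rightarrow> real) \<Rightarrow> 'a measure" where
  "emeas_bdd F E f = (SOME \<mu>. sets \<mu> = sets borel \<and> finite_measure \<mu> \<and>
      (\<forall>\<phi>\<in>F. Cc \<phi> \<longrightarrow> integral\<^sup>L \<mu> \<phi> =
         2 * E (\<lambda>x. f x * \<phi> x) f - E \<phi> (\<lambda>x. (f x)^2)))"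

definition emeas ::
  "'a::topological_space measure \<Rightarrow> ('a \<Rightarrow> real) set \<Rightarrow> (('a \<Rightarrow> real) \<Rightarrow> ('a \<Rightarrow> real) \<Rightarrow> real) \<Rightarrow> ('a \<Rightarrow> real) \<Rightarrow> 'a measure" where
  "emeas m F E f = (SOME \<mu>. sets \<mu> = sets borel \<and> finite_measure \<mu> \<and>
      (\<forall>u::nat \<Rightarrow> ('a \<Rightarrow> real). (\<forall>n. u n \<in> F \<and> bounded (range (u n))) \<longrightarrow>
         (\<lambda>n. E1norm m E (\<lambda>x. u n x - f x)) \<longlonglongrightarrow> 0 \<longrightarrow>
         (\<forall>A\<in>sets borel. (\<lambda>n. measure (emeas_bdd F E (u n)) A) \<longlonglongrightarrow> measure \<mu> A)))"

text \<open>Density d mu_<f,g> / d nu, with mu_<f,g> = (mu_<f+g> - mu_<f> - mu_<g>)/2.\<close>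
definition edens ::
  "'a::topological_space measure \<Rightarrow> ('a \<Rightarrow> real) set \<Rightarrow> (('a \<Rightarrow> real) \<Rightarrow> ('a \<Rightarrow> real) \<Rightarrow> real) \<Rightarrow> 'a measure
     \<Rightarrow> ('a \<Rightarrow> real) \<Rightarrow> ('a \<Rightarrow> real) \<Rightarrow> 'a \<Rightarrow> real" where
  "edens m F E \<nu> f g x =
     (enn2real (RN_deriv \<nu> (emeas m F E (\<lambda>y. f y + g y)) x)
      - enn2real (RN_deriv \<nu> (emeas m F E f) x)
      - enn2real (RN_deriv \<nu> (emeas m F E g) x)) / 2"

definition energy_dominant ::
  "'a::topological_space measure \<Rightarrow> ('a \<Rightarrow> real) set \<Rightarrow> (('a \<Rightarrow> real) \<Rightarrow> ('a \<Rightarrow> real) \<Rightarrow> real) \<Rightarrow> 'a measure \<Rightarrow> bool" where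
  "energy_dominant m F E \<nu> \<longleftrightarrow> sigma_finite_measure \<nu> \<and> sets \<nu> = sets borel \<and>
     (\<forall>f\<in>F. absolutely_continuous \<nu> (emeas m F E f))"

definition medm ::
  "'a::topological_space measure \<Rightarrow> ('a \<Rightarrow> real) set \<Rightarrow> (('a \<Rightarrow> real) \<Rightarrow> ('a \<Rightarrow> real) \<Rightarrow> real) \<Rightarrow> 'a measure \<Rightarrow> bool" where
  "medm m F E \<nu> \<longleftrightarrow> energy_dominant m F E \<nu> \<and>
     (\<forall>\<nu>'. energy_dominant m F E \<nu>' \<longrightarrow> absolutely_continuous \<nu>' \<nu>)"

definition energy_matrix ::
  "'a::topological_space measure \<Rightarrow> ('a \<Rightarrow> real) set \<Rightarrow> (('a \<Rightarrow> real) \<Rightarrow> ('a \<Rightarrow> real) \<Rightarrow> real) \<Rightarrow> 'a measure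
     \<Rightarrow> nat \<Rightarrow> (nat \<Rightarrow> ('a \<Rightarrow> real)) \<Rightarrow> 'a \<Rightarrow> real mat" where
  "energy_matrix m F E \<nu> N fs x = mat N N (\<lambda>(i,j). edens m F E \<nu> (fs i) (fs j) x)"

definition rank_bound ::
  "'a::topological_space measure \<Rightarrow> ('a \<Rightarrow> real) set \<Rightarrow> (('a \<Rightarrow> real) \<Rightarrow> ('a \<Rightarrow> real) \<Rightarrow> real) \<Rightarrow> 'a measure
     \<Rightarrow> ('a \<Rightarrow> enat) \<Rightarrow> bool" where
  "rank_bound m F E \<nu> q \<longleftrightarrow> q \<in> measurable (completion \<nu>) (count_space UNIV) \<and>
     (\<forall>N fs. (\<forall>i<N. fs i \<in> F) \<longrightarrow>
        (AE x in \<nu>. enat (vec_space.rank N (energy_matrix m F E \<nu> N fs x)) \<le> q x))"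

definition pointwise_index ::
  "'a::topological_space measure \<Rightarrow> ('a \<Rightarrow> real) set \<Rightarrow> (('a \<Rightarrow> real) \<Rightarrow> ('a \<Rightarrow> real) \<Rightarrow> real) \<Rightarrow> 'a measure
     \<Rightarrow> ('a \<Rightarrow> enat) \<Rightarrow> bool" where
  "pointwise_index m F E \<nu> p \<longleftrightarrow> rank_bound m F E \<nu> p \<and>
     (\<forall>q. rank_bound m F E \<nu> q \<longrightarrow> (AE x in \<nu>. p x \<le> q x))"

definition dindex :: "'a measure \<Rightarrow> ('a \<Rightarrow> enat) \<Rightarrow> enat" where
  "dindex \<nu> p = (LEAST k. AE x in \<nu>. p x \<le> k)"

definition Gset ::
  "'a::topological_space measure \<Rightarrow> ('a \<Rightarrow> real) set \<Rightarrow> (('a \<Rightarrow> real) \<Rightarrow> ('a \<Rightarrow> real) \<Rightarrow> real) \<Rightarrow> 'a measure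
     \<Rightarrow> ('a \<Rightarrow> enat) \<Rightarrow> nat \<Rightarrow> (nat \<Rightarrow> ('a \<Rightarrow> real)) set" where
  "Gset m F E \<nu> p n = {g. (\<forall>i<n. g i \<in> F) \<and>
     (AE x in \<nu>. \<exists>k. p x = enat k \<and> k \<le> n \<and> invertible_mat (energy_matrix m F E \<nu> k g x))}"

definition Ghat ::
  "'a::topological_space measure \<Rightarrow> ('a \<Rightarrow> real) set \<Rightarrow> (('a \<Rightarrow> real) \<Rightarrow> ('a \<Rightarrow> real) \<Rightarrow> real) \<Rightarrow> 'a measure
     \<Rightarrow> ('a \<Rightarrow> enat) \<Rightarrow> nat \<Rightarrow> (nat \<Rightarrow> ('a \<Rightarrow> real)) set" where
  "Ghat m F E \<nu> p n = {g \<in> Gset m F E \<nu> p n. \<forall>i<n. medm m F E (emeas m F E (g i))}"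

definition dense_in_Fn ::
  "'a measure \<Rightarrow> ('a \<Rightarrow> real) set \<Rightarrow> (('a \<Rightarrow> real) \<Rightarrow> ('a \<Rightarrow> real) \<Rightarrow> real) \<Rightarrow> nat
     \<Rightarrow> (nat \<Rightarrow> ('a \<Rightarrow> real)) set \<Rightarrow> bool" where
  "dense_in_Fn m F E n S \<longleftrightarrow>
     (\<forall>f. (\<forall>i<n. f i \<in> F) \<longrightarrow> (\<forall>\<epsilon>>0. \<exists>g\<in>S. \<forall>i<n. E1norm m E (\<lambda>x. g i x - f i x) < \<epsilon>))"

end

theory Submission
  imports Defs
begin

text \<open>The form is the limit of the forms \<open>(f, g) \<mapsto> b (f - R f, g)\<close>, where \<open>R\<close> is the Markovian resolvent with parameter
  \<open>b\<close>. Hence, for bounded \<open>f\<close>, the functional \<open>\<phi> \<mapsto> 2 E(f \<phi>, f) - E(\<phi>, f\<^sup>2)\<close> is a limit of integrals against nonnegative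
  densities of mass at most \<open>2 E(f, f)\<close>, and the Riesz representation theorem yields the energy measures. They form
  a bounded quadratic form in \<open>f\<close>, so that almost everywhere the densities \<open>d\<mu>\<langle>f, g\<rangle> / d\<nu>\<close> are positive semidefinite and
  depend continuously on \<open>f\<close>.

  There is a sequence \<open>h\<close> in \<open>F\<close> whose Gram determinants detect, up to null sets, the points where any given tuple
  is independent; the pointwise index is then at most the number of independent members of \<open>h\<close>. Suppose that
  \<open>g\<^sub>1, \<dots>, g\<^sub>i\<close> are independent wherever \<open>i\<close> members of \<open>h\<close> are. The functions \<open>u\<close> for which \<open>g\<^sub>1, \<dots>, g\<^sub>i, u\<close> are independent
  wherever \<open>i + 1\<close> members of \<open>h\<close> are, except on a set of measure less than \<open>\<eta>\<close>, form an open set. It is dense: along the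
  moment curve \<open>u + \<Sum>k<K. t\<^sup>k\<^sup>+\<^sup>1 h\<^sub>k\<close> every point is exceptional for at most \<open>K\<close> parameters \<open>t\<close>, so that some small \<open>t\<close> has
  a small exceptional set. By the Baire category theorem in the complete space \<open>F\<close> the tuple can be extended without any
  exceptional set, arbitrarily close to a prescribed function. Applied with the empty tuple in place of \<open>g\<^sub>1, \<dots>, g\<^sub>i\<close>, the
  same argument makes the density of the energy measure of \<open>u\<close> positive almost everywhere, which is minimal energy
  dominance.\<close>

section \<open>The form and its norm\<close>

text \<open>The definitions select energy measures by a choice operator, so nothing is known about
  them before existence is proved; this is why the construction of the measures takes up so much
  room. The functional to be represented contains the products \<open>f \<phi>\<close> and
  \<open>f\<^sup>2\<close>, which must first be shown to lie in \<open>F\<close>. The resolvent is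
  available only as a minimiser, up to null sets and without a kernel, so its pointwise inequalities
  go through rational parameters. For the densities the obstacle is that every relation between them
  has a null set depending on the functions involved, while the index varies from point to point. A
  tuple therefore cannot be built by linear algebra at each point. Instead, failure is measured: a
  finite measure with the null sets of \<open>\<nu>\<close> makes small exceptional sets meaningful,
  and they can then be removed by category. Independence is demanded of all leading segments of the
  tuple, because a point of index \<open>k\<close> looks only at the leading minor of size
  \<open>k\<close>.\<close>

lemma sq_le_of_quadratic_nonneg:
  fixes a b c :: real
  assumes q: "\<And>t. 0 \<le> a + 2 * t * b + t\<^sup>2 * c"
  shows "b\<^sup>2 \<le> a * c"
proof (cases "c = 0")
  case True
  have "b = 0"
  proof (rule ccontr)
    assume "b \<noteq> 0"
    \<comment> \<open>For this parameter the affine function takes the value -1.\<close>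
    with q[of "- (a + 1) / (2 * b)"] True show False by (simp add: field_simps)
  qed
  with True show ?thesis by simp
next
  case False
  have "0 \<le> c"
  proof (rule ccontr)
    assume c: "\<not> 0 \<le> c"
    \<comment> \<open>Chosen so that \<open>t * (- c)\<close> is at least
      \<open>\<bar>a\<bar> + 2 * \<bar>b\<bar> + 1\<close>; with \<open>t \<ge> 1\<close> the
      quadratic term then outweighs the other two.\<close>
    define t where "t = max 1 ((\<bar>a\<bar> + 2 * \<bar>b\<bar> + 1) / (- c))"
    have t: "1 \<le> t" "(\<bar>a\<bar> + 2 * \<bar>b\<bar> + 1) \<le> t * (- c)"
      using c by (auto simp: t_def max_def field_simps)
    have "t * (\<bar>a\<bar> + 2 * \<bar>b\<bar> + 1) \<le> t * (t * (- c))"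
      using t by (intro mult_left_mono) auto
    moreover have "t * (\<bar>a\<bar> + 2 * \<bar>b\<bar> + 1) \<ge> \<bar>a\<bar> + 2 * t * \<bar>b\<bar> + 1"
    proof -
      have "1 * (\<bar>a\<bar> + 1) \<le> t * (\<bar>a\<bar> + 1)" using t by (intro mult_right_mono) auto
      then show ?thesis by (simp add: algebra_simps)
    qed
    moreover have "a + 2 * t * b \<le> \<bar>a\<bar> + 2 * t * \<bar>b\<bar>"
      using t by (intro add_mono mult_left_mono) auto
    ultimately show False using q[of t] by (simp add: power2_eq_square algebra_simps)
  qed
  with False have c: "c > 0" by simp
  have "0 \<le> a + 2 * (- b / c) * b + (- b / c)\<^sup>2 * c" by (rule q)
  also have "\<dots> = a - b\<^sup>2 / c" using c by (simp add: power2_eq_square field_simps)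
  finally show ?thesis using c by (simp add: field_simps)
qed

section \<open>Square-integrable functions\<close>

lemma L2fun_add:
  assumes "L2fun m f" "L2fun m g"
  shows "L2fun m (\<lambda>x. f x + g x)"
proof -
  have [measurable]: "f \<in> borel_measurable m" "g \<in> borel_measurable m"
    using assms by (auto simp: L2fun_def)
  have "integrable m (\<lambda>x. (f x + g x)\<^sup>2)"
  proof (rule Bochner_Integration.integrable_bound)
    show "integrable m (\<lambda>x. 2 * (f x)\<^sup>2 + 2 * (g x)\<^sup>2)"
      using assms by (auto simp: L2fun_def)
    have "(f x + g x)\<^sup>2 \<le> 2 * (f x)\<^sup>2 + 2 * (g x)\<^sup>2" for x
      using sum_squares_ge_zero[of "f x - g x" 0] by (simp add: power2_eq_square algebra_simps)
    then show "AE x in m. norm ((f x + g x)\<^sup>2) \<le> norm (2 * (f x)\<^sup>2 + 2 * (g x)\<^sup>2)" by auto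
  qed measurable
  then show ?thesis by (simp add: L2fun_def)
qed

lemma L2fun_scale: "L2fun m f \<Longrightarrow> L2fun m (\<lambda>x. c * f x)"
  by (auto simp: L2fun_def power_mult_distrib)

lemma L2fun_diff: "L2fun m f \<Longrightarrow> L2fun m g \<Longrightarrow> L2fun m (\<lambda>x. f x - g x)"
  using L2fun_add[OF _ L2fun_scale[of m g "-1"], of f] by simp

lemma L2fun_integrable_mult:
  assumes "L2fun m f" "L2fun m g"
  shows "integrable m (\<lambda>x. f x * g x)"
proof (rule Bochner_Integration.integrable_bound)
  show "integrable m (\<lambda>x. (f x)\<^sup>2 + (g x)\<^sup>2)"
    using assms by (auto simp: L2fun_def)
  have *: "\<bar>a * b\<bar> \<le> a\<^sup>2 + b\<^sup>2" for a b :: real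
    using sum_squares_ge_zero[of "a - b" 0] sum_squares_ge_zero[of "a + b" 0]
    by (auto simp: power2_eq_square algebra_simps abs_if)
  show "AE x in m. norm (f x * g x) \<le> norm ((f x)\<^sup>2 + (g x)\<^sup>2)"
    using * by auto
qed (use assms in \<open>auto simp: L2fun_def\<close>)

lemma L2fun_bounded_mult:
  assumes "L2fun m f" "g \<in> borel_measurable m" "\<And>x. \<bar>g x\<bar> \<le> M"
  shows "L2fun m (\<lambda>x. f x * g x)"
proof -
  have [measurable]: "f \<in> borel_measurable m" "g \<in> borel_measurable m"
    using assms by (auto simp: L2fun_def)
  have "integrable m (\<lambda>x. (f x * g x)\<^sup>2)"
  proof (rule Bochner_Integration.integrable_bound)
    show "integrable m (\<lambda>x. M\<^sup>2 * (f x)\<^sup>2)"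
      using assms by (auto simp: L2fun_def)
    have "(f x * g x)\<^sup>2 \<le> M\<^sup>2 * (f x)\<^sup>2" for x
      using power_mono[OF assms(3)[of x], of 2]
      by (simp add: power_mult_distrib mult.commute[of "(f x)\<^sup>2"] mult_right_mono)
    then show "AE x in m. norm ((f x * g x)\<^sup>2) \<le> norm (M\<^sup>2 * (f x)\<^sup>2)" by auto
  qed measurable
  then show ?thesis by (simp add: L2fun_def)
qed

locale dform =
  fixes m :: "'a measure" and F :: "('a \<Rightarrow> real) set"
    and E :: "('a \<Rightarrow> real) \<Rightarrow> ('a \<Rightarrow> real) \<Rightarrow> real"
  assumes df: "dirichlet_form m F E"
begin

abbreviation ip :: "('a \<Rightarrow> real) \<Rightarrow> ('a \<Rightarrow> real) \<Rightarrow> real" where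
  "ip f g \<equiv> integral\<^sup>L m (\<lambda>x. f x * g x)"

lemmas df_unfolded = df[unfolded dirichlet_form_def]
lemmas df1 = df_unfolded[THEN conjunct1]
lemmas df2 = df_unfolded[THEN conjunct2, THEN conjunct1]
lemmas df3 = df_unfolded[THEN conjunct2, THEN conjunct2, THEN conjunct1]
lemmas df4 = df_unfolded[THEN conjunct2, THEN conjunct2, THEN conjunct2, THEN conjunct1]
lemmas df5 = df_unfolded[THEN conjunct2, THEN conjunct2, THEN conjunct2, THEN conjunct2, THEN conjunct1]
lemmas df7 = df_unfolded[THEN conjunct2, THEN conjunct2, THEN conjunct2, THEN conjunct2, THEN conjunct2, THEN conjunct2, THEN conjunct1]
lemmas df8 = df_unfolded[THEN conjunct2, THEN conjunct2, THEN conjunct2, THEN conjunct2, THEN conjunct2, THEN conjunct2, THEN conjunct2, THEN conjunct1]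
lemmas df9 = df_unfolded[THEN conjunct2, THEN conjunct2, THEN conjunct2, THEN conjunct2, THEN conjunct2, THEN conjunct2, THEN conjunct2, THEN conjunct2, THEN conjunct1]
lemmas df10 = df_unfolded[THEN conjunct2, THEN conjunct2, THEN conjunct2, THEN conjunct2, THEN conjunct2, THEN conjunct2, THEN conjunct2, THEN conjunct2, THEN conjunct2, THEN conjunct1]
lemmas df11 = df_unfolded[THEN conjunct2, THEN conjunct2, THEN conjunct2, THEN conjunct2, THEN conjunct2, THEN conjunct2, THEN conjunct2, THEN conjunct2, THEN conjunct2, THEN conjunct2, THEN conjunct1]
lemmas df12 = df_unfolded[THEN conjunct2, THEN conjunct2, THEN conjunct2, THEN conjunct2, THEN conjunct2, THEN conjunct2, THEN conjunct2, THEN conjunct2, THEN conjunct2, THEN conjunct2, THEN conjunct2]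

lemma F_L2: "f \<in> F \<Longrightarrow> L2fun m f"
  using df1 by blast

lemma F_meas[measurable_dest]: "f \<in> F \<Longrightarrow> f \<in> borel_measurable m"
  using F_L2 by (auto simp: L2fun_def)

lemma F_AE:
  assumes "f \<in> F" "g \<in> borel_measurable m" "AE x in m. f x = g x"
  shows "g \<in> F" "h \<in> F \<Longrightarrow> E g h = E f h" "h \<in> F \<Longrightarrow> E h g = E h f"
  using df2 assms by blast+

lemma F_zero[simp]: "(\<lambda>x. 0) \<in> F"
  using df3 by blast

lemma F_add: "f \<in> F \<Longrightarrow> g \<in> F \<Longrightarrow> (\<lambda>x. f x + g x) \<in> F"
  using df4 by blast

lemma F_scale: "f \<in> F \<Longrightarrow> (\<lambda>x. c * f x) \<in> F"
  using df5 by blast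

lemma F_diff: "f \<in> F \<Longrightarrow> g \<in> F \<Longrightarrow> (\<lambda>x. f x - g x) \<in> F"
  using F_add[OF _ F_scale[of g "-1"], of f] by simp

lemma F_sum: "(\<And>i. i \<in> I \<Longrightarrow> f i \<in> F) \<Longrightarrow> (\<lambda>x. \<Sum>i\<in>I. f i x) \<in> F"
  by (induction I rule: infinite_finite_induct) (auto simp: F_add)

lemma E_sym: "f \<in> F \<Longrightarrow> g \<in> F \<Longrightarrow> E f g = E g f"
  using df7 by blast

lemma E_add: "f \<in> F \<Longrightarrow> g \<in> F \<Longrightarrow> h \<in> F \<Longrightarrow> E (\<lambda>x. f x + g x) h = E f h + E g h"
  using df8 by blast

lemma E_scale: "f \<in> F \<Longrightarrow> h \<in> F \<Longrightarrow> E (\<lambda>x. c * f x) h = c * E f h"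
  using df9 by blast

lemma E_nonneg: "f \<in> F \<Longrightarrow> 0 \<le> E f f"
  using df10 by blast

lemma E_diff: "f \<in> F \<Longrightarrow> g \<in> F \<Longrightarrow> h \<in> F \<Longrightarrow> E (\<lambda>x. f x - g x) h = E f h - E g h"
  using E_add[OF _ F_scale[of g "-1"], of f h] E_scale[of g h "-1"] by simp

lemma E_addr: "f \<in> F \<Longrightarrow> g \<in> F \<Longrightarrow> h \<in> F \<Longrightarrow> E h (\<lambda>x. f x + g x) = E h f + E h g"
  by (simp add: E_sym[of h] F_add E_add)

lemma E_scaler: "f \<in> F \<Longrightarrow> h \<in> F \<Longrightarrow> E h (\<lambda>x. c * f x) = c * E h f"
  by (simp add: E_sym[of h] F_scale E_scale)

lemma E_diffr: "f \<in> F \<Longrightarrow> g \<in> F \<Longrightarrow> h \<in> F \<Longrightarrow> E h (\<lambda>x. f x - g x) = E h f - E h g"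
  by (simp add: E_sym[of h] F_diff E_diff)

lemmas E_lin = E_add E_addr E_scale E_scaler E_diff E_diffr F_add F_scale F_diff

lemma F_complete:
  assumes "\<And>n. u n \<in> F"
    and "\<And>\<epsilon>. \<epsilon> > 0 \<Longrightarrow> \<exists>N. \<forall>i\<ge>N. \<forall>j\<ge>N. E1norm m E (\<lambda>x. u i x - u j x) < \<epsilon>"
  obtains f where "f \<in> F" "(\<lambda>n. E1norm m E (\<lambda>x. u n x - f x)) \<longlonglongrightarrow> 0"
  using df11[rule_format, of u] assms by blast

lemma F_clip: "f \<in> F \<Longrightarrow> (\<lambda>x. min 1 (max 0 (f x))) \<in> F"
  and E_clip: "f \<in> F \<Longrightarrow> E (\<lambda>x. min 1 (max 0 (f x))) (\<lambda>x. min 1 (max 0 (f x))) \<le> E f f"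
  using df12 by blast+

lemma E_expand:
  assumes "f \<in> F" "g \<in> F"
  shows "E (\<lambda>x. f x + t * g x) (\<lambda>x. f x + t * g x) = E f f + 2 * t * E f g + t\<^sup>2 * E g g"
  using assms by (simp add: E_lin E_sym[of g f] power2_eq_square algebra_simps)

lemma E_CS: "f \<in> F \<Longrightarrow> g \<in> F \<Longrightarrow> (E f g)\<^sup>2 \<le> E f f * E g g"
  using E_expand[of f g] by (intro sq_le_of_quadratic_nonneg) (metis E_nonneg F_add F_scale)

lemma ip_add: "L2fun m f \<Longrightarrow> L2fun m g \<Longrightarrow> L2fun m h \<Longrightarrow> ip (\<lambda>x. f x + g x) h = ip f h + ip g h"
  by (simp add: ring_distribs L2fun_integrable_mult)

lemma ip_diff: "L2fun m f \<Longrightarrow> L2fun m g \<Longrightarrow> L2fun m h \<Longrightarrow> ip (\<lambda>x. f x - g x) h = ip f h - ip g h"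
  by (simp add: left_diff_distrib L2fun_integrable_mult)

lemma ip_sym: "ip f g = ip g f"
  by (simp add: mult.commute)

lemma ip_addr: "L2fun m f \<Longrightarrow> L2fun m g \<Longrightarrow> L2fun m h \<Longrightarrow> ip h (\<lambda>x. f x + g x) = ip h f + ip h g"
  by (simp add: ring_distribs L2fun_integrable_mult)

lemma ip_diffr: "L2fun m f \<Longrightarrow> L2fun m g \<Longrightarrow> L2fun m h \<Longrightarrow> ip h (\<lambda>x. f x - g x) = ip h f - ip h g"
  by (simp add: right_diff_distrib L2fun_integrable_mult)

lemma ip_scale: "ip (\<lambda>x. c * f x) h = c * ip f h" 
  by (simp add: mult.assoc)

lemma ip_scaler: "ip h (\<lambda>x. c * f x) = c * ip h f" 
  by (simp add: mult.left_commute)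

lemmas ip_lin = ip_add ip_addr ip_diff ip_diffr ip_scale ip_scaler L2fun_add L2fun_diff L2fun_scale

lemma ip_nonneg: "0 \<le> ip f f"
  by simp

lemma ip_CS:
  assumes "L2fun m f" "L2fun m g"
  shows "(ip f g)\<^sup>2 \<le> ip f f * ip g g"
proof (rule sq_le_of_quadratic_nonneg)
  fix t
  have "ip (\<lambda>x. f x + t * g x) (\<lambda>x. f x + t * g x) = ip f f + 2 * t * ip f g + t\<^sup>2 * ip g g"
    using assms by (simp only: ip_lin ip_sym[of g f]) (simp add: power2_eq_square algebra_simps)
  then show "0 \<le> ip f f + 2 * t * ip f g + t\<^sup>2 * ip g g"
    using ip_nonneg[of "\<lambda>x. f x + t * g x"] by simp
qed

lemma ip_zero_AE: "L2fun m f \<Longrightarrow> ip f f = 0 \<Longrightarrow> AE x in m. f x = 0"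
  using integral_nonneg_eq_0_iff_AE[of m "\<lambda>x. f x * f x"] L2fun_integrable_mult[of m f f] by simp

lemma E1norm_sq: "f \<in> F \<Longrightarrow> (E1norm m E f)\<^sup>2 = E f f + ip f f"
  unfolding E1norm_def using E_nonneg[of f] by (simp add: power2_eq_square[symmetric])

lemma E1norm_nonneg: "0 \<le> E1norm m E f" if "f \<in> F"
  unfolding E1norm_def using E_nonneg[OF that] by simp

lemma E1norm_tendsto_iff:
  assumes "\<And>n. u n \<in> F"
  shows "((\<lambda>n. E1norm m E (u n)) \<longlonglongrightarrow> 0) \<longleftrightarrow> (\<lambda>n. E (u n) (u n)) \<longlonglongrightarrow> 0 \<and> (\<lambda>n. ip (u n) (u n)) \<longlonglongrightarrow> 0"
proof
  assume "(\<lambda>n. E1norm m E (u n)) \<longlonglongrightarrow> 0"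
  then have "(\<lambda>n. (E1norm m E (u n))\<^sup>2) \<longlonglongrightarrow> 0" using tendsto_power[of _ 0 _ 2] by force
  then have *: "(\<lambda>n. E (u n) (u n) + ip (u n) (u n)) \<longlonglongrightarrow> 0" using E1norm_sq[OF assms] by simp
  show "(\<lambda>n. E (u n) (u n)) \<longlonglongrightarrow> 0 \<and> (\<lambda>n. ip (u n) (u n)) \<longlonglongrightarrow> 0"
    using E_nonneg[OF assms] ip_nonneg
    by (auto intro!: tendsto_sandwich[OF _ _ tendsto_const *])
next
  assume "(\<lambda>n. E (u n) (u n)) \<longlonglongrightarrow> 0 \<and> (\<lambda>n. ip (u n) (u n)) \<longlonglongrightarrow> 0"
  then have "(\<lambda>n. E (u n) (u n) + ip (u n) (u n)) \<longlonglongrightarrow> 0 + 0" by (intro tendsto_add) auto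
  then have "(\<lambda>n. sqrt (E (u n) (u n) + ip (u n) (u n))) \<longlonglongrightarrow> sqrt 0" by (intro tendsto_real_sqrt) simp
  then show "(\<lambda>n. E1norm m E (u n)) \<longlonglongrightarrow> 0" unfolding E1norm_def by (simp add: power2_eq_square)
qed

lemma abs_E_le: "f \<in> F \<Longrightarrow> g \<in> F \<Longrightarrow> \<bar>E f g\<bar> \<le> sqrt (E f f) * sqrt (E g g)"
  using E_CS[of f g] by (metis real_sqrt_abs real_sqrt_le_iff real_sqrt_mult)

lemma abs_ip_le: "L2fun m f \<Longrightarrow> L2fun m g \<Longrightarrow> \<bar>ip f g\<bar> \<le> sqrt (ip f f) * sqrt (ip g g)"
  using ip_CS[of f g] by (metis real_sqrt_abs real_sqrt_le_iff real_sqrt_mult)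

lemma E_tendsto:
  assumes "\<And>n. u n \<in> F" "f \<in> F" "g \<in> F" "(\<lambda>n. E1norm m E (\<lambda>x. u n x - f x)) \<longlonglongrightarrow> 0"
  shows "(\<lambda>n. E (u n) g) \<longlonglongrightarrow> E f g"
proof -
  have 1: "(\<lambda>n. E (\<lambda>x. u n x - f x) (\<lambda>x. u n x - f x)) \<longlonglongrightarrow> 0"
    using assms E1norm_tendsto_iff[of "\<lambda>n x. u n x - f x"] by (simp add: F_diff)
  have 2: "(\<lambda>n. sqrt (E (\<lambda>x. u n x - f x) (\<lambda>x. u n x - f x)) * sqrt (E g g)) \<longlonglongrightarrow> sqrt 0 * sqrt (E g g)"
    by (intro tendsto_mult tendsto_real_sqrt 1 tendsto_const)
  have "(\<lambda>n. E (\<lambda>x. u n x - f x) g) \<longlonglongrightarrow> 0"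
    by (rule Lim_null_comparison[OF _ 2[simplified]]) (use assms in \<open>auto intro!: always_eventually abs_E_le F_diff\<close>)
  then have "(\<lambda>n. E (u n) g - E f g) \<longlonglongrightarrow> 0" using assms by (simp add: E_diff)
  then show ?thesis by (simp add: LIM_zero_iff)
qed

lemma ip_tendsto:
  assumes "\<And>n. L2fun m (u n)" "L2fun m f" "L2fun m g" "(\<lambda>n. ip (\<lambda>x. u n x - f x) (\<lambda>x. u n x - f x)) \<longlonglongrightarrow> 0"
  shows "(\<lambda>n. ip (u n) g) \<longlonglongrightarrow> ip f g"
proof -
  have 2: "(\<lambda>n. sqrt (ip (\<lambda>x. u n x - f x) (\<lambda>x. u n x - f x)) * sqrt (ip g g)) \<longlonglongrightarrow> sqrt 0 * sqrt (ip g g)"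
    by (intro tendsto_mult tendsto_real_sqrt assms(4) tendsto_const)
  have "(\<lambda>n. ip (\<lambda>x. u n x - f x) g) \<longlonglongrightarrow> 0"
    by (rule Lim_null_comparison[OF _ 2[simplified]]) (use assms in \<open>auto intro!: always_eventually abs_ip_le L2fun_diff\<close>)
  then have "(\<lambda>n. ip (u n) g - ip f g) \<longlonglongrightarrow> 0" using assms by (simp only: ip_diff)
  then show ?thesis by (simp add: LIM_zero_iff)
qed

text \<open>Both limits have the same inner product with their difference, whose norm is therefore
  zero.\<close>

lemma L2_limit_unique:
  assumes "\<And>n. L2fun m (u n)" "L2fun m f" "L2fun m g"
    "(\<lambda>n. ip (\<lambda>x. u n x - f x) (\<lambda>x. u n x - f x)) \<longlonglongrightarrow> 0"
    "(\<lambda>n. ip (\<lambda>x. u n x - g x) (\<lambda>x. u n x - g x)) \<longlonglongrightarrow> 0"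
  shows "AE x in m. f x = g x"
proof -
  let ?d = "\<lambda>x. f x - g x"
  have d: "L2fun m ?d" using assms by (intro L2fun_diff)
  have "(\<lambda>n. ip (u n) ?d) \<longlonglongrightarrow> ip f ?d" "(\<lambda>n. ip (u n) ?d) \<longlonglongrightarrow> ip g ?d"
    using assms d by (intro ip_tendsto; simp)+
  then have "ip f ?d = ip g ?d" by (rule LIMSEQ_unique)
  then have "ip ?d ?d = 0" using assms d ip_diff[of f g ?d] by simp
  from ip_zero_AE[OF d this] show ?thesis by simp
qed

text \<open>Cauchy-Schwarz for the sum of the two forms comes directly from the expansion of the
  squared norm along a line.\<close>

lemma E1norm_triangle:
  assumes f: "f \<in> F" and g: "g \<in> F"
  shows "E1norm m E (\<lambda>x. f x + g x) \<le> E1norm m E f + E1norm m E g"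
proof -
  define b where "b = E f g + ip f g"
  note L = F_L2[OF f] F_L2[OF g]
  have ex: "(E1norm m E (\<lambda>x. f x + t * g x))\<^sup>2 = (E1norm m E f)\<^sup>2 + 2 * t * b + t\<^sup>2 * (E1norm m E g)\<^sup>2" for t
  proof -
    have "ip (\<lambda>x. f x + t * g x) (\<lambda>x. f x + t * g x) = ip f f + 2 * t * ip f g + t\<^sup>2 * ip g g"
      using L by (simp only: ip_lin ip_sym[of g f]) (simp add: power2_eq_square algebra_simps)
    then show ?thesis
      unfolding E1norm_sq[OF f] E1norm_sq[OF g] E1norm_sq[OF F_add[OF f F_scale[OF g]]] b_def
      using E_expand[OF f g, of t] by (simp add: algebra_simps)
  qed
  have "b\<^sup>2 \<le> (E1norm m E f)\<^sup>2 * (E1norm m E g)\<^sup>2"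
    by (rule sq_le_of_quadratic_nonneg) (metis ex zero_le_power2)
  then have "b \<le> E1norm m E f * E1norm m E g"
    using E1norm_nonneg[OF f] E1norm_nonneg[OF g]
    by (metis abs_le_D1 abs_le_square_iff abs_of_nonneg mult_nonneg_nonneg power_mult_distrib)
  then have "(E1norm m E (\<lambda>x. f x + g x))\<^sup>2 \<le> (E1norm m E f + E1norm m E g)\<^sup>2"
    using ex[of 1] by (simp add: power2_sum)
  then show ?thesis
    using E1norm_nonneg[OF f] E1norm_nonneg[OF g] by (intro power2_le_imp_le[of "E1norm m E (\<lambda>x. f x + g x)"]) auto
qed

lemma E1norm_scale:
  assumes "f \<in> F"
  shows "E1norm m E (\<lambda>x. c * f x) = \<bar>c\<bar> * E1norm m E f"
  unfolding E1norm_def using assms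
  by (simp add: E_lin power_mult_distrib mult.assoc[symmetric] power2_eq_square[symmetric] distrib_left[symmetric] real_sqrt_mult)

lemma E1norm_zero: "E1norm m E (\<lambda>x. 0) = 0"
  using E1norm_scale[OF F_zero, of 0] by simp

lemma E1norm_sum_le:
  assumes "\<And>k. k < K \<Longrightarrow> h k \<in> F"
  shows "E1norm m E (\<lambda>x. \<Sum>k<(K::nat). h k x) \<le> (\<Sum>k<K. E1norm m E (h k))"
  using assms
proof (induction K)
  case (Suc K)
  have "E1norm m E (\<lambda>x. (\<Sum>k<K. h k x) + h K x) \<le> E1norm m E (\<lambda>x. \<Sum>k<K. h k x) + E1norm m E (h K)"
    using Suc.prems by (intro E1norm_triangle F_sum) auto
  with Suc show ?case by fastforce
qed (simp add: E1norm_zero)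

lemma E1dist_triangle:
  assumes "f \<in> F" "g \<in> F" "h \<in> F"
  shows "E1norm m E (\<lambda>x. f x - h x) \<le> E1norm m E (\<lambda>x. f x - g x) + E1norm m E (\<lambda>x. g x - h x)"
  using E1norm_triangle[OF F_diff[OF assms(1,2)] F_diff[OF assms(2,3)]] by simp

lemma E1dist_commute:
  assumes "f \<in> F" "g \<in> F"
  shows "E1norm m E (\<lambda>x. f x - g x) = E1norm m E (\<lambda>x. g x - f x)"
  using E1norm_scale[OF F_diff[OF assms], of "-1"] by simp

end

section \<open>Resolvents\<close>

context dform begin

text \<open>The Cauchy criterion in the shape its two uses deliver: for a minimising sequence
  \<open>r\<close> is the excess over the infimum, for a bounded monotone sequence of energies it is
  the distance to their limit.\<close>

lemma F_converge:
  assumes u: "\<And>n. u n \<in> F"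
    and r: "r \<longlonglongrightarrow> 0"
    and le: "\<And>i j. E (\<lambda>x. u i x - u j x) (\<lambda>x. u i x - u j x) + ip (\<lambda>x. u i x - u j x) (\<lambda>x. u i x - u j x) \<le> r i + r j"
  obtains f where "f \<in> F" "(\<lambda>n. E1norm m E (\<lambda>x. u n x - f x)) \<longlonglongrightarrow> 0"
proof (rule F_complete[OF u])
  fix e :: real assume e: "e > 0"
  then have "e\<^sup>2 / 2 > 0" by simp
  from LIMSEQ_D[OF r this] obtain N where N: "\<And>n. n \<ge> N \<Longrightarrow> \<bar>r n\<bar> < e\<^sup>2 / 2" by auto
  have "E1norm m E (\<lambda>x. u i x - u j x) < e" if "i \<ge> N" "j \<ge> N" for i j
  proof -
    have "(E1norm m E (\<lambda>x. u i x - u j x))\<^sup>2 \<le> r i + r j"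
      using le[of i j] by (subst E1norm_sq) (auto intro: F_diff u)
    also have "\<dots> < e\<^sup>2" using N[OF that(1)] N[OF that(2)] by linarith
    finally show ?thesis using e by (rule power2_less_imp_less[OF _ less_imp_le])
  qed
  then show "\<exists>N. \<forall>i\<ge>N. \<forall>j\<ge>N. E1norm m E (\<lambda>x. u i x - u j x) < e" by blast
qed

text \<open>The Euler-Lagrange equation of this functional is the weak resolvent equation for the
  parameter \<open>b\<close>.\<close>

definition resJ :: "real \<Rightarrow> ('a \<Rightarrow> real) \<Rightarrow> ('a \<Rightarrow> real) \<Rightarrow> real" where
  "resJ b g v = E v v + b * ip (\<lambda>x. v x - g x) (\<lambda>x. v x - g x)"

lemma resJ_expand:
  assumes "v \<in> F" "h \<in> F" "L2fun m g"
  shows "resJ b g (\<lambda>x. v x + t * h x) = resJ b g v + 2 * t * (E v h + b * ip (\<lambda>x. v x - g x) h)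
     + t\<^sup>2 * (E h h + b * ip h h)"
proof -
  note [simp] = F_L2[OF assms(1)] F_L2[OF assms(2)] assms(3)
  have eq: "(\<lambda>x. v x + t * h x - g x) = (\<lambda>x. (v x - g x) + t * h x)" by (auto simp: algebra_simps)
  have "ip (\<lambda>x. (v x - g x) + t * h x) (\<lambda>x. (v x - g x) + t * h x) =
      ip (\<lambda>x. v x - g x) (\<lambda>x. v x - g x) + 2 * t * ip (\<lambda>x. v x - g x) h + t\<^sup>2 * ip h h"
    using L2fun_diff[of m v g]
    by (simp only: ip_add ip_addr ip_scale ip_scaler L2fun_add L2fun_scale F_L2[OF assms(1)] F_L2[OF assms(2)] assms(3)
         ip_sym[of h "\<lambda>x. v x - g x"]) (simp add: power2_eq_square algebra_simps)
  then show ?thesis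
    unfolding resJ_def eq using E_expand[OF assms(1,2), of t] by (simp add: algebra_simps)
qed

lemma resJ_nonneg: "v \<in> F \<Longrightarrow> 0 < b \<Longrightarrow> 0 \<le> resJ b g v"
  unfolding resJ_def using E_nonneg by simp

text \<open>Minimising sequences of \<open>resJ b g\<close> are Cauchy by the parallelogram law.\<close>

lemma res_exists:
  assumes b: "b > 0" and g: "L2fun m g"
  shows "\<exists>u\<in>F. \<forall>v\<in>F. E u v = b * ip (\<lambda>x. g x - u x) v"
proof -
  define d where "d = Inf (resJ b g ` F)"
  have bdd: "bdd_below (resJ b g ` F)" using resJ_nonneg[OF _ b] by (auto intro!: bdd_belowI[of _ 0])
  have d_le: "d \<le> resJ b g v" if "v \<in> F" for v
    unfolding d_def using bdd that by (auto intro: cINF_lower)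
  have "\<exists>v\<in>F. resJ b g v < d + 1 / Suc n" for n
  proof -
    have "F \<noteq> {}" using F_zero by blast
    then show ?thesis
      using cInf_lessD[of "resJ b g ` F" "d + 1 / Suc n"]
      by (auto simp add: d_def[symmetric] simp del: of_nat_Suc)
  qed
  then obtain u where u: "\<And>n. u n \<in> F" "\<And>n. resJ b g (u n) < d + 1 / Suc n" by metis
  \<comment> \<open>The 2 comes from the midpoint comparison, and \<open>1 + 1 / b\<close> is the
    cost of replacing the weight \<open>b\<close> of the inner product by 1.\<close>
  define c where "c = 2 * (1 + 1 / b)"
  have lim: "(\<lambda>n. 1 / real (Suc n)) \<longlonglongrightarrow> 0" using LIMSEQ_inverse_real_of_nat by (simp add: inverse_eq_divide)
  have r: "(\<lambda>n. c * (1 / real (Suc n))) \<longlonglongrightarrow> 0" using tendsto_mult_right_zero[OF lim] .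
  obtain f where f: "f \<in> F" "(\<lambda>n. E1norm m E (\<lambda>x. u n x - f x)) \<longlonglongrightarrow> 0"
  proof (rule F_converge[OF u(1) r])
    fix i j
    let ?D = "\<lambda>x. u i x - u j x"
    have D: "?D \<in> F" using u by (intro F_diff)
    define X where "X = E (u j) ?D + b * ip (\<lambda>x. u j x - g x) ?D"
    define Y where "Y = E ?D ?D + b * ip ?D ?D"
    have "resJ b g (\<lambda>x. u j x + 1 * ?D x) = resJ b g (u j) + 2 * 1 * X + 1\<^sup>2 * Y"
      unfolding X_def Y_def by (rule resJ_expand[OF u(1) D g])
    then have 1: "resJ b g (u i) = resJ b g (u j) + 2 * X + Y" by simp
    have "resJ b g (\<lambda>x. u j x + (1/2) * ?D x) = resJ b g (u j) + 2 * (1/2) * X + (1/2)\<^sup>2 * Y"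
      unfolding X_def Y_def by (rule resJ_expand[OF u(1) D g])
    moreover have "d \<le> resJ b g (\<lambda>x. u j x + (1/2) * ?D x)"
      using u D by (intro d_le F_add F_scale)
    ultimately have 2: "d \<le> resJ b g (u j) + X + Y / 4" by (simp add: power2_eq_square)
    have Y: "Y \<le> 2 * (1 / Suc i) + 2 * (1 / Suc j)" using 1 2 u(2)[of i] u(2)[of j] by linarith
    have "E ?D ?D + ip ?D ?D \<le> (1 + 1 / b) * Y"
      using b E_nonneg[OF D] ip_nonneg[of ?D] unfolding Y_def by (simp add: field_simps)
    also have "\<dots> \<le> (1 + 1 / b) * (2 * (1 / Suc i) + 2 * (1 / Suc j))"
      using Y b by (intro mult_left_mono) auto
    also have "\<dots> = c * (1 / Suc i) + c * (1 / Suc j)" proof -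
      have "(1 + 1 / b) * (2 * p + 2 * q) = c * p + c * q" for p q
        unfolding c_def by (simp add: algebra_simps)
      then show ?thesis .
    qed
    finally show "E ?D ?D + ip ?D ?D \<le> c * (1 / Suc i) + c * (1 / Suc j)" .
  qed
  have "E f v = b * ip (\<lambda>x. g x - f x) v" if v: "v \<in> F" for v
  proof -
    define Q where "Q = E v v + b * ip v v"
    define L where "L n = E (u n) v + b * ip (\<lambda>x. u n x - g x) v" for n
    define L' where "L' = E f v + b * ip (\<lambda>x. f x - g x) v"
    have uL: "L2fun m (u n)" for n using u F_L2 by blast
    have "(\<lambda>n. ip (u n) v) \<longlonglongrightarrow> ip f v"
      using f u v F_L2 E1norm_tendsto_iff[of "\<lambda>n x. u n x - f x"] by (intro ip_tendsto) (auto intro: F_diff)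
    then have "(\<lambda>n. E (u n) v + b * (ip (u n) v - ip g v)) \<longlonglongrightarrow> E f v + b * (ip f v - ip g v)"
      using E_tendsto[OF u(1) f(1) v f(2)] by (intro tendsto_intros)
    then have Llim: "L \<longlonglongrightarrow> L'"
      unfolding L_def L'_def using g v f F_L2 uL by (simp only: ip_diff)
    \<comment> \<open>The first variation \<open>L'\<close> at the limit enters a nonnegative
      quadratic without constant term, so the discriminant bound makes it vanish.\<close>
    have "0 \<le> 0 + 2 * t * L' + t\<^sup>2 * Q" for t
    proof (rule LIMSEQ_le_const)
      show "(\<lambda>n. 1 / real (Suc n) + 2 * t * L n + t\<^sup>2 * Q) \<longlonglongrightarrow> 0 + 2 * t * L' + t\<^sup>2 * Q"
        by (intro tendsto_intros Llim lim)
      have "0 \<le> 1 / real (Suc n) + 2 * t * L n + t\<^sup>2 * Q" for n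
      proof -
        have "d \<le> resJ b g (\<lambda>x. u n x + t * v x)" using u v by (intro d_le F_add F_scale)
        also have "\<dots> = resJ b g (u n) + 2 * t * L n + t\<^sup>2 * Q"
          unfolding L_def Q_def by (rule resJ_expand[OF u(1) v g])
        finally show ?thesis using u(2)[of n] by linarith
      qed
      then show "\<exists>N. \<forall>n\<ge>N. 0 \<le> 1 / real (Suc n) + 2 * t * L n + t\<^sup>2 * Q" by blast
    qed
    from sq_le_of_quadratic_nonneg[OF this] have "L' = 0" by simp
    moreover have "ip (\<lambda>x. f x - g x) v = - ip (\<lambda>x. g x - f x) v"
      using f(1) g v F_L2 by (simp only: ip_diff)
    ultimately show ?thesis unfolding L'_def by simp
  qed
  with f(1) show ?thesis by blast
qed

text \<open>This is \<open>b\<close> times the classical resolvent, the normalisation that is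
  Markovian. The choice fixes one representative of a class modulo null sets, hence linearity and
  bounds hold only almost everywhere.\<close>

definition res :: "real \<Rightarrow> ('a \<Rightarrow> real) \<Rightarrow> ('a \<Rightarrow> real)" where
  "res b g = (SOME u. u \<in> F \<and> (\<forall>v\<in>F. E u v = b * ip (\<lambda>x. g x - u x) v))"

lemma res:
  assumes "b > 0" "L2fun m g"
  shows res_F: "res b g \<in> F" and res_L2: "L2fun m (res b g)"
    and res_eq: "v \<in> F \<Longrightarrow> E (res b g) v = b * ip (\<lambda>x. g x - res b g x) v"
  using someI_ex[of "\<lambda>u. u \<in> F \<and> (\<forall>v\<in>F. E u v = b * ip (\<lambda>x. g x - u x) v)"] res_exists[OF assms]
  unfolding res_def by (blast intro: F_L2)+

text \<open>The first variation vanishes at the minimiser, so the expansion has only its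
  second-order term. The exact excess is what the clipping argument and the monotonicity in
  \<open>b\<close> exploit.\<close>

lemma resJ_min:
  assumes "b > 0" "L2fun m g" "v \<in> F"
  shows "resJ b g v = resJ b g (res b g) + E (\<lambda>x. v x - res b g x) (\<lambda>x. v x - res b g x)
     + b * ip (\<lambda>x. v x - res b g x) (\<lambda>x. v x - res b g x)"
proof -
  let ?u = "res b g" let ?h = "\<lambda>x. v x - ?u x"
  have h: "?h \<in> F" using assms res_F by (intro F_diff) auto
  have "ip (\<lambda>x. ?u x - g x) ?h = - ip (\<lambda>x. g x - ?u x) ?h"
    using assms res_L2[OF assms(1,2)] F_L2[OF h] by (simp only: ip_diff)
  then have "E ?u ?h + b * ip (\<lambda>x. ?u x - g x) ?h = 0"
    using res_eq[OF assms(1,2) h] by simp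
  then show ?thesis
    using resJ_expand[OF res_F[OF assms(1,2)] h assms(2), of b 1] by simp
qed

text \<open>The energy of the difference of two solutions is \<open>- b\<close> times its squared
  norm, so both are zero. As the equation is linear, linearity of \<open>res\<close> is a
  consequence.\<close>

lemma res_unique:
  assumes "b > 0" "L2fun m g" "w \<in> F" "\<And>v. v \<in> F \<Longrightarrow> E w v = b * ip (\<lambda>x. g x - w x) v"
  shows "AE x in m. w x = res b g x"
proof -
  let ?u = "res b g" let ?h = "\<lambda>x. w x - ?u x"
  have h: "?h \<in> F" using assms res_F by (intro F_diff) auto
  note L = F_L2[OF h] res_L2[OF assms(1,2)] assms(2) F_L2[OF assms(3)]
  have "E ?h ?h = b * ip (\<lambda>x. g x - w x) ?h - b * ip (\<lambda>x. g x - ?u x) ?h"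
    using assms(4)[OF h] res_eq[OF assms(1,2) h] E_diff[OF assms(3) res_F[OF assms(1,2)] h] by simp
  also have "ip (\<lambda>x. g x - w x) ?h = ip g ?h - ip w ?h" using L by (rule_tac ip_diff)
  also have "ip (\<lambda>x. g x - ?u x) ?h = ip g ?h - ip ?u ?h" using L by (rule_tac ip_diff)
  also have "b * (ip g ?h - ip w ?h) - b * (ip g ?h - ip ?u ?h) = - b * (ip w ?h - ip ?u ?h)"
    by (simp add: algebra_simps)
  also have "ip w ?h - ip ?u ?h = ip ?h ?h" using L by (rule_tac ip_diff[symmetric])
  finally have "b * ip ?h ?h \<le> 0" using E_nonneg[OF h] by simp
  then have "ip ?h ?h = 0" using assms(1) ip_nonneg[of ?h] by (simp add: mult_le_0_iff)
  from ip_zero_AE[OF L(1) this] show ?thesis by simp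
qed

lemma res_add:
  assumes "b > 0" "L2fun m f" "L2fun m g"
  shows "AE x in m. res b (\<lambda>x. f x + g x) x = res b f x + res b g x"
proof -
  have "AE x in m. (\<lambda>x. res b f x + res b g x) x = res b (\<lambda>x. f x + g x) x"
  proof (rule res_unique)
    fix v assume v: "v \<in> F"
    note L = res_L2[OF assms(1,2)] res_L2[OF assms(1,3)] F_L2[OF v] assms(2,3)
    have "ip (\<lambda>x. f x + g x - (res b f x + res b g x)) v =
       ip (\<lambda>x. f x - res b f x) v + ip (\<lambda>x. g x - res b g x) v"
      using L by (simp only: ip_lin)
    then show "E (\<lambda>x. res b f x + res b g x) v = b * ip (\<lambda>x. f x + g x - (res b f x + res b g x)) v"
      using assms v by (simp only: E_add res_F res_eq) (simp add: algebra_simps)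
  qed (use assms in \<open>auto intro: L2fun_add F_add res_F\<close>)
  then show ?thesis by auto
qed

lemma res_scale:
  assumes "b > 0" "L2fun m f"
  shows "AE x in m. res b (\<lambda>x. c * f x) x = c * res b f x"
proof -
  have "AE x in m. (\<lambda>x. c * res b f x) x = res b (\<lambda>x. c * f x) x"
  proof (rule res_unique)
    fix v assume v: "v \<in> F"
    note L = res_L2[OF assms(1,2)] F_L2[OF v] assms(2)
    have "ip (\<lambda>x. c * f x - c * res b f x) v = c * ip (\<lambda>x. f x - res b f x) v"
      using L by (simp only: ip_lin) (simp add: algebra_simps)
    then show "E (\<lambda>x. c * res b f x) v = b * ip (\<lambda>x. c * f x - c * res b f x) v"
      using assms v by (simp only: E_scale res_F res_eq) (simp add: algebra_simps)
  qed (use assms in \<open>auto intro: L2fun_scale F_scale res_F\<close>)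
  then show ?thesis by auto
qed

text \<open>Both sides arise from evaluating \<open>E (res b f) (res b g)\<close>, once by the
  equation for \<open>f\<close> and once by the one for \<open>g\<close>.\<close>

lemma res_sym:
  assumes "b > 0" "L2fun m f" "L2fun m g"
  shows "ip (res b f) g = ip f (res b g)"
proof -
  let ?u = "res b f" and ?w = "res b g"
  note F = res_F[OF assms(1,2)] res_F[OF assms(1,3)]
  note L = F[THEN F_L2] assms(2,3)
  have "b * (ip f ?w - ip ?u ?w) = E ?u ?w" 
    using res_eq[OF assms(1,2) F(2)] ip_diff[OF L(3) L(1) L(2)] by simp
  also have "\<dots> = E ?w ?u" using F by (rule E_sym)
  also have "\<dots> = b * (ip g ?u - ip ?w ?u)"
    using res_eq[OF assms(1,3) F(1)] ip_diff[OF L(4) L(2) L(1)] by simp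
  finally show ?thesis using assms(1) ip_sym[of ?w ?u] ip_sym[of g ?u] by simp
qed

text \<open>Clipping to the unit interval does not increase \<open>resJ b g\<close>, whose minimiser is unique.\<close>

lemma res_01:
  assumes b: "b > 0" and g: "L2fun m g" and 01: "\<And>x. 0 \<le> g x" "\<And>x. g x \<le> 1"
  shows "AE x in m. 0 \<le> res b g x \<and> res b g x \<le> 1"
proof -
  let ?u = "res b g" let ?c = "\<lambda>x. min 1 (max 0 (?u x))"
  have u: "?u \<in> F" and c: "?c \<in> F" using res_F[OF b g] F_clip by auto
  have "ip (\<lambda>x. ?c x - g x) (\<lambda>x. ?c x - g x) \<le> ip (\<lambda>x. ?u x - g x) (\<lambda>x. ?u x - g x)"
  proof (rule integral_mono)
    have "\<bar>?c x - g x\<bar> \<le> \<bar>?u x - g x\<bar>" for x using 01[of x] by (auto simp: min_def max_def)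
    then show "(?c x - g x) * (?c x - g x) \<le> (?u x - g x) * (?u x - g x)" for x
      by (metis abs_le_square_iff power2_eq_square)
  qed (use u c g F_L2 in \<open>auto intro!: L2fun_integrable_mult L2fun_diff\<close>)
  then have "resJ b g ?c \<le> resJ b g ?u"
    unfolding resJ_def using E_clip[OF u] b by (intro add_mono mult_left_mono) auto
  with resJ_min[OF b g c] E_nonneg[OF F_diff[OF c u]]
  have "b * ip (\<lambda>x. ?c x - ?u x) (\<lambda>x. ?c x - ?u x) \<le> 0" by linarith
  then have "ip (\<lambda>x. ?c x - ?u x) (\<lambda>x. ?c x - ?u x) = 0"
    using b ip_nonneg[of "\<lambda>x. ?c x - ?u x"] by (simp add: mult_le_0_iff)
  from ip_zero_AE[OF F_L2[OF F_diff[OF c u]] this] show ?thesis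
    by eventually_elim (auto simp: min_def max_def split: if_splits)
qed

text \<open>Division by the bound reduces to values in the unit interval. Since \<open>M\<close> may
  be zero, the division is by slightly larger numbers, which then decrease to the bound along a
  sequence.\<close>

lemma res_nonneg:
  assumes b: "b > 0" and g: "L2fun m g" and ge: "\<And>x. 0 \<le> g x" and M: "\<And>x. g x \<le> M"
  shows "AE x in m. 0 \<le> res b g x" "AE x in m. res b g x \<le> M"
proof -
  define K where "K = max M 0"
  have "AE x in m. 0 \<le> res b g x \<and> res b g x \<le> K'" if K': "K' > 0" "K \<le> K'" for K'
  proof -
    have "AE x in m. 0 \<le> res b (\<lambda>x. (1 / K') * g x) x \<and> res b (\<lambda>x. (1 / K') * g x) x \<le> 1"
      using K' ge M by (intro res_01[OF b] L2fun_scale g) (auto simp: K_def intro: order_trans)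
    with res_scale[OF b g, of "1/K'"] show ?thesis
    proof eventually_elim
      case (elim x)
      then have "res b g x = K' * res b (\<lambda>x. (1 / K') * g x) x" using K'(1) by simp
      then show ?case using elim K'(1) by (simp add: mult_left_le)
    qed
  qed
  from this[of "K + 1 / Suc n" for n] have "AE x in m. \<forall>n. 0 \<le> res b g x \<and> res b g x \<le> K + 1 / Suc n"
    by (subst AE_all_countable) (auto simp: K_def add_nonneg_pos)
  then have *: "AE x in m. 0 \<le> res b g x \<and> res b g x \<le> K"
  proof eventually_elim
    case (elim x)
    have "(\<lambda>n. K + 1 / real (Suc n)) \<longlonglongrightarrow> K + 0"
      using LIMSEQ_inverse_real_of_nat by (intro tendsto_intros) (simp add: inverse_eq_divide)
    then have "res b g x \<le> K + 0" using elim by (intro LIMSEQ_le_const) auto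
    with elim show ?case by simp
  qed
  then show "AE x in m. 0 \<le> res b g x" by auto
  \<comment> \<open>The inequalities \<open>0 \<le> g x \<le> M\<close> at an arbitrary point show
    that \<open>M\<close> is nonnegative.\<close>
  have "K = M" using ge[of undefined] M[of undefined] by (simp add: K_def)
  with * show "AE x in m. res b g x \<le> M" by auto
qed

text \<open>The image of the positive part is at most \<open>c\<close>, and the negative part
  contributes with the favourable sign. The bound \<open>M\<close> makes positivity applicable to
  the negative part.\<close>

lemma res_le:
  assumes b: "b > 0" and g: "L2fun m g" and le: "\<And>x. g x \<le> c" and c: "0 \<le> c" and M: "\<And>x. \<bar>g x\<bar> \<le> M"
  shows "AE x in m. res b g x \<le> c"
proof -
  have [measurable]: "g \<in> borel_measurable m" using g by (simp add: L2fun_def)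
  let ?p = "\<lambda>x. max 0 (g x)" and ?n = "\<lambda>x. max 0 (- g x)"
  have L: "L2fun m ?p" "L2fun m ?n"
    using g unfolding L2fun_def
    by (auto intro!: Bochner_Integration.integrable_bound[where f="\<lambda>x. (g x)\<^sup>2"] simp: max_def)
  have eq: "g = (\<lambda>x. ?p x + (-1) * ?n x)" by (auto simp: max_def)
  have "AE x in m. res b ?p x \<le> c"
    using le c by (intro res_nonneg[OF b L(1)]) auto
  moreover have "AE x in m. 0 \<le> res b ?n x"
    using M by (intro res_nonneg(1)[OF b L(2), of M]) (auto simp: abs_le_iff order_trans[OF abs_ge_zero M])
  moreover have "AE x in m. res b (\<lambda>x. ?p x + (-1) * ?n x) x = res b ?p x + res b (\<lambda>x. (-1) * ?n x) x"
    by (intro res_add[OF b] L L2fun_scale)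
  moreover have "AE x in m. res b (\<lambda>x. (-1) * ?n x) x = (-1) * res b ?n x"
    by (intro res_scale[OF b] L)
  ultimately have "AE x in m. res b (\<lambda>x. ?p x + (-1) * ?n x) x \<le> c"
    by eventually_elim auto
  then show ?thesis using eq by simp
qed

end

section \<open>The approximating forms and products of bounded functions\<close>

lemma nonneg_of_rat:
  fixes g :: "real \<Rightarrow> real"
  assumes "continuous_on UNIV g" "\<And>q::rat. 0 \<le> g (of_rat q)"
  shows "0 \<le> g a"
proof -
  have "closed {x. 0 \<le> g x}" using assms(1) by (intro closed_Collect_le) auto
  moreover have "\<rat> \<subseteq> {x. 0 \<le> g x}" using assms(2) by (auto elim!: Rats_cases)
  ultimately have "closure \<rat> \<subseteq> {x. 0 \<le> g x}" by (rule closure_minimal[rotated])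
  then show ?thesis using Rats_closure_real by auto
qed

context dform begin

text \<open>The approximating form on the diagonal; it is also the minimum of \<open>resJ b u\<close>, hence increasing in \<open>b\<close>.\<close>

definition resa :: "real \<Rightarrow> ('a \<Rightarrow> real) \<Rightarrow> real" where
  "resa b u = b * ip (\<lambda>x. u x - res b u x) u"

lemma resJ_res:
  assumes "b > 0" "L2fun m u"
  shows "resJ b u (res b u) = resa b u"
proof -
  let ?R = "res b u"
  note L = res_L2[OF assms] assms(2)
  have "resJ b u ?R = b * (ip (\<lambda>x. u x - ?R x) ?R + ip (\<lambda>x. ?R x - u x) (\<lambda>x. ?R x - u x))"
    unfolding resJ_def using res_eq[OF assms res_F[OF assms]] by (simp add: algebra_simps)
  also have "ip (\<lambda>x. u x - ?R x) ?R + ip (\<lambda>x. ?R x - u x) (\<lambda>x. ?R x - u x) = ip (\<lambda>x. u x - ?R x) u"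
    using L by (simp only: ip_lin ip_sym[of u ?R])
  finally show ?thesis unfolding resa_def .
qed

text \<open>\<open>res c u\<close> competes in the minimisation with parameter \<open>b\<close>, and
  the functional increases with its parameter. The excess is kept because it turns boundedness of
  \<open>resa\<close> into the Cauchy property of the resolvents.\<close>

lemma resa_mono:
  assumes "0 < b" "b \<le> c" "L2fun m u"
  shows "resa b u + E (\<lambda>x. res c u x - res b u x) (\<lambda>x. res c u x - res b u x)
     + b * ip (\<lambda>x. res c u x - res b u x) (\<lambda>x. res c u x - res b u x) \<le> resa c u"
proof -
  have c: "c > 0" using assms by simp
  have "resJ b u (res c u) \<le> resJ c u (res c u)"
    unfolding resJ_def using assms ip_nonneg by (intro add_mono mult_right_mono) auto
  then show ?thesis
    using resJ_min[OF assms(1,3) res_F[OF c assms(3)]] resJ_res[OF assms(1,3)] resJ_res[OF c assms(3)] by simp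
qed

text \<open>The competitor \<open>u\<close> itself has zero penalty term.\<close>

lemma resa_le: 
  assumes "b > 0" "u \<in> F"
  shows "resa b u \<le> E u u"
proof -
  note L = F_L2[OF assms(2)]
  have h: "(\<lambda>x. u x - res b u x) \<in> F" using assms res_F L by (intro F_diff) auto
  have "resa b u \<le> resJ b u u"
    using resJ_min[OF assms(1) L assms(2)] resJ_res[OF assms(1) L] E_nonneg[OF h] ip_nonneg[of "\<lambda>x. u x - res b u x"]
     assms(1) by (simp add: zero_le_mult_iff)
  then show ?thesis unfolding resJ_def by simp
qed

text \<open>A membership criterion for \<open>F\<close>: bounded approximating energies make the
  resolvents Cauchy in \<open>F\<close>, and their L2 limit is \<open>u\<close>. It is the tool that
  later puts squares into \<open>F\<close>.\<close>

lemma resa_bounded_imp: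
  assumes u: "L2fun m u" and C: "\<And>n. resa (real (Suc n)) u \<le> C"
  shows "u \<in> F" "(\<lambda>n. E1norm m E (\<lambda>x. res (real (Suc n)) u x - u x)) \<longlonglongrightarrow> 0"
proof -
  let ?R = "\<lambda>n. res (real (Suc n)) u"
  define a where "a n = resa (real (Suc n)) u" for n
  have R: "?R n \<in> F" for n using u by (intro res_F) auto
  have a_step: "E (\<lambda>x. ?R j x - ?R i x) (\<lambda>x. ?R j x - ?R i x) + ip (\<lambda>x. ?R j x - ?R i x) (\<lambda>x. ?R j x - ?R i x) \<le> a j - a i"
    if "i \<le> j" for i j
  proof -
    have "1 * ip (\<lambda>x. ?R j x - ?R i x) (\<lambda>x. ?R j x - ?R i x) \<le> Suc i * ip (\<lambda>x. ?R j x - ?R i x) (\<lambda>x. ?R j x - ?R i x)"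
      using ip_nonneg by (intro mult_right_mono) auto
    then show ?thesis using resa_mono[of "Suc i" "Suc j" u] that u unfolding a_def by simp
  qed
  have "a i \<le> a j" if "i \<le> j" for i j
    using a_step[OF that] E_nonneg[OF F_diff[OF R R], of j i] ip_nonneg[of "\<lambda>x. ?R j x - ?R i x"] by linarith
  then have inc: "incseq a" by (auto simp: incseq_def)
  have aC: "\<forall>i. a i \<le> C" using C by (simp add: a_def)
  obtain L where L: "a \<longlonglongrightarrow> L" using incseq_convergent[OF inc aC] by metis
  have r: "(\<lambda>n. \<bar>a n - L\<bar>) \<longlonglongrightarrow> 0" using L by (simp add: LIM_zero tendsto_rabs_zero)
  obtain w where w: "w \<in> F" "(\<lambda>n. E1norm m E (\<lambda>x. ?R n x - w x)) \<longlonglongrightarrow> 0"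
  proof (rule F_converge[OF R r])
    fix i j
    have sw: "E (\<lambda>x. ?R i x - ?R j x) (\<lambda>x. ?R i x - ?R j x) = E (\<lambda>x. ?R j x - ?R i x) (\<lambda>x. ?R j x - ?R i x)"
      using R[of i] R[of j] by (simp add: E_lin)
    have sw2: "ip (\<lambda>x. ?R i x - ?R j x) (\<lambda>x. ?R i x - ?R j x) = ip (\<lambda>x. ?R j x - ?R i x) (\<lambda>x. ?R j x - ?R i x)"
      by (intro Bochner_Integration.integral_cong) (auto simp: algebra_simps)
    show "E (\<lambda>x. ?R i x - ?R j x) (\<lambda>x. ?R i x - ?R j x) + ip (\<lambda>x. ?R i x - ?R j x) (\<lambda>x. ?R i x - ?R j x) \<le> \<bar>a i - L\<bar> + \<bar>a j - L\<bar>"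
      using a_step[of i j] a_step[of j i] sw sw2 by (cases "i \<le> j") auto
  qed
  have wR: "(\<lambda>n. ip (\<lambda>x. ?R n x - w x) (\<lambda>x. ?R n x - w x)) \<longlonglongrightarrow> 0"
    using w R E1norm_tendsto_iff[of "\<lambda>n x. ?R n x - w x"] by (auto intro: F_diff)
  \<comment> \<open>The penalty term is part of a minimum bounded by \<open>C\<close>, so the
    squared distance to \<open>u\<close> is at most \<open>C / (n + 1)\<close>.\<close>
  have uR: "(\<lambda>n. ip (\<lambda>x. ?R n x - u x) (\<lambda>x. ?R n x - u x)) \<longlonglongrightarrow> 0"
  proof (rule tendsto_sandwich[of "\<lambda>_. 0" _ _ "\<lambda>n. C * inverse (real (Suc n))"])
    have "ip (\<lambda>x. ?R n x - u x) (\<lambda>x. ?R n x - u x) \<le> C * inverse (real (Suc n))" for n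
    proof -
      have "real (Suc n) * ip (\<lambda>x. ?R n x - u x) (\<lambda>x. ?R n x - u x) \<le> a n"
        using resJ_res[of "Suc n" u] E_nonneg[OF R, of n] u unfolding resJ_def a_def by simp
      also have "a n \<le> C" using C unfolding a_def .
      finally show ?thesis by (simp add: field_simps)
    qed
    then show "\<forall>\<^sub>F n in sequentially. ip (\<lambda>x. ?R n x - u x) (\<lambda>x. ?R n x - u x) \<le> C * inverse (real (Suc n))" by simp
    show "(\<lambda>n. C * inverse (real (Suc n))) \<longlonglongrightarrow> 0"
      by (intro tendsto_mult_right_zero LIMSEQ_inverse_real_of_nat)
  qed auto
  have AE: "AE x in m. w x = u x"
    by (rule L2_limit_unique[OF F_L2[OF R] F_L2[OF w(1)] u wR uR])
  show "u \<in> F" by (rule F_AE(1)[OF w(1) _ AE]) (use u in \<open>simp add: L2fun_def\<close>)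
  then have D: "(\<lambda>x. ?R n x - u x) \<in> F" for n using R by (intro F_diff)
  have Dw: "(\<lambda>x. ?R n x - w x) \<in> F" for n using R w by (intro F_diff)
  have AE': "AE x in m. ?R n x - w x = ?R n x - u x" for n using AE by auto
  \<comment> \<open>Convergence is known for the representative \<open>w\<close> and is moved to
    \<open>u\<close> by the invariance of the form under modification on null sets.\<close>
  have "E1norm m E (\<lambda>x. ?R n x - u x) = E1norm m E (\<lambda>x. ?R n x - w x)" for n
  proof -
    note me = F_meas[OF D[of n]]
    have "E (\<lambda>x. ?R n x - u x) (\<lambda>x. ?R n x - u x) = E (\<lambda>x. ?R n x - w x) (\<lambda>x. ?R n x - u x)"
      by (rule F_AE(2)[OF Dw me AE' D])
    also have "\<dots> = E (\<lambda>x. ?R n x - w x) (\<lambda>x. ?R n x - w x)"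
      by (rule F_AE(3)[OF Dw me AE' Dw])
    finally have 1: "E (\<lambda>x. ?R n x - u x) (\<lambda>x. ?R n x - u x) = E (\<lambda>x. ?R n x - w x) (\<lambda>x. ?R n x - w x)" .
    have "integral\<^sup>L m (\<lambda>x. (?R n x - u x)\<^sup>2) = integral\<^sup>L m (\<lambda>x. (?R n x - w x)\<^sup>2)"
      using AE F_meas[OF D[of n]] F_meas[OF Dw[of n]] by (intro integral_cong_AE) auto
    with 1 show ?thesis unfolding E1norm_def by simp
  qed
  with w(2) show "(\<lambda>n. E1norm m E (\<lambda>x. ?R n x - u x)) \<longlonglongrightarrow> 0" by simp
qed

lemma E_limit:
  assumes "u \<in> F" "v \<in> F"
  shows "(\<lambda>n. real (Suc n) * ip (\<lambda>x. u x - res (real (Suc n)) u x) v) \<longlonglongrightarrow> E u v"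
proof -
  have "(\<lambda>n. E1norm m E (\<lambda>x. res (real (Suc n)) u x - u x)) \<longlonglongrightarrow> 0"
    using assms by (intro resa_bounded_imp(2)[of _ "E u u"] F_L2 resa_le) auto
  then have "(\<lambda>n. E (res (real (Suc n)) u) v) \<longlonglongrightarrow> E u v"
    using assms by (intro E_tendsto res_F F_L2) auto
  then show ?thesis using res_eq[OF _ F_L2[OF assms(1)] assms(2)] by simp
qed

text \<open>If the resolvent is given by a kernel, this is the resolvent of \<open>\<lambda>y. (f y - f x)\<^sup>2\<close> at \<open>x\<close> plus a nonnegative
  killing term.\<close>

definition cdc :: "real \<Rightarrow> ('a \<Rightarrow> real) \<Rightarrow> 'a \<Rightarrow> real" where
  "cdc b f x = res b (\<lambda>x. (f x)\<^sup>2) x - 2 * f x * res b f x + (f x)\<^sup>2"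

section \<open>Pointwise bounds for the approximating densities\<close>

lemma L2fun_sq:
  assumes "L2fun m f" "\<And>x. \<bar>f x\<bar> \<le> M"
  shows "L2fun m (\<lambda>x. (f x)\<^sup>2)"
  using L2fun_bounded_mult[OF assms(1) _ assms(2)] assms(1) by (simp add: power2_eq_square L2fun_def)

text \<open>The resolvent preserves the bound \<open>2 a f - f\<^sup>2 \<le> a\<^sup>2\<close>. One null set serves all rational \<open>a\<close>, so that \<open>a = f x\<close>
  may be substituted.\<close>

lemma cdc_nonneg:
  assumes b: "b > 0" and f: "L2fun m f" and M: "\<And>x. \<bar>f x\<bar> \<le> M"
  shows "AE x in m. 0 \<le> cdc b f x"
proof -
  let ?f2 = "\<lambda>x. (f x)\<^sup>2"
  have f2: "L2fun m ?f2" using f M by (rule L2fun_sq)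
  have "AE x in m. 0 \<le> res b ?f2 x - 2 * a * res b f x + a\<^sup>2" for a
  proof -
    let ?g = "\<lambda>x. (2 * a) * f x + (-1) * ?f2 x"
    have g: "L2fun m ?g" using f f2 by (intro L2fun_add L2fun_scale)
    have "AE x in m. res b ?g x \<le> a\<^sup>2"
    proof (rule res_le[OF b g])
      show "?g x \<le> a\<^sup>2" for x
        using sum_squares_ge_zero[of "f x - a" 0] by (simp add: power2_eq_square algebra_simps)
      have "\<bar>?g x\<bar> \<le> 2 * \<bar>a\<bar> * M + M\<^sup>2" for x
      proof -
        have "\<bar>?g x\<bar> \<le> \<bar>(2 * a) * f x\<bar> + \<bar>?f2 x\<bar>" by linarith
        also have "\<dots> \<le> 2 * \<bar>a\<bar> * M + M\<^sup>2"
          using M[of x] power_mono[OF M[of x], of 2] by (intro add_mono) (auto simp: abs_mult mult_left_mono)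
        finally show ?thesis .
      qed
      then show "\<bar>?g x\<bar> \<le> 2 * \<bar>a\<bar> * M + M\<^sup>2" for x .
    qed simp
    moreover have "AE x in m. res b ?g x = res b (\<lambda>x. (2 * a) * f x) x + res b (\<lambda>x. (-1) * ?f2 x) x"
      using f f2 by (intro res_add[OF b] L2fun_scale)
    moreover have "AE x in m. res b (\<lambda>x. (2 * a) * f x) x = 2 * a * res b f x"
      using f by (intro res_scale[OF b])
    moreover have "AE x in m. res b (\<lambda>x. (-1) * ?f2 x) x = (-1) * res b ?f2 x"
      using f2 by (intro res_scale[OF b])
    ultimately show ?thesis by eventually_elim auto
  qed
  then have "AE x in m. \<forall>q::rat. 0 \<le> res b ?f2 x - 2 * of_rat q * res b f x + (of_rat q)\<^sup>2"
    by (subst AE_all_countable) auto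
  then show ?thesis
  proof eventually_elim
    case (elim x)
    have "0 \<le> (\<lambda>a. res b ?f2 x - 2 * a * res b f x + a\<^sup>2) (f x)"
      by (rule nonneg_of_rat[where g="\<lambda>a. res b ?f2 x - 2 * a * res b f x + a\<^sup>2"])
        (use elim in \<open>auto intro!: continuous_intros\<close>)
    then show ?case unfolding cdc_def .
  qed
qed

text \<open>The same argument for the bound \<open>(f\<^sup>2 - a\<^sup>2)\<^sup>2 \<le> (M + \<bar>a\<bar>)\<^sup>2 (f - a)\<^sup>2\<close>, expanded in powers of \<open>f\<close>.\<close>

lemma cdc_sq_le:
  assumes b: "b > 0" and f: "L2fun m f" and M: "\<And>x. \<bar>f x\<bar> \<le> M"
  shows "AE x in m. cdc b (\<lambda>x. (f x)\<^sup>2) x \<le> 4 * M\<^sup>2 * cdc b f x"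
proof -
  let ?f2 = "\<lambda>x. (f x)\<^sup>2" let ?f4 = "\<lambda>x. (?f2 x)\<^sup>2"
  have M0: "0 \<le> M" using M[of undefined] by linarith
  have f2: "L2fun m ?f2" using f M by (rule L2fun_sq)
  have M2: "\<bar>?f2 x\<bar> \<le> M\<^sup>2" for x using power_mono[OF M[of x], of 2] by simp
  have f4: "L2fun m ?f4" by (rule L2fun_sq[OF f2 M2])
  have M4: "\<bar>?f4 x\<bar> \<le> (M\<^sup>2)\<^sup>2" for x using power_mono[OF M2[of x], of 2] by simp
  \<comment> \<open>A bound for \<open>(f x + a)\<^sup>2\<close>, the factor that separates
    \<open>(f\<^sup>2 - a\<^sup>2)\<^sup>2\<close> from \<open>(f - a)\<^sup>2\<close>.\<close>
  define K where "K a = (M + \<bar>a\<bar>)\<^sup>2" for a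
  have "AE x in m. 0 \<le> K a * (res b ?f2 x - 2 * a * res b f x + a\<^sup>2) - (res b ?f4 x - 2 * a\<^sup>2 * res b ?f2 x + (a\<^sup>2)\<^sup>2)" for a
  proof -
    let ?h = "\<lambda>x. (- (2 * a\<^sup>2 + K a)) * ?f2 x + (2 * K a * a) * f x"
    let ?g = "\<lambda>x. ?f4 x + ?h x"
    have h: "L2fun m ?h" using f f2 by (intro L2fun_add L2fun_scale)
    have g: "L2fun m ?g" by (rule L2fun_add[OF f4 h])
    have "AE x in m. res b ?g x \<le> K a * a\<^sup>2 - (a\<^sup>2)\<^sup>2"
    proof (rule res_le[OF b g])
      show "?g x \<le> K a * a\<^sup>2 - (a\<^sup>2)\<^sup>2" for x
      proof -
        have "\<bar>f x + a\<bar> \<le> \<bar>M + \<bar>a\<bar>\<bar>" using M[of x] by linarith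
        then have "(f x + a)\<^sup>2 \<le> K a" unfolding K_def by (simp add: abs_le_square_iff)
        then have "(f x + a)\<^sup>2 * (f x - a)\<^sup>2 \<le> K a * (f x - a)\<^sup>2" by (intro mult_right_mono) auto
        then show ?thesis by (simp add: power2_eq_square algebra_simps)
      qed
      have "\<bar>a\<bar> \<le> \<bar>M + \<bar>a\<bar>\<bar>" using M0 by linarith
      then have "a\<^sup>2 \<le> K a" unfolding K_def by (simp add: abs_le_square_iff)
      then have "a\<^sup>2 * a\<^sup>2 \<le> K a * a\<^sup>2" by (intro mult_right_mono) auto
      then show "0 \<le> K a * a\<^sup>2 - (a\<^sup>2)\<^sup>2" by (simp add: power2_eq_square)
      show "\<bar>?g x\<bar> \<le> (M\<^sup>2)\<^sup>2 + (\<bar>2 * a\<^sup>2 + K a\<bar> * M\<^sup>2 + \<bar>2 * K a * a\<bar> * M)" for x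
      proof -
        have "\<bar>?g x\<bar> \<le> \<bar>?f4 x\<bar> + (\<bar>(- (2 * a\<^sup>2 + K a)) * ?f2 x\<bar> + \<bar>(2 * K a * a) * f x\<bar>)" by linarith
        also have "\<dots> \<le> (M\<^sup>2)\<^sup>2 + (\<bar>2 * a\<^sup>2 + K a\<bar> * M\<^sup>2 + \<bar>2 * K a * a\<bar> * M)"
          unfolding abs_mult[of _ "f x"] abs_mult[of _ "?f2 x"] abs_minus_cancel using M[of x] M2[of x] M4[of x]
          by (intro add_mono mult_left_mono) auto
        finally show ?thesis .
      qed
    qed
    moreover have "AE x in m. res b ?g x = res b ?f4 x + res b ?h x"
      using h f4 by (intro res_add[OF b])
    moreover have "AE x in m. res b ?h x = res b (\<lambda>x. (- (2 * a\<^sup>2 + K a)) * ?f2 x) x + res b (\<lambda>x. (2 * K a * a) * f x) x"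
      using f f2 by (intro res_add[OF b] L2fun_scale)
    moreover have "AE x in m. res b (\<lambda>x. (- (2 * a\<^sup>2 + K a)) * ?f2 x) x = (- (2 * a\<^sup>2 + K a)) * res b ?f2 x"
      using f2 by (intro res_scale[OF b])
    moreover have "AE x in m. res b (\<lambda>x. (2 * K a * a) * f x) x = (2 * K a * a) * res b f x"
      using f by (intro res_scale[OF b])
    ultimately show ?thesis
    proof eventually_elim
      case (elim x)
      then have "res b ?f4 x + ((- (2 * a\<^sup>2 + K a)) * res b ?f2 x + (2 * K a * a) * res b f x) \<le> K a * a\<^sup>2 - (a\<^sup>2)\<^sup>2"
        by linarith
      then show ?case by (simp add: algebra_simps)
    qed
  qed
  then have "AE x in m. \<forall>q::rat. 0 \<le> K (of_rat q) * (res b ?f2 x - 2 * of_rat q * res b f x + (of_rat q)\<^sup>2)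
     - (res b ?f4 x - 2 * (of_rat q)\<^sup>2 * res b ?f2 x + ((of_rat q)\<^sup>2)\<^sup>2)"
    by (subst AE_all_countable) auto
  with cdc_nonneg[OF b f M] show ?thesis
  proof eventually_elim
    case (elim x)
    have "0 \<le> (\<lambda>a. K a * (res b ?f2 x - 2 * a * res b f x + a\<^sup>2) - (res b ?f4 x - 2 * a\<^sup>2 * res b ?f2 x + (a\<^sup>2)\<^sup>2)) (f x)"
      by (rule nonneg_of_rat[where g="\<lambda>a. K a * (res b ?f2 x - 2 * a * res b f x + a\<^sup>2)
           - (res b ?f4 x - 2 * a\<^sup>2 * res b ?f2 x + (a\<^sup>2)\<^sup>2)"])
        (use elim(2) in \<open>auto simp: K_def intro!: continuous_intros\<close>)
    then have "cdc b ?f2 x \<le> K (f x) * cdc b f x" unfolding cdc_def by simp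
    \<comment> \<open>Substituting \<open>a = f x\<close> is the origin of the constant
      \<open>4 * M\<^sup>2\<close>.\<close>
    also have "K (f x) \<le> (M + M)\<^sup>2" unfolding K_def using M[of x] M0 by (intro power_mono) auto
    then have "K (f x) * cdc b f x \<le> (M + M)\<^sup>2 * cdc b f x" using elim(1) by (intro mult_right_mono)
    finally show ?case by (simp add: power2_eq_square algebra_simps)
  qed
qed

text \<open>Contraction in L1 is dual to the upper bound 1. As the constant 1 need not be square
  integrable, symmetry is applied to indicators of the sets where the image exceeds
  \<open>1 / (k + 1)\<close>, and Fatou's lemma passes to the limit.\<close>

lemma res_L1:
  assumes b: "b > 0" and g: "L2fun m g" and ge: "\<And>x. 0 \<le> g x" and M: "\<And>x. g x \<le> M" and int: "integrable m g"
  shows "integrable m (res b g)" "integral\<^sup>L m (res b g) \<le> integral\<^sup>L m g"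
proof -
  let ?R = "res b g"
  have RL: "L2fun m ?R" using res_L2[OF b g] .
  have [measurable]: "?R \<in> borel_measurable m" using RL by (simp add: L2fun_def)
  have R0: "AE x in m. 0 \<le> ?R x" by (rule res_nonneg(1)[OF b g ge M])
  have C0: "0 \<le> integral\<^sup>L m g" using ge by simp
  define A where "A k = {x\<in>space m. ?R x > 1 / real (Suc k)}" for k
  have [measurable]: "A k \<in> sets m" for k unfolding A_def by measurable
  have le: "(\<integral>\<^sup>+x. ennreal (indicator (A k) x * ?R x) \<partial>m) \<le> ennreal (integral\<^sup>L m g)" for k
  proof -
    let ?I = "indicator (A k) :: 'a \<Rightarrow> real"
    \<comment> \<open>Chebyshev's inequality for the square-integrable function
      \<open>?R\<close>.\<close>
    have I: "L2fun m ?I"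
      unfolding L2fun_def
    proof (intro conjI, measurable)
      show "integrable m (\<lambda>x. (?I x)\<^sup>2)"
      proof (rule Bochner_Integration.integrable_bound)
        show "integrable m (\<lambda>x. (real (Suc k))\<^sup>2 * (?R x)\<^sup>2)" using RL by (auto simp: L2fun_def)
        have "(?I x)\<^sup>2 \<le> (real (Suc k))\<^sup>2 * (?R x)\<^sup>2" for x
        proof (cases "x \<in> A k")
          case True
          then have "1 \<le> real (Suc k) * ?R x" by (auto simp: A_def field_simps)
          then have "1\<^sup>2 \<le> (real (Suc k) * ?R x)\<^sup>2" by (intro power_mono) auto
          with True show ?thesis by (simp add: power_mult_distrib)
        qed simp
        then show "AE x in m. norm ((?I x)\<^sup>2) \<le> norm ((real (Suc k))\<^sup>2 * (?R x)\<^sup>2)" by auto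
      qed measurable
    qed
    have "AE x in m. 0 \<le> res b ?I x \<and> res b ?I x \<le> 1" by (rule res_01[OF b I]) (auto simp: indicator_def)
    then have AE: "AE x in m. res b ?I x * g x \<le> g x"
      by eventually_elim (use ge in \<open>auto intro: mult_left_le_one_le\<close>)
    have "(\<integral>\<^sup>+x. ennreal (?I x * ?R x) \<partial>m) = ennreal (ip ?I ?R)"
      using R0 by (intro nn_integral_eq_integral L2fun_integrable_mult I RL) (auto simp: indicator_def)
    also have "ip ?I ?R = ip (res b ?I) g" using res_sym[OF b I g] by simp
    also have "\<dots> \<le> integral\<^sup>L m g"
      by (intro integral_mono_AE L2fun_integrable_mult res_L2[OF b I] g int AE)
    finally show ?thesis by (simp add: ennreal_leI)
  qed
  have "(\<integral>\<^sup>+x. ennreal (?R x) \<partial>m) \<le> (\<integral>\<^sup>+x. liminf (\<lambda>k. ennreal (indicator (A k) x * ?R x)) \<partial>m)"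
  proof (rule nn_integral_mono)
    fix x assume x: "x \<in> space m"
    show "ennreal (?R x) \<le> liminf (\<lambda>k. ennreal (indicator (A k) x * ?R x))"
    proof (cases "?R x > 0")
      case True
      obtain n where n: "inverse (real (Suc n)) < ?R x" using reals_Archimedean[OF True] by blast
      have "\<forall>\<^sub>F k in sequentially. ennreal (indicator (A k) x * ?R x) = ennreal (?R x)"
      proof (rule eventually_sequentiallyI[of n])
        fix k assume "n \<le> k"
        then have "1 / real (Suc k) \<le> inverse (real (Suc n))" by (simp add: field_simps)
        with n x show "ennreal (indicator (A k) x * ?R x) = ennreal (?R x)" by (auto simp: A_def indicator_def)
      qed
      then have "(\<lambda>k. ennreal (indicator (A k) x * ?R x)) \<longlonglongrightarrow> ennreal (?R x)" by (rule tendsto_eventually)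
      then show ?thesis by (simp add: lim_imp_Liminf)
    qed (simp add: ennreal_neg)
  qed
  also have "\<dots> \<le> liminf (\<lambda>k. \<integral>\<^sup>+x. ennreal (indicator (A k) x * ?R x) \<partial>m)"
    by (rule nn_integral_liminf) measurable
  also have "\<dots> \<le> ennreal (integral\<^sup>L m g)"
  proof -
    have "liminf (\<lambda>k. \<integral>\<^sup>+x. ennreal (indicator (A k) x * ?R x) \<partial>m) \<le> liminf (\<lambda>k::nat. ennreal (integral\<^sup>L m g))"
      using le by (intro Liminf_mono) auto
    then show ?thesis by (simp add: Liminf_const)
  qed
  finally have nn: "(\<integral>\<^sup>+x. ennreal (?R x) \<partial>m) \<le> ennreal (integral\<^sup>L m g)" .
  show intR: "integrable m ?R"
  proof (rule integrableI_nonneg)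
    show "(\<integral>\<^sup>+x. ennreal (?R x) \<partial>m) < \<infinity>" using nn by (rule le_less_trans) simp
  qed (use R0 in auto)
  have "ennreal (integral\<^sup>L m ?R) \<le> ennreal (integral\<^sup>L m g)"
    using nn nn_integral_eq_integral[OF intR R0] by simp
  then show "integral\<^sup>L m ?R \<le> integral\<^sup>L m g" using C0 by simp
qed

section \<open>Energy of squares and the algebra of bounded functions\<close>

lemma integrable_sq: "L2fun m f \<Longrightarrow> integrable m (\<lambda>x. (f x)\<^sup>2)"
  by (simp add: L2fun_def)

lemma integrable_cdc:
  assumes b: "b > 0" and f: "L2fun m f" and M: "\<And>x. \<bar>f x\<bar> \<le> M"
  shows "integrable m (res b (\<lambda>x. (f x)\<^sup>2))" "integrable m (cdc b f)"
    "integral\<^sup>L m (res b (\<lambda>x. (f x)\<^sup>2)) \<le> integral\<^sup>L m (\<lambda>x. (f x)\<^sup>2)"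
proof -
  have M2: "(f x)\<^sup>2 \<le> M\<^sup>2" for x using power_mono[OF M[of x], of 2] by simp
  note R = res_L1[OF b L2fun_sq[OF f M] zero_le_power2 M2 integrable_sq[OF f]]
  show "integrable m (res b (\<lambda>x. (f x)\<^sup>2))" "integral\<^sup>L m (res b (\<lambda>x. (f x)\<^sup>2)) \<le> integral\<^sup>L m (\<lambda>x. (f x)\<^sup>2)"
    by (rule R)+
  show "integrable m (cdc b f)"
    unfolding cdc_def using R(1) integrable_sq[OF f] L2fun_integrable_mult[OF f res_L2[OF b f]]
    by (auto simp: mult.assoc)
qed

text \<open>Splits the approximating energy into the integral of \<open>cdc\<close> and the mass
  that the resolvent removes from \<open>f\<^sup>2\<close>. Both parts are nonnegative, and each can
  be compared with the corresponding part for the square.\<close>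

lemma resa_cdc:
  assumes b: "b > 0" and f: "L2fun m f" and M: "\<And>x. \<bar>f x\<bar> \<le> M"
  shows "2 * resa b f = b * integral\<^sup>L m (cdc b f)
     + b * (integral\<^sup>L m (\<lambda>x. (f x)\<^sup>2) - integral\<^sup>L m (res b (\<lambda>x. (f x)\<^sup>2)))"
proof -
  note i = integrable_cdc(1)[OF b f M] integrable_sq[OF f] L2fun_integrable_mult[OF f res_L2[OF b f]]
  have 1: "integral\<^sup>L m (cdc b f) = integral\<^sup>L m (res b (\<lambda>x. (f x)\<^sup>2)) - 2 * ip f (res b f) + integral\<^sup>L m (\<lambda>x. (f x)\<^sup>2)"
    unfolding cdc_def using i by (simp add: mult.assoc)
  have 2: "resa b f = b * (integral\<^sup>L m (\<lambda>x. (f x)\<^sup>2) - ip f (res b f))"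
    unfolding resa_def ip_diff[OF f res_L2[OF b f] f] ip_sym[of "res b f"] by (simp add: power2_eq_square)
  show ?thesis unfolding 1 2 by (simp add: algebra_simps)
qed

text \<open>The two parts of \<open>resa_cdc\<close> are estimated separately: the first by
  \<open>cdc_sq_le\<close>, the second by mass contraction of the nonnegative function
  \<open>?g\<close>.\<close>

lemma resa_sq_le:
  assumes b: "b > 0" and f: "L2fun m f" and M: "\<And>x. \<bar>f x\<bar> \<le> M"
  shows "resa b (\<lambda>x. (f x)\<^sup>2) \<le> 4 * M\<^sup>2 * resa b f"
proof -
  let ?f2 = "\<lambda>x. (f x)\<^sup>2" let ?f4 = "\<lambda>x. (?f2 x)\<^sup>2"
  have f2: "L2fun m ?f2" using f M by (rule L2fun_sq)
  have M2: "\<bar>?f2 x\<bar> \<le> M\<^sup>2" for x using power_mono[OF M[of x], of 2] by simp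
  have f4: "L2fun m ?f4" by (rule L2fun_sq[OF f2 M2])
  have i2: "integrable m ?f2" and i4: "integrable m ?f4" by (rule integrable_sq f f2)+
  have 1: "integral\<^sup>L m (cdc b ?f2) \<le> 4 * M\<^sup>2 * integral\<^sup>L m (cdc b f)"
  proof -
    have "integral\<^sup>L m (cdc b ?f2) \<le> integral\<^sup>L m (\<lambda>x. 4 * M\<^sup>2 * cdc b f x)"
      by (intro integral_mono_AE integrable_mult_right integrable_cdc(2)[OF b f M] integrable_cdc(2)[OF b f2 M2]
          cdc_sq_le[OF b f M])
    then show ?thesis by simp
  qed
  let ?g = "\<lambda>x. (4 * M\<^sup>2) * ?f2 x + (-1) * ?f4 x"
  have g: "L2fun m ?g" using f2 f4 by (intro L2fun_add L2fun_scale)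
  have gx: "0 \<le> ?g x" "?g x \<le> 4 * M\<^sup>2 * M\<^sup>2" for x
  proof -
    have "?f4 x \<le> M\<^sup>2 * ?f2 x" unfolding power2_eq_square[of "?f2 x"] using M2[of x] by (intro mult_right_mono) auto
    also have "\<dots> \<le> 4 * M\<^sup>2 * ?f2 x" by simp
    finally show "0 \<le> ?g x" by simp
    have "?g x \<le> 4 * M\<^sup>2 * ?f2 x" by simp
    also have "\<dots> \<le> 4 * M\<^sup>2 * M\<^sup>2" using M2[of x] by (intro mult_left_mono) auto
    finally show "?g x \<le> 4 * M\<^sup>2 * M\<^sup>2" .
  qed
  have gi: "integrable m ?g" using i2 i4 by simp
  have "integral\<^sup>L m (res b ?g) \<le> integral\<^sup>L m ?g" by (rule res_L1(2)[OF b g gx gi])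
  also have "integral\<^sup>L m ?g = (4 * M\<^sup>2) * integral\<^sup>L m ?f2 - integral\<^sup>L m ?f4" using i2 i4 by simp
  also have "integral\<^sup>L m (res b ?g) = integral\<^sup>L m (\<lambda>x. (4 * M\<^sup>2) * res b ?f2 x - res b ?f4 x)"
  proof (rule integral_cong_AE)
    have "AE x in m. res b ?g x = res b (\<lambda>x. (4 * M\<^sup>2) * ?f2 x) x + res b (\<lambda>x. (-1) * ?f4 x) x"
      using f2 f4 by (intro res_add[OF b] L2fun_scale)
    moreover have "AE x in m. res b (\<lambda>x. (4 * M\<^sup>2) * ?f2 x) x = (4 * M\<^sup>2) * res b ?f2 x"
      using f2 by (intro res_scale[OF b])
    moreover have "AE x in m. res b (\<lambda>x. (-1) * ?f4 x) x = (-1) * res b ?f4 x"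
      using f4 by (intro res_scale[OF b])
    ultimately show "AE x in m. res b ?g x = (4 * M\<^sup>2) * res b ?f2 x - res b ?f4 x"
      by eventually_elim simp
  qed (use res_L2[OF b g] res_L2[OF b f2] res_L2[OF b f4] in \<open>auto simp: L2fun_def\<close>)
  also have "\<dots> = (4 * M\<^sup>2) * integral\<^sup>L m (res b ?f2) - integral\<^sup>L m (res b ?f4)"
    using integrable_cdc(1)[OF b f M] integrable_cdc(1)[OF b f2 M2] by simp
  finally have 2: "integral\<^sup>L m ?f4 - integral\<^sup>L m (res b ?f4) \<le> 4 * M\<^sup>2 * (integral\<^sup>L m ?f2 - integral\<^sup>L m (res b ?f2))"
    by (simp add: algebra_simps)
  have "2 * resa b ?f2 \<le> b * (4 * M\<^sup>2 * integral\<^sup>L m (cdc b f)) + b * (4 * M\<^sup>2 * (integral\<^sup>L m ?f2 - integral\<^sup>L m (res b ?f2)))"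
    unfolding resa_cdc[OF b f2 M2] using 1 2 b by (intro add_mono mult_left_mono) auto
  also have "\<dots> = 4 * M\<^sup>2 * (2 * resa b f)"
    unfolding resa_cdc[OF b f M] by (simp add: algebra_simps)
  finally show ?thesis by simp
qed

lemma F_sq:
  assumes "f \<in> F" "\<And>x. \<bar>f x\<bar> \<le> M"
  shows "(\<lambda>x. (f x)\<^sup>2) \<in> F"
proof (rule resa_bounded_imp(1))
  show "L2fun m (\<lambda>x. (f x)\<^sup>2)" using assms by (intro L2fun_sq F_L2)
  fix n
  have "resa (real (Suc n)) (\<lambda>x. (f x)\<^sup>2) \<le> 4 * M\<^sup>2 * resa (real (Suc n)) f"
    by (intro resa_sq_le F_L2 assms) simp
  also have "\<dots> \<le> 4 * M\<^sup>2 * E f f" by (intro mult_left_mono resa_le assms) auto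
  finally show "resa (real (Suc n)) (\<lambda>x. (f x)\<^sup>2) \<le> 4 * M\<^sup>2 * E f f" .
qed

lemma F_mult:
  assumes "f \<in> F" "g \<in> F" "\<And>x. \<bar>f x\<bar> \<le> M" "\<And>x. \<bar>g x\<bar> \<le> M'"
  shows "(\<lambda>x. f x * g x) \<in> F"
proof -
  have "\<bar>f x + g x\<bar> \<le> M + M'" for x using assms(3,4)[of x] by linarith
  then have "(\<lambda>x. (1/2) * (((f x + g x)\<^sup>2 - (f x)\<^sup>2) - (g x)\<^sup>2)) \<in> F"
    using assms by (intro F_scale F_diff F_sq F_add)
  also have "(\<lambda>x. (1/2) * (((f x + g x)\<^sup>2 - (f x)\<^sup>2) - (g x)\<^sup>2)) = (\<lambda>x. f x * g x)"
    by (auto simp: power2_eq_square algebra_simps)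
  finally show ?thesis .
qed

text \<open>The value that the energy measure of \<open>f\<close> must assign to the test function
  \<open>\<phi>\<close>.\<close>

definition Lam :: "('a \<Rightarrow> real) \<Rightarrow> ('a \<Rightarrow> real) \<Rightarrow> real" where
  "Lam f \<phi> = 2 * E (\<lambda>x. f x * \<phi> x) f - E \<phi> (\<lambda>x. (f x)\<^sup>2)"

lemma integrable_bdd_cdc:
  assumes b: "b > 0" and f: "L2fun m f" and M: "\<And>x. \<bar>f x\<bar> \<le> M"
    and "\<phi> \<in> borel_measurable m" and "\<And>x. \<bar>\<phi> x\<bar> \<le> M'"
  shows "integrable m (\<lambda>x. \<phi> x * cdc b f x)"
proof (rule Bochner_Integration.integrable_bound)
  show "integrable m (\<lambda>x. M' * cdc b f x)" using integrable_cdc[OF b f M] by simp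
  have "\<bar>\<phi> x\<bar> \<le> \<bar>M'\<bar>" for x using assms(5)[of x] by linarith
  then show "AE x in m. norm (\<phi> x * cdc b f x) \<le> norm (M' * cdc b f x)"
    by (auto simp: abs_mult intro!: mult_right_mono)
qed (use assms integrable_cdc(2)[OF b f M] in auto)

lemma Lam_limit:
  assumes f: "f \<in> F" and M: "\<And>x. \<bar>f x\<bar> \<le> M" and p: "\<phi> \<in> F" and M': "\<And>x. \<bar>\<phi> x\<bar> \<le> M'"
  shows "(\<lambda>n. integral\<^sup>L m (\<lambda>x. \<phi> x * (real (Suc n) * cdc (real (Suc n)) f x))) \<longlonglongrightarrow> Lam f \<phi>"
proof -
  let ?f2 = "\<lambda>x. (f x)\<^sup>2" let ?fp = "\<lambda>x. f x * \<phi> x"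
  have f2: "?f2 \<in> F" using f M by (rule F_sq)
  have fp: "?fp \<in> F" using f p M M' by (rule F_mult)
  \<comment> \<open>The integrands already agree pointwise: \<open>\<phi> cdc\<close> equals
    \<open>2 (f - R f) f \<phi> - (f\<^sup>2 - R f\<^sup>2) \<phi>\<close>, where \<open>R\<close>
    is the resolvent. Each of the two terms integrates to an approximating form.\<close>
  have "integral\<^sup>L m (\<lambda>x. \<phi> x * (b * cdc b f x)) =
     2 * (b * ip (\<lambda>x. f x - res b f x) ?fp) - b * ip (\<lambda>x. ?f2 x - res b ?f2 x) \<phi>" if b: "b > 0" for b
  proof -
    have i: "integrable m (\<lambda>x. (f x - res b f x) * ?fp x)" "integrable m (\<lambda>x. (?f2 x - res b ?f2 x) * \<phi> x)"
      using L2fun_integrable_mult[OF L2fun_diff[OF F_L2[OF f] res_L2[OF b F_L2[OF f]]] F_L2[OF fp]]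
        L2fun_integrable_mult[OF L2fun_diff[OF F_L2[OF f2] res_L2[OF b F_L2[OF f2]]] F_L2[OF p]] by blast+
    have "integral\<^sup>L m (\<lambda>x. \<phi> x * (b * cdc b f x)) = integral\<^sup>L m (\<lambda>x. 2 * b * ((f x - res b f x) * ?fp x) - b * ((?f2 x - res b ?f2 x) * \<phi> x))"
      by (intro Bochner_Integration.integral_cong) (auto simp: cdc_def power2_eq_square algebra_simps)
    also have "\<dots> = 2 * b * ip (\<lambda>x. f x - res b f x) ?fp - b * ip (\<lambda>x. ?f2 x - res b ?f2 x) \<phi>"
      using i by simp
    finally show ?thesis by simp
  qed
  then have eq: "integral\<^sup>L m (\<lambda>x. \<phi> x * (real (Suc n) * cdc (real (Suc n)) f x)) = 
    2 * (real (Suc n) * ip (\<lambda>x. f x - res (real (Suc n)) f x) ?fp) - real (Suc n) * ip (\<lambda>x. ?f2 x - res (real (Suc n)) ?f2 x) \<phi>" for n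
    by simp
  have "Lam f \<phi> = 2 * E f ?fp - E ?f2 \<phi>"
    unfolding Lam_def using E_sym[OF fp f] E_sym[OF p f2] by simp
  then show ?thesis unfolding eq
    by (auto simp del: of_nat_Suc intro!: tendsto_intros E_limit f f2 fp p)
qed

text \<open>The removed mass in \<open>resa_cdc\<close> is nonnegative and is dropped. Hence the
  factor 2 in the mass bounds.\<close>

lemma cdc_mass:
  assumes f: "f \<in> F" and M: "\<And>x. \<bar>f x\<bar> \<le> M" and b: "b > 0"
  shows "integral\<^sup>L m (\<lambda>x. b * cdc b f x) \<le> 2 * E f f"
proof -
  have "b * integral\<^sup>L m (cdc b f) \<le> 2 * resa b f"
    using resa_cdc[OF b F_L2[OF f] M] integrable_cdc(3)[OF b F_L2[OF f] M] b by simp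
  also have "\<dots> \<le> 2 * E f f" using resa_le[OF b f] by simp
  finally show ?thesis by simp
qed

end

section \<open>Riesz representation\<close>

lemma Cc_subset:
  fixes f g :: "'a::t2_space \<Rightarrow> real"
  assumes "Cc f" "continuous_on UNIV g" "\<And>x. f x = 0 \<Longrightarrow> g x = 0"
  shows "Cc g"
proof -
  have "{x. g x \<noteq> 0} \<subseteq> {x. f x \<noteq> 0}" using assms(3) by auto
  then have "closure {x. g x \<noteq> 0} \<subseteq> closure {x. f x \<noteq> 0}" by (rule closure_mono)
  moreover have "compact (closure {x. f x \<noteq> 0})" using assms(1) by (simp add: Cc_def)
  ultimately have "compact (closure {x. f x \<noteq> 0} \<inter> closure {x. g x \<noteq> 0})"
    by (intro compact_Int_closed) auto
  also have "closure {x. f x \<noteq> 0} \<inter> closure {x. g x \<noteq> 0} = closure {x. g x \<noteq> 0}"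
    using \<open>closure {x. g x \<noteq> 0} \<subseteq> _\<close> by auto
  finally show ?thesis using assms(2) by (simp add: Cc_def)
qed

lemma Cc_continuous: "Cc f \<Longrightarrow> continuous_on UNIV f"
  by (simp add: Cc_def)

lemma Cc_zero[simp]: "Cc (\<lambda>x. 0)"
  by (simp add: Cc_def)

lemma Cc_add:
  fixes f g :: "'a::t2_space \<Rightarrow> real"
  assumes "Cc f" "Cc g"
  shows "Cc (\<lambda>x. f x + g x)"
proof -
  have "compact (closure {x. f x \<noteq> 0} \<union> closure {x. g x \<noteq> 0})"
    using assms by (intro compact_Un) (auto simp: Cc_def)
  then have "compact (closure {x. \<bar>f x\<bar> + \<bar>g x\<bar> \<noteq> 0})"
  proof -
    have "{x. \<bar>f x\<bar> + \<bar>g x\<bar> \<noteq> 0} = {x. f x \<noteq> 0} \<union> {x. g x \<noteq> 0}" by auto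
    with \<open>compact (closure {x. f x \<noteq> 0} \<union> closure {x. g x \<noteq> 0})\<close> show ?thesis by simp
  qed
  then have "Cc (\<lambda>x. \<bar>f x\<bar> + \<bar>g x\<bar>)"
    using assms by (auto simp: Cc_def intro!: continuous_intros)
  then show ?thesis
    by (rule Cc_subset) (use assms in \<open>auto simp: Cc_def intro!: continuous_intros\<close>)
qed

lemma Cc_scale:
  fixes f :: "'a::t2_space \<Rightarrow> real"
  assumes "Cc f"
  shows "Cc (\<lambda>x. c * f x)"
  by (rule Cc_subset[OF assms]) (use assms in \<open>auto simp: Cc_def intro!: continuous_intros\<close>)

lemma Cc_diff:
  fixes f g :: "'a::t2_space \<Rightarrow> real"
  assumes "Cc f" "Cc g"
  shows "Cc (\<lambda>x. f x - g x)"
  using Cc_add[OF assms(1) Cc_scale[OF assms(2), of "-1"]] by simp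

lemma Cc_sum:
  fixes f :: "'i \<Rightarrow> 'a::t2_space \<Rightarrow> real"
  assumes "\<And>i. i \<in> J \<Longrightarrow> Cc (f i)"
  shows "Cc (\<lambda>x. \<Sum>i\<in>J. f i x)"
  using assms by (induction J rule: infinite_finite_induct) (auto intro: Cc_add)

lemma Cc_bounded:
  fixes f :: "'a::t2_space \<Rightarrow> real"
  assumes "Cc f"
  obtains B where "B > 0" "\<And>x. \<bar>f x\<bar> \<le> B"
proof -
  have "compact (f ` closure {x. f x \<noteq> 0})"
    using assms by (auto simp: Cc_def intro!: compact_continuous_image elim: continuous_on_subset)
  then have "bounded (f ` closure {x. f x \<noteq> 0})" by (rule compact_imp_bounded)
  then obtain B where B: "B > 0" "\<And>y. y \<in> f ` closure {x. f x \<noteq> 0} \<Longrightarrow> norm y \<le> B"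
    by (auto simp: bounded_pos)
  have "\<bar>f x\<bar> \<le> B" for x
  proof (cases "f x = 0")
    case False
    then have "x \<in> closure {x. f x \<noteq> 0}" using closure_subset[of "{x. f x \<noteq> 0}"] by auto
    then show ?thesis using B(2)[of "f x"] by auto
  qed (use B in auto)
  with B(1) that show ?thesis by blast
qed

text \<open>The case distinction is needed because \<open>infdist x {} = 0\<close>.\<close>

definition gap :: "'a::metric_space set \<Rightarrow> 'a \<Rightarrow> real" where
  "gap U x = (if U = UNIV then 1 else infdist x (- U))"

lemma continuous_gap: "continuous_on UNIV (gap U)"
  unfolding gap_def by (cases "U = UNIV") (auto intro!: continuous_intros)

lemma gap_nonneg: "0 \<le> gap U x"
  by (auto simp: gap_def infdist_nonneg)

lemma gap_pos: "open U \<Longrightarrow> x \<in> U \<Longrightarrow> 0 < gap U x"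
  using infdist_pos_not_in_closed[of "- U" x] by (auto simp: gap_def)

lemma gap_zero: "x \<notin> U \<Longrightarrow> gap U x = 0"
  by (auto simp: gap_def intro!: infdist_zero)

text \<open>The bound in the uniform norm makes the representing measure finite and prices every
  cut-off: lowering a nonnegative function by \<open>e\<close> costs at most
  \<open>C * e\<close>.\<close>

locale Cc_functional =
  fixes I :: "('a::{metric_space, second_countable_topology} \<Rightarrow> real) \<Rightarrow> real" and C :: real
  assumes I_add: "Cc f \<Longrightarrow> Cc g \<Longrightarrow> I (\<lambda>x. f x + g x) = I f + I g"
    and I_scale: "Cc f \<Longrightarrow> I (\<lambda>x. c * f x) = c * I f"
    and I_nonneg: "Cc f \<Longrightarrow> (\<And>x. 0 \<le> f x) \<Longrightarrow> 0 \<le> I f"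
    and I_bound: "Cc f \<Longrightarrow> (\<And>x. \<bar>f x\<bar> \<le> c) \<Longrightarrow> I f \<le> C * c"
begin

lemma C_nonneg: "0 \<le> C"
  using I_nonneg[of "\<lambda>x. 0"] I_bound[of "\<lambda>x. 0" 1] by simp

lemma I_zero: "I (\<lambda>x. 0) = 0"
  using I_scale[of "\<lambda>x. 0" 0] by simp

lemma I_diff: "Cc f \<Longrightarrow> Cc g \<Longrightarrow> I (\<lambda>x. f x - g x) = I f - I g"
  using I_add[of f "\<lambda>x. (-1) * g x"] I_scale[of g "-1"] Cc_scale[of g "-1"] by simp

lemma I_mono: "Cc f \<Longrightarrow> Cc g \<Longrightarrow> (\<And>x. f x \<le> g x) \<Longrightarrow> I f \<le> I g"
  using I_nonneg[of "\<lambda>x. g x - f x"] I_diff[of g f] Cc_diff[of g f] by simp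

lemma I_sum: "(\<And>i. i \<in> J \<Longrightarrow> Cc (f i)) \<Longrightarrow> I (\<lambda>x. \<Sum>i\<in>J. f i x) = (\<Sum>i\<in>J. I (f i))"
  by (induction J rule: infinite_finite_induct) (auto simp: I_zero I_add Cc_sum)

lemma I_cut:
  assumes "Cc \<phi>" "\<And>x. 0 \<le> \<phi> x" "e > 0"
  shows "Cc (\<lambda>x. max 0 (\<phi> x - e))" "I \<phi> \<le> I (\<lambda>x. max 0 (\<phi> x - e)) + C * e"
proof -
  show 1: "Cc (\<lambda>x. max 0 (\<phi> x - e))"
    using assms Cc_continuous[OF assms(1)] by (intro Cc_subset[OF assms(1)]) (auto intro!: continuous_intros)
  have "I (\<lambda>x. \<phi> x - max 0 (\<phi> x - e)) \<le> C * e"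
  proof (intro I_bound Cc_diff 1 assms(1))
    show "\<bar>\<phi> x - max 0 (\<phi> x - e)\<bar> \<le> e" for x using assms(2)[of x] assms(3) by auto
  qed
  then show "I \<phi> \<le> I (\<lambda>x. max 0 (\<phi> x - e)) + C * e"
    using I_diff[OF assms(1) 1] by simp
qed

text \<open>Only vanishing off \<open>U\<close> is required, not a support inside \<open>U\<close>.
  Where compactness inside \<open>U\<close> matters, \<open>I_cut\<close> confines the function to a
  superlevel set at a positive height.\<close>

definition below :: "'a set \<Rightarrow> ('a \<Rightarrow> real) set" where
  "below U = {\<phi>. Cc \<phi> \<and> (\<forall>x. 0 \<le> \<phi> x \<and> \<phi> x \<le> indicator U x)}"

definition lam :: "'a set \<Rightarrow> ennreal" where
  "lam U = (SUP \<phi>\<in>below U. ennreal (I \<phi>))"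

definition om :: "'a set \<Rightarrow> ennreal" where
  "om A = (INF U\<in>{U. open U \<and> A \<subseteq> U}. lam U)"

lemma belowD: "\<phi> \<in> below U \<Longrightarrow> Cc \<phi>" "\<phi> \<in> below U \<Longrightarrow> 0 \<le> \<phi> x" "\<phi> \<in> below U \<Longrightarrow> \<phi> x \<le> 1"
  "\<phi> \<in> below U \<Longrightarrow> x \<notin> U \<Longrightarrow> \<phi> x = 0"
  unfolding below_def by (auto intro: order_trans[OF _ indicator_le_1] antisym dest!: spec[of _ x])

lemma belowI: "Cc \<phi> \<Longrightarrow> (\<And>x. 0 \<le> \<phi> x) \<Longrightarrow> (\<And>x. \<phi> x \<le> 1) \<Longrightarrow> (\<And>x. x \<notin> U \<Longrightarrow> \<phi> x = 0) \<Longrightarrow> \<phi> \<in> below U"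
  unfolding below_def by (auto simp: indicator_def)

lemma zero_below: "(\<lambda>x. 0) \<in> below U"
  by (intro belowI) auto

lemma lam_ge: "\<phi> \<in> below U \<Longrightarrow> ennreal (I \<phi>) \<le> lam U"
  unfolding lam_def by (rule SUP_upper)

lemma lam_mono: "U \<subseteq> V \<Longrightarrow> lam U \<le> lam V"
  unfolding lam_def by (rule SUP_subset_mono) (auto intro!: belowI intro: belowD)

lemma lam_le: "lam U \<le> ennreal C"
  unfolding lam_def
proof (rule SUP_least)
  fix \<phi> assume p: "\<phi> \<in> below U"
  have "I \<phi> \<le> C * 1" using belowD[OF p] by (intro I_bound) auto
  then show "ennreal (I \<phi>) \<le> ennreal C" by (simp add: ennreal_leI)
qed

lemma om_open: "open U \<Longrightarrow> om U = lam U"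
  unfolding om_def by (rule antisym) (auto intro!: INF_lower INF_greatest lam_mono)

lemma om_le: "open U \<Longrightarrow> A \<subseteq> U \<Longrightarrow> om A \<le> lam U"
  unfolding om_def by (auto intro!: INF_lower)

lemma om_fin: "om A < \<top>"
  using le_less_trans[OF order_trans[OF om_le[of UNIV A] lam_le] ennreal_less_top] by simp

text \<open>After the cut the function lives on the compact set \<open>K\<close>. Some
  \<open>V k\<close> contains \<open>K\<close>, and there the functions \<open>k * d i\<close> with
  \<open>i < k\<close> sum to more than 1; truncating them by the cut function replaces a partition
  of unity.\<close>

lemma lam_Union_ge:
  assumes U: "\<And>i::nat. open (U i)" and p: "\<phi> \<in> below (\<Union>i. U i)" 
  shows "ennreal (I \<phi>) \<le> (\<Sum>i. lam (U i))"
proof (rule ennreal_le_epsilon)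
  fix e0 :: real assume e0: "e0 > 0"
  \<comment> \<open>The summand 1 allows for \<open>C = 0\<close>.\<close>
  define e where "e = e0 / (C + 1)"
  have e: "e > 0" "C * e \<le> e0" using e0 C_nonneg by (auto simp: e_def field_simps)
  let ?f = "\<lambda>x. max 0 (\<phi> x - e)"
  note f = I_cut[OF belowD(1,2)[OF p] e(1)]
  define K where "K = {x. e \<le> \<phi> x}"
  have "closed K" unfolding K_def using Cc_continuous[OF belowD(1)[OF p]] by (intro closed_Collect_le) auto
  have "K \<subseteq> closure {x. \<phi> x \<noteq> 0}" using e closure_subset[of "{x. \<phi> x \<noteq> 0}"] by (auto simp: K_def)
  then have "compact K"
    using compact_Int_closed[OF _ \<open>closed K\<close>, of "closure {x. \<phi> x \<noteq> 0}"] belowD(1)[OF p]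
    by (simp add: Cc_def Int_absorb1)
  define d where "d i = gap (U i)" for i
  note d_cont = continuous_gap[of "U _", folded d_def] and d_nonneg = gap_nonneg[of "U _", folded d_def]
    and d_pos = gap_pos[OF U, folded d_def] and d_zero = gap_zero[of _ "U _", folded d_def]
  define V where "V k = {x. 1 < real k * (\<Sum>i<k. d i x)}" for k
  have V_open: "open (V k)" for k
    unfolding V_def by (intro open_Collect_less continuous_intros d_cont)
  have V_mono: "V k \<subseteq> V l" if "k \<le> l" for k l
  proof
    fix x assume "x \<in> V k"
    then have "1 < real k * (\<Sum>i<k. d i x)" by (simp add: V_def)
    also have "\<dots> \<le> real l * (\<Sum>i<l. d i x)"
      using that d_nonneg by (intro mult_mono sum_mono2 sum_nonneg) auto
    finally show "x \<in> V l" by (simp add: V_def)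
  qed
  have "K \<subseteq> (\<Union>k. V k)"
  proof
    fix x assume "x \<in> K"
    then have "\<phi> x \<noteq> 0" using e by (auto simp: K_def)
    then obtain i where i: "x \<in> U i" using belowD(4)[OF p, of x] by auto
    obtain N where N: "1 / d i x < real N" using reals_Archimedean2 by blast
    define k where "k = max N (Suc i)"
    have "1 < real N * d i x" using N d_pos[OF i] by (simp add: field_simps)
    also have "\<dots> \<le> real k * (\<Sum>j<k. d j x)"
      using d_nonneg by (intro mult_mono member_le_sum) (auto simp: k_def)
    finally show "x \<in> (\<Union>k. V k)" by (auto simp: V_def)
  qed
  then obtain T where T: "finite T" "K \<subseteq> (\<Union>k\<in>T. V k)"
    using compactE_image[OF \<open>compact K\<close>, of UNIV V] V_open by (metis UNIV_I)
  define k where "k = Max (insert 0 T)"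
  have KV: "K \<subseteq> V k"
  proof
    fix x assume "x \<in> K"
    then obtain l where "l \<in> T" "x \<in> V l" using T by blast
    then show "x \<in> V k" using V_mono[of l k] T(1) by (auto simp: k_def)
  qed
  let ?g = "\<lambda>i x. min (?f x) (real k * d i x)"
  have g_cont: "continuous_on UNIV (?g i)" for i
    by (intro continuous_intros d_cont Cc_continuous belowD(1)[OF p])
  have g: "?g i \<in> below (U i)" for i
  proof (rule belowI)
    show "Cc (?g i)"
      using d_nonneg[of i] by (intro Cc_subset[OF f(1) g_cont]) (auto simp: min_def)
    show "0 \<le> ?g i x" for x using d_nonneg[of i x] by auto
    show "?g i x \<le> 1" for x using belowD(3)[OF p, of x] e by (auto simp: min_def max_def)
    show "?g i x = 0" if "x \<notin> U i" for x using d_zero[OF that] by auto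
  qed
  have "?f x \<le> (\<Sum>i<k. ?g i x)" for x
  \<comment> \<open>If no truncation is active at a point of \<open>K\<close>, the sum exceeds 1; if
    one is active, that summand alone equals the cut function.\<close>
  proof (cases "x \<in> K \<and> (\<forall>i<k. real k * d i x \<le> ?f x)")
    case True
    have "?f x \<le> 1" using belowD(3)[OF p, of x] e by auto
    also have "1 \<le> real k * (\<Sum>i<k. d i x)" using True KV by (auto simp: V_def)
    also have "\<dots> = (\<Sum>i<k. ?g i x)" using True by (simp add: sum_distrib_left)
    finally show ?thesis .
  next
    case False
    show ?thesis
    proof (cases "x \<in> K")
      case True
      with False obtain i where i: "i < k" "?f x < real k * d i x" by force
      have "?f x = ?g i x" using i by simp
      also have "\<dots> \<le> (\<Sum>i<k. ?g i x)"
        using i belowD(2)[OF g] by (intro member_le_sum) auto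
      finally show ?thesis .
    next
      case False
      then have "?f x = 0" by (auto simp: K_def)
      then show ?thesis using belowD(2)[OF g] by (auto intro!: sum_nonneg)
    qed
  qed
  then have "I ?f \<le> I (\<lambda>x. \<Sum>i<k. ?g i x)"
    by (intro I_mono f(1) Cc_sum belowD(1)[OF g])
  also have "\<dots> = (\<Sum>i<k. I (?g i))" by (intro I_sum belowD(1)[OF g])
  finally have le: "I ?f \<le> (\<Sum>i<k. I (?g i))" .
  have "ennreal (I \<phi>) \<le> ennreal ((\<Sum>i<k. I (?g i)) + e0)"
    using f(2) le e by (intro ennreal_leI) linarith
  also have "\<dots> = (\<Sum>i<k. ennreal (I (?g i))) + ennreal e0"
    using I_nonneg[OF belowD(1)[OF g] belowD(2)[OF g]] e0
    by (subst ennreal_plus) (auto intro!: sum_nonneg simp: sum_ennreal)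
  also have "\<dots> \<le> (\<Sum>i<k. lam (U i)) + ennreal e0"
    by (intro add_right_mono sum_mono lam_ge g)
  also have "\<dots> \<le> (\<Sum>i. lam (U i)) + ennreal e0"
    by (intro add_right_mono sum_le_suminf) auto
  finally show "ennreal (I \<phi>) \<le> (\<Sum>i. lam (U i)) + ennreal e0" .
qed

lemma lam_Union_le:
  assumes "\<And>i::nat. open (U i)"
  shows "lam (\<Union>i. U i) \<le> (\<Sum>i. lam (U i))"
  unfolding lam_def[of "\<Union>i. U i"] by (intro SUP_least lam_Union_ge assms)

lemma lam_empty: "lam {} = 0"
proof -
  have "I \<phi> = 0" if "\<phi> \<in> below {}" for \<phi>
  proof -
    have "\<phi> = (\<lambda>x. 0)" using belowD(4)[OF that] by auto
    then show ?thesis using I_zero by simp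
  qed
  then show ?thesis unfolding lam_def by (auto intro!: antisym SUP_least)
qed

lemma om_outer: "outer_measure_space UNIV om"
  unfolding outer_measure_space_def
proof (intro conjI)
  show "positive UNIV om" using om_open[of "{}"] lam_empty by (simp add: positive_def)
  show "increasing UNIV om"
    unfolding increasing_def om_def by (auto intro!: INF_superset_mono)
  show "countably_subadditive UNIV om"
    unfolding countably_subadditive_def
  proof safe
    fix A :: "nat \<Rightarrow> 'a set"
    show "om (\<Union>i. A i) \<le> (\<Sum>i. om (A i))"
    proof (rule ennreal_le_epsilon)
      fix e :: real assume e: "0 < e"
      have "\<exists>U. open U \<and> A n \<subseteq> U \<and> lam U \<le> om (A n) + ennreal (e * (1/2) ^ Suc n)" for n
      proof -
        have "0 < ennreal (e * (1/2) ^ Suc n)" using e by simp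
        then have "om (A n) < om (A n) + ennreal (e * (1/2) ^ Suc n)"
          using om_fin[of "A n"] by (auto simp: less_top)
        then obtain U where "open U" "A n \<subseteq> U" "lam U < om (A n) + ennreal (e * (1/2) ^ Suc n)"
          by (subst (asm) om_def) (auto simp: INF_less_iff)
        then show ?thesis by (auto intro: less_imp_le)
      qed
      then obtain U where U: "\<And>n. open (U n)" "\<And>n. A n \<subseteq> U n"
        "\<And>n. lam (U n) \<le> om (A n) + ennreal (e * (1/2) ^ Suc n)" by metis
      have "om (\<Union>i. A i) \<le> lam (\<Union>i. U i)" using U by (intro om_le) auto
      also have "\<dots> \<le> (\<Sum>i. lam (U i))" by (intro lam_Union_le U)
      also have "\<dots> \<le> (\<Sum>n. om (A n) + ennreal (e * (1/2) ^ Suc n))"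
        by (intro suminf_le U) auto
      also have "\<dots> = (\<Sum>n. om (A n)) + (\<Sum>n. ennreal e * ennreal ((1/2) ^ Suc n))"
        using e by (subst suminf_add[symmetric]) (auto simp del: ennreal_suminf_cmult simp add: ennreal_mult[symmetric])
      also have "\<dots> = (\<Sum>n. om (A n)) + e"
        unfolding ennreal_suminf_cmult
        by (subst suminf_ennreal_eq[OF zero_le_power power_half_series]) auto
      finally show "om (\<Union>i. A i) \<le> (\<Sum>i. om (A i)) + ennreal e" .
    qed
  qed
qed

text \<open>Caratheodory's condition for open sets. Given a competitor for
  \<open>U \<inter> V\<close>, the set \<open>W\<close> where it stays below \<open>e\<close>
  contains \<open>A - V\<close>, and its cut version vanishes on \<open>W\<close>; adding a
  competitor for \<open>W\<close> therefore gives one for \<open>U\<close>.\<close>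

lemma om_split:
  assumes V: "open V"
  shows "om (A \<inter> V) + om (A - V) \<le> om A"
proof -
  have *: "om (A \<inter> V) + om (A - V) \<le> lam U" if U: "open U" "A \<subseteq> U" for U
  proof -
    have "om (A \<inter> V) + om (A - V) \<le> lam (U \<inter> V) + om (A - V)"
      using U V by (intro add_right_mono om_le) auto
    also have "\<dots> \<le> lam U"
    proof -
      have "lam (U \<inter> V) + om (A - V) = (SUP \<phi>\<in>below (U \<inter> V). ennreal (I \<phi>) + om (A - V))"
        unfolding lam_def by (subst ennreal_SUP_add_left) (use zero_below in auto)
      also have "\<dots> \<le> lam U"
      proof (rule SUP_least, rule ennreal_le_epsilon)
        fix \<phi> and e0 :: real assume p: "\<phi> \<in> below (U \<inter> V)" and e0: "e0 > 0"
        define e where "e = e0 / (C + 1)"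
        have e: "e > 0" "C * e \<le> e0" using e0 C_nonneg by (auto simp: e_def field_simps)
        let ?f = "\<lambda>x. max 0 (\<phi> x - e)"
        note f = I_cut[OF belowD(1,2)[OF p] e(1)]
        define W where "W = {x \<in> U. \<phi> x < e}"
        have W: "open W" unfolding W_def Collect_conj_eq
          using U Cc_continuous[OF belowD(1)[OF p]] by (intro open_Int open_Collect_less) auto
        have "A - V \<subseteq> W" using U(2) belowD(4)[OF p] e by (auto simp: W_def)
        with W have "om (A - V) \<le> lam W" by (rule om_le)
        have f0: "0 \<le> I ?f" using f(1) by (intro I_nonneg) auto
        have "ennreal (I ?f) + lam W = (SUP \<psi>\<in>below W. ennreal (I ?f) + ennreal (I \<psi>))"
          unfolding lam_def by (subst ennreal_SUP_add_right) (use zero_below in auto)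
        also have "\<dots> \<le> lam U"
        proof (rule SUP_least)
          fix \<psi> assume q: "\<psi> \<in> below W"
          have s: "(\<lambda>x. ?f x + \<psi> x) \<in> below U"
          proof (rule belowI)
            show "Cc (\<lambda>x. ?f x + \<psi> x)" by (intro Cc_add f(1) belowD(1)[OF q])
            show "0 \<le> ?f x + \<psi> x" for x using belowD(2)[OF q, of x] by auto
            show "?f x + \<psi> x \<le> 1" for x
              using belowD(3)[OF p, of x] belowD(3)[OF q, of x] belowD(4)[OF q, of x] e
              by (cases "x \<in> W") (auto simp: W_def)
            show "?f x + \<psi> x = 0" if "x \<notin> U" for x
              using that belowD(4)[OF p, of x] belowD(4)[OF q, of x] e by (auto simp: W_def)
          qed
          have "ennreal (I ?f) + ennreal (I \<psi>) = ennreal (I (\<lambda>x. ?f x + \<psi> x))"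
            using f0 I_nonneg[OF belowD(1)[OF q] belowD(2)[OF q]]
            by (simp add: I_add[OF f(1) belowD(1)[OF q]])
          also have "\<dots> \<le> lam U" by (rule lam_ge[OF s])
          finally show "ennreal (I ?f) + ennreal (I \<psi>) \<le> lam U" .
        qed
        finally have "ennreal (I ?f) + lam W \<le> lam U" .
        have "ennreal (I \<phi>) \<le> ennreal (I ?f + e0)" using f(2) e by (intro ennreal_leI) linarith
        also have "\<dots> = ennreal (I ?f) + ennreal e0" using f0 e0 by simp
        finally have "ennreal (I \<phi>) + om (A - V) \<le> ennreal (I ?f) + ennreal e0 + lam W"
          using \<open>om (A - V) \<le> lam W\<close> by (intro add_mono)
        also have "\<dots> = (ennreal (I ?f) + lam W) + ennreal e0" by (simp add: ac_simps)
        also have "\<dots> \<le> lam U + ennreal e0" using \<open>ennreal (I ?f) + lam W \<le> lam U\<close> by (intro add_right_mono)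
        finally show "ennreal (I \<phi>) + om (A - V) \<le> lam U + ennreal e0" .
      qed
      finally show ?thesis .
    qed
    finally show ?thesis .
  qed
  show ?thesis
    unfolding om_def[of A] by (rule INF_greatest) (use * in auto)
qed

section \<open>The representing measure and its integrals\<close>

definition rm :: "'a measure" where
  "rm = measure_of UNIV (sets borel) om"

lemma sets_rm[simp]: "sets rm = sets borel"
  unfolding rm_def using sets.sigma_sets_eq[of borel] by (simp add: sets_measure_of_conv)

lemma space_rm[simp]: "space rm = UNIV"
  unfolding rm_def by (simp add: space_measure_of_conv)

lemma emeasure_rm: "A \<in> sets borel \<Longrightarrow> emeasure rm A = om A"
proof -
  interpret P: sigma_algebra UNIV "UNIV :: 'a set set"
    using sigma_algebra_Pow[of "UNIV :: 'a set"] by simp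
  let ?L = "lambda_system UNIV UNIV om"
  have ms: "measure_space UNIV ?L om" by (rule P.caratheodory_lemma[OF om_outer])
  have "subadditive UNIV om"
    using om_outer by (intro P.countably_subadditive_subadditive) (auto simp: outer_measure_space_def)
  then have sub: "om A \<le> om (A \<inter> V) + om (A - V)" for A V
    unfolding subadditive_def
    by (metis Diff_Int_distrib Diff_disjoint Int_Diff_Un UNIV_I Int_Diff_disjoint)
  have "V \<in> ?L" if "open V" for V
  proof -
    have "om (V \<inter> X) + om ((UNIV - V) \<inter> X) = om X" for X
    proof -
      have *: "V \<inter> X = X \<inter> V" "(UNIV - V) \<inter> X = X - V" by auto
      show ?thesis unfolding * using sub[of X V] om_split[OF that, of X] by (simp add: antisym)
    qed
    then show ?thesis by (simp add: lambda_system_def)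
  qed
  moreover have "sigma_algebra UNIV ?L" using ms by (simp add: measure_space_def)
  ultimately have "sigma_sets UNIV {V. open V} \<subseteq> ?L"
    by (intro sigma_algebra.sigma_sets_subset) auto
  then have le: "sets borel \<subseteq> ?L" by (simp add: borel_def)
  have "sigma_algebra UNIV (sets (borel :: 'a measure))"
    using sets.sigma_algebra_axioms[of "borel :: 'a measure"] by simp
  from measure_down[OF ms this le] have "measure_space UNIV (sets borel) om" .
  moreover assume "A \<in> sets borel"
  ultimately show ?thesis
    unfolding rm_def
    by (intro emeasure_measure_of_sigma) (auto simp: measure_space_def)
qed

lemma finite_rm: "finite_measure rm"
proof
  show "emeasure rm (space rm) \<noteq> \<infinity>"
    using om_fin[of UNIV] by (simp add: emeasure_rm less_top)
qed

lemma measure_rm_open: "open U \<Longrightarrow> ennreal (measure rm U) = lam U"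
proof -
  assume U: "open U"
  interpret finite_measure rm by (rule finite_rm)
  show ?thesis using emeasure_rm[of U] U om_open[OF U] by (simp add: emeasure_eq_measure)
qed

lemma measure_rm_le_C: "measure rm UNIV \<le> C"
  using measure_rm_open[of UNIV] lam_le[of UNIV] C_nonneg by (simp flip: ennreal_le_iff)

lemma Cc_meas_rm: "Cc \<phi> \<Longrightarrow> \<phi> \<in> borel_measurable rm"
  using borel_measurable_continuous_onI[OF Cc_continuous, of \<phi>]
  by (simp add: measurable_cong_sets[of rm borel borel borel])

lemma Cc_integrable_rm: 
  assumes "Cc \<phi>"
  shows "integrable rm \<phi>"
proof -
  interpret finite_measure rm by (rule finite_rm)
  obtain B where "\<And>x. \<bar>\<phi> x\<bar> \<le> B" using Cc_bounded[OF assms] by metis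
  then show ?thesis using Cc_meas_rm[OF assms] by (intro integrable_const_bound[of _ B]) auto
qed

text \<open>Horizontal slices of \<open>\<phi>\<close> are squeezed between multiples of indicators of superlevel sets.\<close>

lemma slice_bounds:
  assumes "Cc \<phi>" "0 \<le> a" "d > 0"
  defines "s \<equiv> \<lambda>x. min (max (\<phi> x - a) 0) d"
  shows "Cc s" "d * measure rm {x. \<phi> x > a + d} \<le> I s" "I s \<le> d * measure rm {x. \<phi> x > a}"
    "d * measure rm {x. \<phi> x > a + d} \<le> integral\<^sup>L rm s" "integral\<^sup>L rm s \<le> d * measure rm {x. \<phi> x > a}"
proof -
  interpret finite_measure rm by (rule finite_rm)
  note cont = Cc_continuous[OF assms(1)]
  have s_cont: "continuous_on UNIV s" unfolding s_def using cont by (intro continuous_intros)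
  show s: "Cc s" using assms by (intro Cc_subset[OF assms(1) s_cont]) (auto simp: s_def)
  have O: "open {x. \<phi> x > c}" for c using cont by (intro open_Collect_less) auto
  have Om[measurable]: "{x. \<phi> x > c} \<in> sets rm" for c using O by auto
  let ?t = "\<lambda>x. (1 / d) * s x"
  have t: "?t \<in> below {x. \<phi> x > a}"
    using assms(2,3) by (intro belowI Cc_scale s) (auto simp: s_def field_simps min_def max_def)
  have It: "I s = d * I ?t" using I_scale[OF s, of "1 / d"] assms(3) by simp
  have "ennreal (I ?t) \<le> ennreal (measure rm {x. \<phi> x > a})"
    unfolding measure_rm_open[OF O] by (rule lam_ge[OF t])
  then have "I ?t \<le> measure rm {x. \<phi> x > a}" by simp
  then show "I s \<le> d * measure rm {x. \<phi> x > a}" unfolding It using assms(3) by (intro mult_left_mono) auto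
  have "ennreal (measure rm {x. \<phi> x > a + d}) \<le> ennreal (I ?t)"
    unfolding measure_rm_open[OF O] lam_def
  proof (rule SUP_least)
    fix \<psi> assume q: "\<psi> \<in> below {x. \<phi> x > a + d}"
    have "I \<psi> \<le> I ?t"
    proof (rule I_mono[OF belowD(1)[OF q] belowD(1)[OF t]])
      fix x show "\<psi> x \<le> ?t x"
        using belowD(3)[OF q, of x] belowD(4)[OF q, of x] belowD(2)[OF t, of x] assms(3)
        by (cases "\<phi> x > a + d") (auto simp: s_def)
    qed
    then show "ennreal (I \<psi>) \<le> ennreal (I ?t)" by (rule ennreal_leI)
  qed
  moreover have "0 \<le> I ?t" using belowD[OF t] by (intro I_nonneg) auto
  ultimately have "measure rm {x. \<phi> x > a + d} \<le> I ?t" by simp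
  then show "d * measure rm {x. \<phi> x > a + d} \<le> I s" unfolding It using assms(3) by (intro mult_left_mono) auto
  have i: "integrable rm s" by (rule Cc_integrable_rm[OF s])
  have ind: "integrable rm (\<lambda>x. d * indicator {x. \<phi> x > c} x)" for c
    using Om[of c] by (intro integrable_mult_right integrable_real_indicator) (auto simp: less_top[symmetric])
  have "d * measure rm {x. \<phi> x > a + d} = integral\<^sup>L rm (\<lambda>x. d * indicator {x. \<phi> x > a + d} x)" by simp
  also have "\<dots> \<le> integral\<^sup>L rm s"
    by (rule integral_mono[OF ind i]) (use assms(3) in \<open>auto simp: s_def indicator_def\<close>)
  finally show "d * measure rm {x. \<phi> x > a + d} \<le> integral\<^sup>L rm s" .
  have "integral\<^sup>L rm s \<le> integral\<^sup>L rm (\<lambda>x. d * indicator {x. \<phi> x > a} x)"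
    by (rule integral_mono[OF i ind]) (use assms(3) in \<open>auto simp: s_def indicator_def\<close>)
  also have "\<dots> = d * measure rm {x. \<phi> x > a}" by simp
  finally show "integral\<^sup>L rm s \<le> d * measure rm {x. \<phi> x > a}" .
qed

text \<open>The function is cut into \<open>N\<close> slices of height \<open>1 / N\<close>. On each
  slice both functionals lie between the same two multiples of level-set masses, and these bounds
  telescope to a total error of at most \<open>C / N\<close>.\<close>

lemma integral_rm_01:
  assumes p: "Cc \<phi>" "\<And>x. 0 \<le> \<phi> x" "\<And>x. \<phi> x \<le> 1"
  shows "integral\<^sup>L rm \<phi> = I \<phi>"
proof -
  have bound: "\<bar>I \<phi> - integral\<^sup>L rm \<phi>\<bar> \<le> C * inverse (real (Suc n))" for n
  proof -
    define N where "N = Suc n"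
    define d where "d = 1 / real N"
    have d: "d > 0" "real N * d = 1" by (auto simp: d_def N_def)
    define s where "s j x = min (max (\<phi> x - real j * d) 0) d" for j x
    define M where "M j = measure rm {x. \<phi> x > real j * d}" for j
    have sum_s: "(\<Sum>j<k. s j x) = min (\<phi> x) (real k * d)" for k x
      using d(1) p(2)[of x] by (induction k) (auto simp: s_def min_def max_def algebra_simps)
    have phi: "\<phi> = (\<lambda>x. \<Sum>j<N. s j x)" using sum_s[of _ N] d(2) p(3) by auto
    have ar: "real j * d + d = real (Suc j) * d" for j by (simp add: algebra_simps)
    note sb = slice_bounds[OF p(1) _ d(1), of "real j * d" for j, folded s_def, unfolded ar, folded M_def]
    have sc: "Cc (s j)" for j using sb(1) d by simp
    have "I \<phi> = (\<Sum>j<N. I (s j))" by (subst phi) (intro I_sum sc)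
    moreover have "integral\<^sup>L rm \<phi> = (\<Sum>j<N. integral\<^sup>L rm (s j))"
      by (subst phi) (intro Bochner_Integration.integral_sum Cc_integrable_rm sc)
    ultimately have "\<bar>I \<phi> - integral\<^sup>L rm \<phi>\<bar> = \<bar>\<Sum>j<N. I (s j) - integral\<^sup>L rm (s j)\<bar>"
      by (simp add: sum_subtractf)
    also have "\<dots> \<le> (\<Sum>j<N. \<bar>I (s j) - integral\<^sup>L rm (s j)\<bar>)" by (rule sum_abs)
    also have "\<dots> \<le> (\<Sum>j<N. d * (M j - M (Suc j)))"
    proof (rule sum_mono)
      fix j
      show "\<bar>I (s j) - integral\<^sup>L rm (s j)\<bar> \<le> d * (M j - M (Suc j))"
        using sb(2-5)[of j] d by (simp add: algebra_simps abs_le_iff)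
    qed
    also have "\<dots> = d * (M 0 - M N)" by (simp add: sum_distrib_left[symmetric] sum_lessThan_telescope')
    also have "\<dots> \<le> d * C"
    proof -
      interpret finite_measure rm by (rule finite_rm)
      have "M 0 \<le> measure rm UNIV"
        unfolding M_def using finite_measure_mono[of "{x. \<phi> x > real 0 * d}" UNIV] by simp
      moreover have "0 \<le> M N" by (simp add: M_def)
      ultimately show ?thesis using measure_rm_le_C d(1) by (intro mult_left_mono) auto
    qed
    finally show ?thesis by (simp add: d_def N_def field_simps)
  qed
  have "\<bar>I \<phi> - integral\<^sup>L rm \<phi>\<bar> \<le> C * 0"
    by (rule LIMSEQ_le_const[OF tendsto_mult_left[OF LIMSEQ_inverse_real_of_nat]]) (use bound in auto)
  then show ?thesis by simp
qed

lemma integral_rm: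
  assumes p: "Cc \<phi>"
  shows "integral\<^sup>L rm \<phi> = I \<phi>"
proof -
  have nn: "integral\<^sup>L rm f = I f" if f: "Cc f" "\<And>x. 0 \<le> f x" for f
  proof -
    obtain B where B: "B > 0" "\<And>x. \<bar>f x\<bar> \<le> B" using Cc_bounded[OF f(1)] by metis
    have "integral\<^sup>L rm (\<lambda>x. (1 / B) * f x) = I (\<lambda>x. (1 / B) * f x)"
      using B f(2) by (intro integral_rm_01 Cc_scale f(1)) (auto simp: abs_le_iff field_simps)
    then show ?thesis using B(1) I_scale[OF f(1), of "1/B"] by simp
  qed
  note cont = Cc_continuous[OF p]
  have 1: "Cc (\<lambda>x. max 0 (\<phi> x))" "Cc (\<lambda>x. max 0 (- \<phi> x))"
    using cont by (intro Cc_subset[OF p] continuous_intros; simp)+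
  have eq: "\<phi> = (\<lambda>x. max 0 (\<phi> x) - max 0 (- \<phi> x))" by (auto simp: max_def)
  have "integral\<^sup>L rm (\<lambda>x. max 0 (\<phi> x) - max 0 (- \<phi> x)) = I (\<lambda>x. max 0 (\<phi> x) - max 0 (- \<phi> x))"
    using I_diff[OF 1] nn[OF 1(1)] nn[OF 1(2)] Cc_integrable_rm[OF 1(1)] Cc_integrable_rm[OF 1(2)] by simp
  then show ?thesis using eq by simp
qed

theorem Riesz_representation:
  "\<exists>\<mu>. sets \<mu> = sets borel \<and> finite_measure \<mu> \<and> (\<forall>\<phi>. Cc \<phi> \<longrightarrow> integral\<^sup>L \<mu> \<phi> = I \<phi>)"
  using integral_rm finite_rm by (intro exI[of _ rm]) auto

end

section \<open>Energy measures of bounded functions\<close>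

text \<open>Local compactness and the Lindelof property write \<open>U\<close> as a countable union
  of relatively compact open sets, whose gap functions have compact support.\<close>

lemma open_Cc_approx:
  fixes U :: "'a::{metric_space, second_countable_topology} set"
  assumes lc: "locally_compact_space (euclidean :: 'a topology)" and U: "open U"
  obtains \<phi> :: "nat \<Rightarrow> 'a \<Rightarrow> real" where "\<And>k. Cc (\<phi> k)" "\<And>k x. 0 \<le> \<phi> k x" "\<And>k x. \<phi> k x \<le> 1"
    "\<And>x. (\<lambda>k. \<phi> k x) \<longlonglongrightarrow> indicator U x"
proof -
  define G where "G = {V. open V \<and> V \<subseteq> U \<and> compact (closure V)}"
  have cover: "\<Union>G = U"
  proof
    show "\<Union>G \<subseteq> U" by (auto simp: G_def)
    show "U \<subseteq> \<Union>G"
    proof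
      fix x assume x: "x \<in> U"
      have "\<exists>W. open W \<and> (\<exists>K. compact K \<and> x \<in> W \<and> W \<subseteq> K)"
        using lc unfolding locally_compact_space_def by auto
      then obtain W K where WK: "open W" "compact K" "x \<in> W" "W \<subseteq> K" by blast
      have "closure (W \<inter> U) \<subseteq> K" using WK by (intro closure_minimal) (auto intro: compact_imp_closed)
      then have "compact (closure (W \<inter> U))" using compact_Int_closed[OF WK(2), of "closure (W \<inter> U)"] by (simp add: Int_absorb1)
      then show "x \<in> \<Union>G" using x WK U by (auto simp: G_def intro!: exI[of _ "W \<inter> U"])
    qed
  qed
  obtain G' where G': "G' \<subseteq> G" "countable G'" "\<Union>G' = \<Union>G"
    using Lindelof[of G] by (auto simp: G_def)
  \<comment> \<open>The empty set is inserted so that the family to be enumerated is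
    nonempty.\<close>
  define V where "V = from_nat_into (insert {} G')"
  have rV: "range V = insert {} G'" unfolding V_def using G' by (intro range_from_nat_into) auto
  have V: "open (V i)" "compact (closure (V i))" for i
    using rV G'(1) by (auto simp: G_def dest!: arg_cong[where f="\<lambda>S. V i \<in> S"])
  have VU: "(\<Union>i. V i) = U" using rV G'(3) cover by auto
  define d where "d i = gap (V i)" for i
  note d_cont = continuous_gap[of "V _", folded d_def] and d_nonneg = gap_nonneg[of "V _", folded d_def]
    and d_pos = gap_pos[OF V(1), folded d_def] and d_zero = gap_zero[of _ "V _", folded d_def]
  have dC: "Cc (d i)" for i
  proof -
    have "{x. d i x \<noteq> 0} = V i" using d_pos[of _ i] d_zero[of _ i] by force
    then show ?thesis using V d_cont by (simp add: Cc_def)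
  qed
  define \<phi> where "\<phi> k x = min 1 (real k * (\<Sum>i<k. d i x))" for k x
  show thesis
  proof (rule that[of \<phi>])
    show "Cc (\<phi> k)" for k
    proof (rule Cc_subset)
      show "Cc (\<lambda>x. \<Sum>i<k. d i x)" by (intro Cc_sum dC)
      show "continuous_on UNIV (\<phi> k)" unfolding \<phi>_def by (intro continuous_intros d_cont)
    qed (auto simp: \<phi>_def)
    show "0 \<le> \<phi> k x" for k x using d_nonneg by (auto simp: \<phi>_def intro!: mult_nonneg_nonneg sum_nonneg)
    show "\<phi> k x \<le> 1" for k x by (auto simp: \<phi>_def)
    show "(\<lambda>k. \<phi> k x) \<longlonglongrightarrow> indicator U x" for x
    proof (cases "x \<in> U")
      case False
      then have "d i x = 0" for i using VU by (intro d_zero) auto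
      then show ?thesis using False by (simp add: \<phi>_def)
    next
      case True
      then obtain i where i: "x \<in> V i" using VU by auto
      obtain N where N: "1 / d i x < real N" using reals_Archimedean2 by blast
      have "\<phi> k x = 1" if k: "k \<ge> max N (Suc i)" for k
      proof -
        have "1 \<le> real N * d i x" using N d_pos[OF i] by (simp add: field_simps)
        also have "\<dots> \<le> real k * (\<Sum>j<k. d j x)"
          using d_nonneg k by (intro mult_mono member_le_sum) auto
        finally show ?thesis by (simp add: \<phi>_def)
      qed
      then have "\<forall>\<^sub>F k in sequentially. \<phi> k x = 1" by (rule eventually_sequentiallyI)
      then show ?thesis using True by (simp add: tendsto_eventually)
    qed
  qed
qed

lemma Cc_integrable:
  fixes \<phi> :: "'a::{metric_space, second_countable_topology} \<Rightarrow> real"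
  assumes "finite_measure \<mu>" "sets \<mu> = sets borel" "Cc \<phi>"
  shows "integrable \<mu> \<phi>"
proof -
  interpret finite_measure \<mu> by fact
  have "\<phi> \<in> borel_measurable \<mu>"
    using borel_measurable_continuous_onI[OF Cc_continuous[OF assms(3)]]
    by (simp add: measurable_cong_sets[OF assms(2) refl])
  moreover obtain B where "\<And>x. \<bar>\<phi> x\<bar> \<le> B" using Cc_bounded[OF assms(3)] by metis
  ultimately show ?thesis by (intro integrable_const_bound[of _ B]) auto
qed

lemma Cc_integral_tendsto:
  fixes \<phi> :: "nat \<Rightarrow> 'a::{metric_space, second_countable_topology} \<Rightarrow> real"
  assumes "finite_measure \<mu>" "sets \<mu> = sets borel" "open U"
    and "\<And>k. Cc (\<phi> k)" "\<And>k x. 0 \<le> \<phi> k x" "\<And>k x. \<phi> k x \<le> 1" "\<And>x. (\<lambda>k. \<phi> k x) \<longlonglongrightarrow> indicator U x"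
  shows "(\<lambda>k. integral\<^sup>L \<mu> (\<phi> k)) \<longlonglongrightarrow> measure \<mu> U"
proof -
  interpret finite_measure \<mu> by fact
  have U: "U \<in> sets \<mu>" using assms(2,3) by simp
  have "(\<lambda>k. integral\<^sup>L \<mu> (\<phi> k)) \<longlonglongrightarrow> integral\<^sup>L \<mu> (indicator U)"
  proof (rule integral_dominated_convergence[where w="\<lambda>_. 1"])
    show "\<phi> k \<in> borel_measurable \<mu>" for k using Cc_integrable[OF assms(1,2,4), of k] by auto
    show "AE x in \<mu>. norm (\<phi> k x) \<le> 1" for k using assms(5,6) by auto
  qed (use assms borel_measurable_indicator[OF U] in auto)
  also have "integral\<^sup>L \<mu> (indicator U) = measure \<mu> U" 
    using U sets.sets_into_space[OF U] by (simp add: Int_absorb2)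
  finally show ?thesis .
qed

text \<open>Formulated for signed combinations because an identity between several energy measures
  is one linear relation. Dominated convergence gives it for open sets, the pi-lambda theorem for
  Borel sets.\<close>

lemma signed_measure_zero:
  fixes \<mu> :: "nat \<Rightarrow> 'a::{metric_space, second_countable_topology} measure"
  assumes lc: "locally_compact_space (euclidean :: 'a topology)"
    and fin: "\<And>i. finite_measure (\<mu> i)" and sets: "\<And>i. sets (\<mu> i) = sets borel"
    and zero: "\<And>\<phi>. Cc \<phi> \<Longrightarrow> (\<Sum>i<n. a i * integral\<^sup>L (\<mu> i) \<phi>) = 0"
    and A: "A \<in> sets borel"
  shows "(\<Sum>i<n. a i * measure (\<mu> i) A) = 0"
proof -
  have sp: "space (\<mu> i) = UNIV" for i using sets_eq_imp_space_eq[OF sets, of i] by simp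
  have op: "(\<Sum>i<n. a i * measure (\<mu> i) U) = 0" if U: "open U" for U
  proof -
    obtain \<phi> :: "nat \<Rightarrow> 'a \<Rightarrow> real" where p: "\<And>k. Cc (\<phi> k)" "\<And>k x. 0 \<le> \<phi> k x" "\<And>k x. \<phi> k x \<le> 1"
      "\<And>x. (\<lambda>k. \<phi> k x) \<longlonglongrightarrow> indicator U x" using open_Cc_approx[OF lc U] by metis
    have "(\<lambda>k. \<Sum>i<n. a i * integral\<^sup>L (\<mu> i) (\<phi> k)) \<longlonglongrightarrow> (\<Sum>i<n. a i * measure (\<mu> i) U)"
      by (intro tendsto_intros Cc_integral_tendsto fin sets U p)
    then show ?thesis using zero[OF p(1)] by (simp add: LIMSEQ_const_iff)
  qed
  have "Int_stable {U::'a set. open U}" by (auto simp: Int_stable_def)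
  moreover have "{U::'a set. open U} \<subseteq> Pow UNIV" by simp
  moreover have "A \<in> sigma_sets UNIV {U. open U}" using A by (simp add: borel_def)
  ultimately show ?thesis
  proof (induction rule: sigma_sets_induct_disjoint)
    case (basic A) then show ?case using op by simp
  next
    case (compl A)
    then have "A \<in> sets borel" by (simp add: borel_def)
    then have "measure (\<mu> i) (UNIV - A) = measure (\<mu> i) UNIV - measure (\<mu> i) A" for i
      using finite_measure.finite_measure_compl[OF fin, of A i] sets sp by simp
    then show ?case using compl op[of UNIV] by (simp add: right_diff_distrib sum_subtractf)
  next
    case (union A)
    then have A: "range A \<subseteq> sets borel" by (simp add: borel_def)
    have "(\<lambda>k. \<Sum>i<n. a i * measure (\<mu> i) (A k)) sums (\<Sum>i<n. a i * measure (\<mu> i) (\<Union>k. A k))"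
      using A union by (intro sums_sum sums_mult finite_measure.finite_measure_UNION fin) (auto simp: sets)
    then have "(\<lambda>k. 0) sums (\<Sum>i<n. a i * measure (\<mu> i) (\<Union>k. A k))" using union by simp
    then show ?case using sums_unique2 sums_zero by blast
  qed auto
qed

text \<open>Quadratic forms described by identities linear in the values of \<open>q\<close>. Such
  identities pass from test functions to measures, through limits and on to densities, and they
  still give polarisation and Cauchy-Schwarz.\<close>

locale quad =
  fixes V :: "('a \<Rightarrow> real) set" and q :: "('a \<Rightarrow> real) \<Rightarrow> real"
  assumes V_add: "f \<in> V \<Longrightarrow> g \<in> V \<Longrightarrow> (\<lambda>x. f x + g x) \<in> V"
    and V_scale: "f \<in> V \<Longrightarrow> (\<lambda>x. c * f x) \<in> V"
    and q_nonneg: "f \<in> V \<Longrightarrow> 0 \<le> q f"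
    and q_add3: "f \<in> V \<Longrightarrow> g \<in> V \<Longrightarrow> h \<in> V \<Longrightarrow>
       q (\<lambda>x. f x + g x + h x) + q f + q g + q h = q (\<lambda>x. f x + g x) + q (\<lambda>x. g x + h x) + q (\<lambda>x. f x + h x)"
    and q_line: "f \<in> V \<Longrightarrow> g \<in> V \<Longrightarrow>
       q (\<lambda>x. f x + t * g x) = (1 - t) * q f + t * q (\<lambda>x. f x + g x) + (t\<^sup>2 - t) * q g"
begin

definition b :: "('a \<Rightarrow> real) \<Rightarrow> ('a \<Rightarrow> real) \<Rightarrow> real" where
  "b f g = (q (\<lambda>x. f x + g x) - q f - q g) / 2"

lemma q_expand: "f \<in> V \<Longrightarrow> g \<in> V \<Longrightarrow> q (\<lambda>x. f x + t * g x) = q f + 2 * t * b f g + t\<^sup>2 * q g"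
  unfolding b_def by (subst q_line) (auto simp: field_simps)

lemma b_CS: "f \<in> V \<Longrightarrow> g \<in> V \<Longrightarrow> (b f g)\<^sup>2 \<le> q f * q g"
  by (rule sq_le_of_quadratic_nonneg) (metis q_expand q_nonneg V_add V_scale)

lemma abs_b_le: "f \<in> V \<Longrightarrow> g \<in> V \<Longrightarrow> \<bar>b f g\<bar> \<le> sqrt (q f) * sqrt (q g)"
  using b_CS[of f g] by (metis real_sqrt_abs real_sqrt_le_iff real_sqrt_mult)

lemma q_diff_le:
  assumes "f \<in> V" "g \<in> V"
  shows "\<bar>q f - q g\<bar> \<le> 2 * (sqrt (q g) * sqrt (q (\<lambda>x. f x - g x))) + q (\<lambda>x. f x - g x)"
proof -
  let ?d = "\<lambda>x. f x - g x"
  have d: "?d \<in> V" using V_add[OF assms(1) V_scale[OF assms(2), of "-1"]] by simp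
  have "q f = q g + 2 * b g ?d + q ?d" using q_expand[OF assms(2) d, of 1] by simp
  then show ?thesis using abs_b_le[OF assms(2) d] q_nonneg[OF d] by linarith
qed

end

locale reg_dform = dform m F E
  for m :: "'a::{metric_space, second_countable_topology} measure" and F E +
  assumes lc: "locally_compact_space (euclidean :: 'a topology)"
    and sets_m: "sets m = sets borel"
    and reg: "regular_df m F E"
begin

section \<open>Bounded elements of the domain and their approximating densities\<close>

lemma cont_meas: "continuous_on UNIV f \<Longrightarrow> f \<in> borel_measurable m"
  using borel_measurable_continuous_onI[of f] by (simp add: measurable_cong_sets[OF sets_m refl])

lemma Cc_meas: "Cc f \<Longrightarrow> f \<in> borel_measurable m"
  by (rule cont_meas[OF Cc_continuous])

lemma Cc_approx:
  assumes "Cc f" "e > 0"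
  obtains g where "g \<in> F" "Cc g" "\<And>x. \<bar>f x - g x\<bar> < e"
  using reg assms unfolding regular_df_def by metis

lemma F_approx:
  assumes "f \<in> F" "e > 0"
  obtains g where "g \<in> F" "Cc g" "E1norm m E (\<lambda>x. f x - g x) < e"
  using reg assms unfolding regular_df_def by metis

definition Fb :: "('a \<Rightarrow> real) set" where
  "Fb = {f \<in> F. bounded (range f)}"

lemma Fb_iff: "f \<in> Fb \<longleftrightarrow> f \<in> F \<and> (\<exists>M. \<forall>x. \<bar>f x\<bar> \<le> M)"
  unfolding Fb_def bounded_iff by auto

lemma Fb_F: "f \<in> Fb \<Longrightarrow> f \<in> F"
  by (simp add: Fb_iff)

lemma Cc_Fb: "f \<in> F \<Longrightarrow> Cc f \<Longrightarrow> f \<in> Fb"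
  unfolding Fb_iff using Cc_bounded by metis

lemma Fb_add: "f \<in> Fb \<Longrightarrow> g \<in> Fb \<Longrightarrow> (\<lambda>x. f x + g x) \<in> Fb"
proof -
  assume f: "f \<in> Fb" and g: "g \<in> Fb"
  obtain M M' where "\<And>x. \<bar>f x\<bar> \<le> M" "\<And>x. \<bar>g x\<bar> \<le> M'" using f g by (auto simp: Fb_iff)
  then have "\<bar>f x + g x\<bar> \<le> M + M'" for x by (meson abs_triangle_ineq add_mono order_trans)
  then show ?thesis using f g by (auto simp: Fb_iff F_add)
qed

lemma Fb_scale: "f \<in> Fb \<Longrightarrow> (\<lambda>x. c * f x) \<in> Fb"
proof -
  assume f: "f \<in> Fb"
  obtain M where "\<And>x. \<bar>f x\<bar> \<le> M" using f by (auto simp: Fb_iff)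
  then have "\<bar>c * f x\<bar> \<le> \<bar>c\<bar> * M" for x by (simp add: abs_mult mult_left_mono)
  then show ?thesis using f by (auto simp: Fb_iff F_scale)
qed

lemma Fb_diff: "f \<in> Fb \<Longrightarrow> g \<in> Fb \<Longrightarrow> (\<lambda>x. f x - g x) \<in> Fb"
  using Fb_add[OF _ Fb_scale[of g "-1"], of f] by simp

lemma Fb_mult: "f \<in> Fb \<Longrightarrow> g \<in> Fb \<Longrightarrow> (\<lambda>x. f x * g x) \<in> F"
  using F_mult unfolding Fb_iff by blast

abbreviation dens :: "('a \<Rightarrow> real) \<Rightarrow> nat \<Rightarrow> 'a \<Rightarrow> real" where
  "dens f n x \<equiv> real (Suc n) * cdc (real (Suc n)) f x"

lemma dens:
  assumes "f \<in> Fb"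
  shows dens_nonneg: "AE x in m. 0 \<le> dens f n x"
    and dens_int: "integrable m (dens f n)"
    and dens_mass: "integral\<^sup>L m (dens f n) \<le> 2 * E f f"
    and dens_int_mult: "\<phi> \<in> borel_measurable m \<Longrightarrow> (\<And>x. \<bar>\<phi> x\<bar> \<le> c) \<Longrightarrow> integrable m (\<lambda>x. \<phi> x * dens f n x)"
proof -
  obtain M where M: "\<And>x. \<bar>f x\<bar> \<le> M" and f: "f \<in> F" using assms by (auto simp: Fb_iff)
  have n: "real (Suc n) > 0" by simp
  show "AE x in m. 0 \<le> dens f n x" using cdc_nonneg[OF n F_L2[OF f] M] by auto
  show "integrable m (dens f n)" using integrable_cdc(2)[OF n F_L2[OF f] M] by (rule integrable_mult_right)
  show "integral\<^sup>L m (dens f n) \<le> 2 * E f f" by (rule cdc_mass[OF f M n])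
  show "integrable m (\<lambda>x. \<phi> x * dens f n x)" if "\<phi> \<in> borel_measurable m" "\<And>x. \<bar>\<phi> x\<bar> \<le> c"
    using integrable_mult_right[OF integrable_bdd_cdc[OF n F_L2[OF f] M that], of "real (Suc n)"]
    by (simp only: mult.left_commute)
qed

lemma dens_integral_le:
  assumes "f \<in> Fb" "\<phi> \<in> borel_measurable m" "\<And>x. \<bar>\<phi> x\<bar> \<le> c"
  shows "\<bar>integral\<^sup>L m (\<lambda>x. \<phi> x * dens f n x)\<bar> \<le> 2 * E f f * c"
proof -
  have c: "0 \<le> c" using assms(3)[of undefined] by linarith
  have "\<bar>integral\<^sup>L m (\<lambda>x. \<phi> x * dens f n x)\<bar> \<le> integral\<^sup>L m (\<lambda>x. \<bar>\<phi> x * dens f n x\<bar>)"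
    by (rule integral_abs_bound)
  also have "\<dots> \<le> integral\<^sup>L m (\<lambda>x. c * dens f n x)"
  proof (rule integral_mono_AE)
    show "integrable m (\<lambda>x. \<bar>\<phi> x * dens f n x\<bar>)" using dens_int_mult[OF assms] by (rule integrable_abs)
    show "integrable m (\<lambda>x. c * dens f n x)" using dens_int[OF assms(1)] by (rule integrable_mult_right)
    show "AE x in m. \<bar>\<phi> x * dens f n x\<bar> \<le> c * dens f n x"
      using dens_nonneg[OF assms(1), of n]
    proof eventually_elim
      case (elim x)
      then show ?case unfolding abs_mult[of "\<phi> x"] using assms(3)[of x] by (intro mult_mono) auto
    qed
  qed
  also have "\<dots> = c * integral\<^sup>L m (dens f n)" by simp
  also have "\<dots> \<le> c * (2 * E f f)" by (intro mult_left_mono dens_mass assms c)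
  finally show ?thesis by (simp add: mult.commute)
qed

lemma Lam_lim:
  assumes "f \<in> Fb" "\<phi> \<in> Fb"
  shows "(\<lambda>n. integral\<^sup>L m (\<lambda>x. \<phi> x * dens f n x)) \<longlonglongrightarrow> Lam f \<phi>"
  using Lam_limit assms unfolding Fb_iff by blast

lemma Lam_le:
  assumes "f \<in> Fb" "\<phi> \<in> F" "\<And>x. \<bar>\<phi> x\<bar> \<le> c"
  shows "\<bar>Lam f \<phi>\<bar> \<le> 2 * E f f * c"
proof (rule LIMSEQ_le_const2[OF tendsto_rabs[OF Lam_lim]])
  show "\<phi> \<in> Fb" using assms by (auto simp: Fb_iff)
  show "\<exists>N. \<forall>n\<ge>N. \<bar>integral\<^sup>L m (\<lambda>x. \<phi> x * dens f n x)\<bar> \<le> 2 * E f f * c"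
    using dens_integral_le[OF assms(1) F_meas[OF assms(2)] assms(3)] by blast
qed fact

text \<open>A test function in \<open>Cc\<close> need not lie in \<open>F\<close>. Its uniform
  approximants in \<open>F\<close> have convergent integrals, and the mass bound makes the error
  uniform in \<open>n\<close>.\<close>

lemma dens_convergent:
  assumes f: "f \<in> Fb" and p: "Cc \<phi>"
  shows "convergent (\<lambda>n. integral\<^sup>L m (\<lambda>x. \<phi> x * dens f n x))"
proof (rule Cauchy_convergent, rule CauchyI)
  let ?J = "\<lambda>\<phi> n. integral\<^sup>L m (\<lambda>x. \<phi> x * dens f n x)"
  fix e :: real assume e: "e > 0"
  define C where "C = 2 * E f f"
  have C: "0 \<le> C" using E_nonneg[OF Fb_F[OF f]] by (simp add: C_def)
  define d where "d = e / (4 * (C + 1))"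
  have d: "d > 0" "C * d \<le> e / 4" using e C by (auto simp: d_def field_simps)
  obtain g where g: "g \<in> F" "Cc g" "\<And>x. \<bar>\<phi> x - g x\<bar> < d" using Cc_approx[OF p d(1)] by metis
  obtain B B' where B: "\<And>x. \<bar>\<phi> x\<bar> \<le> B" "\<And>x. \<bar>g x\<bar> \<le> B'" using Cc_bounded[OF p] Cc_bounded[OF g(2)] by metis
  have close: "\<bar>?J \<phi> n - ?J g n\<bar> \<le> e / 4" for n
  proof -
    have "?J \<phi> n - ?J g n = ?J (\<lambda>x. \<phi> x - g x) n"
      using dens_int_mult[OF f Cc_meas[OF p] B(1)] dens_int_mult[OF f Cc_meas[OF g(2)] B(2)]
      by (simp add: left_diff_distrib)
    also have "\<bar>\<dots>\<bar> \<le> C * d"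
      unfolding C_def using g(3) Cc_meas[OF p] Cc_meas[OF g(2)]
      by (intro dens_integral_le f) (auto intro: less_imp_le)
    finally show ?thesis using d by simp
  qed
  have "Cauchy (?J g)" using Lam_lim[OF f Cc_Fb[OF g(1,2)]] LIMSEQ_imp_Cauchy by blast
  then obtain N where N: "\<And>i j. i \<ge> N \<Longrightarrow> j \<ge> N \<Longrightarrow> norm (?J g i - ?J g j) < e / 4"
    using CauchyD[of "?J g" "e / 4"] e by auto
  have "norm (?J \<phi> i - ?J \<phi> j) < e" if "i \<ge> N" "j \<ge> N" for i j
    using N[OF that] close[of i] close[of j] e unfolding real_norm_def by linarith
  then show "\<exists>M. \<forall>i\<ge>M. \<forall>j\<ge>M. norm (?J \<phi> i - ?J \<phi> j) < e" by blast
qed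

lemma emeas_bdd_ex:
  assumes f: "f \<in> Fb"
  shows "\<exists>\<mu>. sets \<mu> = sets borel \<and> finite_measure \<mu> \<and> (\<forall>\<phi>\<in>F. Cc \<phi> \<longrightarrow> integral\<^sup>L \<mu> \<phi> = Lam f \<phi>)"
proof -
  define J where "J \<phi> n = integral\<^sup>L m (\<lambda>x. \<phi> x * dens f n x)" for \<phi> n
  define I where "I \<phi> = lim (J \<phi>)" for \<phi>
  have I: "J \<phi> \<longlonglongrightarrow> I \<phi>" if "Cc \<phi>" for \<phi>
    using dens_convergent[OF f that] unfolding I_def J_def convergent_LIMSEQ_iff .
  have int: "integrable m (\<lambda>x. \<phi> x * dens f n x)" if "Cc \<phi>" for \<phi> n
    using Cc_bounded[OF that] dens_int_mult[OF f Cc_meas[OF that]] by metis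
  interpret R: Cc_functional I "2 * E f f"
  proof
    fix g h :: "'a \<Rightarrow> real" assume gh: "Cc g" "Cc h"
    have "(\<lambda>n. J g n + J h n) \<longlonglongrightarrow> I g + I h" by (intro tendsto_add I gh)
    moreover have "J g n + J h n = J (\<lambda>x. g x + h x) n" for n
      unfolding J_def using int[OF gh(1)] int[OF gh(2)] by (simp add: distrib_right)
    ultimately have "J (\<lambda>x. g x + h x) \<longlonglongrightarrow> I g + I h" by simp
    then show "I (\<lambda>x. g x + h x) = I g + I h" by (rule LIMSEQ_unique[OF I[OF Cc_add[OF gh]]])
  next
    fix g :: "'a \<Rightarrow> real" and c assume g: "Cc g"
    have "(\<lambda>n. c * J g n) \<longlonglongrightarrow> c * I g" by (intro tendsto_mult_left I g)
    moreover have "c * J g n = J (\<lambda>x. c * g x) n" for n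
      unfolding J_def by (simp add: mult.assoc)
    ultimately have "J (\<lambda>x. c * g x) \<longlonglongrightarrow> c * I g" by simp
    then show "I (\<lambda>x. c * g x) = c * I g" by (rule LIMSEQ_unique[OF I[OF Cc_scale[OF g]]])
  next
    fix g :: "'a \<Rightarrow> real" assume g: "Cc g" "\<And>x. 0 \<le> g x"
    have "0 \<le> J g n" for n
      unfolding J_def using dens_nonneg[OF f, of n] g(2) by (intro integral_nonneg_AE) auto
    then show "0 \<le> I g" by (intro LIMSEQ_le_const[OF I[OF g(1)]]) auto
  next
    fix g :: "'a \<Rightarrow> real" and c assume g: "Cc g" "\<And>x. \<bar>g x\<bar> \<le> c"
    have "\<bar>J g n\<bar> \<le> 2 * E f f * c" for n
      unfolding J_def by (rule dens_integral_le[OF f Cc_meas[OF g(1)] g(2)])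
    then show "I g \<le> 2 * E f f * c" by (intro LIMSEQ_le_const2[OF I[OF g(1)]]) (auto simp: abs_le_iff)
  qed
  obtain \<mu> where \<mu>: "sets \<mu> = sets borel" "finite_measure \<mu>" "\<And>\<phi>. Cc \<phi> \<Longrightarrow> integral\<^sup>L \<mu> \<phi> = I \<phi>"
    using R.Riesz_representation by blast
  have "I \<phi> = Lam f \<phi>" if "\<phi> \<in> F" "Cc \<phi>" for \<phi>
    using I[OF that(2)] Lam_lim[OF f Cc_Fb[OF that]] LIMSEQ_unique unfolding J_def by blast
  with \<mu> show ?thesis by (intro exI[of _ \<mu>]) auto
qed

abbreviation "mb \<equiv> emeas_bdd F E"

text \<open>Existence resolves the choice in \<open>emeas_bdd\<close>; everything about the chosen
  measures is derived from these three properties.\<close>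

lemma mb:
  assumes "f \<in> Fb"
  shows sets_mb: "sets (mb f) = sets borel" and fin_mb: "finite_measure (mb f)"
    and int_mb: "\<phi> \<in> F \<Longrightarrow> Cc \<phi> \<Longrightarrow> integral\<^sup>L (mb f) \<phi> = Lam f \<phi>"
  using someI_ex[OF emeas_bdd_ex[OF assms, unfolded Lam_def]]
  unfolding emeas_bdd_def[symmetric] Lam_def by blast+

text \<open>The relation is assumed only for test functions in \<open>F\<close>. Uniform
  approximation and finiteness of the measures extend it to \<open>Cc\<close>, and then
  \<open>signed_measure_zero\<close> applies.\<close>

lemma mb_identity:
  fixes n :: nat
  assumes fs: "\<And>i. i < n \<Longrightarrow> fs i \<in> Fb"
    and zero: "\<And>\<phi>. \<phi> \<in> F \<Longrightarrow> Cc \<phi> \<Longrightarrow> (\<Sum>i<n. a i * Lam (fs i) \<phi>) = 0"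
    and A: "A \<in> sets borel"
  shows "(\<Sum>i<n. a i * measure (mb (fs i)) A) = 0"
proof -
  \<comment> \<open>Padding by the zero function, because \<open>signed_measure_zero\<close> expects
    a finite measure at every index.\<close>
  define gs where "gs i = (if i < n then fs i else (\<lambda>x. 0))" for i
  have "(\<lambda>x. 0) \<in> Fb" by (auto simp: Fb_iff)
  then have gs: "gs i \<in> Fb" for i using fs by (simp add: gs_def)
  have "(\<Sum>i<n. a i * measure (mb (gs i)) A) = 0"
  proof (rule signed_measure_zero[where \<mu>="\<lambda>i. mb (gs i)", OF lc fin_mb[OF gs] sets_mb[OF gs] _ A])
    fix \<phi> :: "'a \<Rightarrow> real" assume p: "Cc \<phi>"
    define S where "S \<psi> = (\<Sum>i<n. a i * integral\<^sup>L (mb (gs i)) \<psi>)" for \<psi>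
    define K where "K = (\<Sum>i<n. \<bar>a i\<bar> * measure (mb (gs i)) UNIV)"
    have K: "0 \<le> K" unfolding K_def by (intro sum_nonneg) auto
    have "\<bar>S \<phi>\<bar> \<le> 0 + e0" if e0: "e0 > 0" for e0
    proof -
      define e where "e = e0 / (K + 1)"
      have e: "e > 0" "K * e \<le> e0" using e0 K by (auto simp: e_def field_simps)
      obtain g where g: "g \<in> F" "Cc g" "\<And>x. \<bar>\<phi> x - g x\<bar> < e" using Cc_approx[OF p e(1)] by metis
      have "S g = (\<Sum>i<n. a i * Lam (fs i) g)"
        unfolding S_def int_mb[OF gs g(1,2)] by (intro sum.cong) (auto simp: gs_def)
      then have "S g = 0" using zero g by simp
      have "\<bar>integral\<^sup>L (mb (gs i)) \<phi> - integral\<^sup>L (mb (gs i)) g\<bar> \<le> e * measure (mb (gs i)) UNIV" for i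
      proof -
        interpret finite_measure "mb (gs i)" by (rule fin_mb[OF gs])
        note int = Cc_integrable[OF fin_mb[OF gs] sets_mb[OF gs] p, of i] Cc_integrable[OF fin_mb[OF gs] sets_mb[OF gs] g(2), of i]
        have sp: "space (mb (gs i)) = UNIV" using sets_eq_imp_space_eq[OF sets_mb[OF gs]] by simp
        have "\<bar>integral\<^sup>L (mb (gs i)) (\<lambda>x. \<phi> x - g x)\<bar> \<le> integral\<^sup>L (mb (gs i)) (\<lambda>x. e)"
          using int g(3) by (intro order_trans[OF integral_abs_bound integral_mono]) (auto intro: less_imp_le)
        then show ?thesis using int sp by (simp add: mult.commute)
      qed
      then have "\<bar>S \<phi> - S g\<bar> \<le> (\<Sum>i<n. \<bar>a i\<bar> * (e * measure (mb (gs i)) UNIV))"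
        unfolding S_def sum_subtractf[symmetric] right_diff_distrib[symmetric]
        by (intro order_trans[OF sum_abs] sum_mono) (auto simp: abs_mult intro!: mult_left_mono)
      also have "\<dots> = K * e" unfolding K_def sum_distrib_right by (simp add: ac_simps)
      finally show ?thesis using \<open>S g = 0\<close> e by simp
    qed
    then have "\<bar>S \<phi>\<bar> \<le> 0" by (rule field_le_epsilon)
    then show "(\<Sum>i<n. a i * integral\<^sup>L (mb (gs i)) \<phi>) = 0" by (simp add: S_def)
  qed
  then show ?thesis by (simp add: gs_def)
qed

lemma mb_mass:
  assumes f: "f \<in> Fb" and A: "A \<in> sets borel"
  shows "measure (mb f) A \<le> 2 * E f f"
proof -
  interpret finite_measure "mb f" by (rule fin_mb[OF f])
  have sp: "space (mb f) = UNIV" using sets_eq_imp_space_eq[OF sets_mb[OF f]] by simp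
  obtain \<phi> :: "nat \<Rightarrow> 'a \<Rightarrow> real" where p: "\<And>k. Cc (\<phi> k)" "\<And>k x. 0 \<le> \<phi> k x" "\<And>k x. \<phi> k x \<le> 1"
      "\<And>x. (\<lambda>k. \<phi> k x) \<longlonglongrightarrow> indicator UNIV x" using open_Cc_approx[OF lc open_UNIV] by metis
  define K where "K = measure (mb f) UNIV + 2 * E f f"
  have K: "0 \<le> K" using E_nonneg[OF Fb_F[OF f]] by (simp add: K_def)
  have "integral\<^sup>L (mb f) (\<phi> k) \<le> 2 * E f f" for k
  proof (rule field_le_epsilon)
    fix e0 :: real assume e0: "e0 > 0"
    define e where "e = e0 / (K + 1)"
    have e: "e > 0" "K * e \<le> e0" using e0 K by (auto simp: e_def field_simps)
    obtain g where g: "g \<in> F" "Cc g" "\<And>x. \<bar>\<phi> k x - g x\<bar> < e" using Cc_approx[OF p(1) e(1)] by metis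
    note int = Cc_integrable[OF fin_mb[OF f] sets_mb[OF f]]
    have "integral\<^sup>L (mb f) (\<phi> k) \<le> integral\<^sup>L (mb f) (\<lambda>x. g x + e)"
    proof (rule integral_mono)
      show "\<phi> k x \<le> g x + e" for x using g(3)[of x] by linarith
    qed (use int[OF p(1)] int[OF g(2)] in auto)
    also have "\<dots> = integral\<^sup>L (mb f) g + e * measure (mb f) UNIV"
      using int[OF g(2)] sp by (simp add: mult.commute)
    also have "integral\<^sup>L (mb f) g = Lam f g" by (rule int_mb[OF f g(1,2)])
    also have "Lam f g \<le> 2 * E f f * (1 + e)"
    proof -
      \<comment> \<open>The approximant of a function bounded by 1 is bounded only by
        \<open>1 + e\<close>; the excess is absorbed in \<open>K * e\<close>.\<close>
      have "\<bar>g x\<bar> \<le> 1 + e" for x using g(3)[of x] p(2)[of k x] p(3)[of k x] by linarith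
      from Lam_le[OF f g(1) this] show ?thesis by linarith
    qed
    finally show "integral\<^sup>L (mb f) (\<phi> k) \<le> 2 * E f f + e0" using e by (simp add: K_def algebra_simps)
  qed
  then have "measure (mb f) UNIV \<le> 2 * E f f"
    by (intro LIMSEQ_le_const2[OF Cc_integral_tendsto[OF fin_mb[OF f] sets_mb[OF f] open_UNIV p]]) auto
  moreover have "measure (mb f) A \<le> measure (mb f) UNIV"
    using A sets_mb[OF f] by (intro finite_measure_mono) auto
  ultimately show ?thesis by simp
qed

text \<open>The polarisation of \<open>Lam\<close> in its first argument. Its bilinearity reduces
  the identities of \<open>quad\<close> to algebra.\<close>

definition Bl :: "('a \<Rightarrow> real) \<Rightarrow> ('a \<Rightarrow> real) \<Rightarrow> ('a \<Rightarrow> real) \<Rightarrow> real" where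
  "Bl f g \<phi> = E (\<lambda>x. f x * \<phi> x) g + E (\<lambda>x. g x * \<phi> x) f - E \<phi> (\<lambda>x. f x * g x)"

lemma Lam_eq_Bl: "Lam f \<phi> = Bl f f \<phi>"
  unfolding Lam_def Bl_def by (simp add: power2_eq_square)

lemma Bl_sym: "Bl f g \<phi> = Bl g f \<phi>"
  unfolding Bl_def by (simp add: mult.commute)

lemma Bl_add: "f \<in> Fb \<Longrightarrow> g \<in> Fb \<Longrightarrow> h \<in> Fb \<Longrightarrow> \<phi> \<in> Fb \<Longrightarrow>
   Bl (\<lambda>x. f x + g x) h \<phi> = Bl f h \<phi> + Bl g h \<phi>"
  unfolding Bl_def by (simp add: distrib_right E_add E_addr Fb_F Fb_mult)

lemma Bl_addr: "f \<in> Fb \<Longrightarrow> g \<in> Fb \<Longrightarrow> h \<in> Fb \<Longrightarrow> \<phi> \<in> Fb \<Longrightarrow>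
   Bl h (\<lambda>x. f x + g x) \<phi> = Bl h f \<phi> + Bl h g \<phi>"
  unfolding Bl_sym[of h "\<lambda>x. f x + g x"] Bl_sym[of h f] Bl_sym[of h g] by (rule Bl_add)

lemma Bl_scale: "f \<in> Fb \<Longrightarrow> h \<in> Fb \<Longrightarrow> \<phi> \<in> Fb \<Longrightarrow> Bl (\<lambda>x. c * f x) h \<phi> = c * Bl f h \<phi>"
  unfolding Bl_def by (simp add: mult.assoc mult.left_commute[of _ c] E_scale E_scaler Fb_F Fb_mult algebra_simps)

lemma Bl_scaler: "f \<in> Fb \<Longrightarrow> h \<in> Fb \<Longrightarrow> \<phi> \<in> Fb \<Longrightarrow> Bl h (\<lambda>x. c * f x) \<phi> = c * Bl h f \<phi>"
  unfolding Bl_sym[of h "\<lambda>x. c * f x"] Bl_sym[of h f] by (rule Bl_scale)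

lemma quad_mb:
  assumes A: "A \<in> sets borel"
  shows "quad Fb (\<lambda>f. measure (mb f) A)"
proof
  fix f g h assume fgh: "f \<in> Fb" "g \<in> Fb" "h \<in> Fb"
  define fs where "fs i = ([\<lambda>x. f x + g x + h x, f, g, h, \<lambda>x. f x + g x, \<lambda>x. g x + h x, \<lambda>x. f x + h x] ! i)" for i
  \<comment> \<open>The identity \<open>q_add3\<close> with all seven terms moved to one
    side.\<close>
  define a where "a i = ([1, 1, 1, 1, -1, -1, -1] ! i :: real)" for i
  have "(\<Sum>i<7. a i * measure (mb (fs i)) A) = 0"
  proof (rule mb_identity[OF _ _ A])
    fix i :: nat assume "i < 7"
    then have "i \<in> {0,1,2,3,4,5,6}" by auto
    then show "fs i \<in> Fb" using fgh by (auto simp: fs_def intro!: Fb_add)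
  next
    fix \<phi> assume "\<phi> \<in> F" "Cc \<phi>"
    then have p: "\<phi> \<in> Fb" by (rule Cc_Fb)
    show "(\<Sum>i<7. a i * Lam (fs i) \<phi>) = 0"
      using fgh p by (simp add: a_def fs_def eval_nat_numeral Lam_eq_Bl Bl_add Bl_addr Fb_add)
  qed
  then show "measure (mb (\<lambda>x. f x + g x + h x)) A + measure (mb f) A + measure (mb g) A + measure (mb h) A =
      measure (mb (\<lambda>x. f x + g x)) A + measure (mb (\<lambda>x. g x + h x)) A + measure (mb (\<lambda>x. f x + h x)) A"
    by (simp add: a_def fs_def eval_nat_numeral)
next
  fix f g t assume fg: "f \<in> Fb" "g \<in> Fb"
  define fs where "fs i = ([\<lambda>x. f x + t * g x, f, \<lambda>x. f x + g x, g] ! i)" for i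
  define a where "a i = ([1, -(1 - t), -t, -(t\<^sup>2-t)] ! i :: real)" for i
  have "(\<Sum>i<4. a i * measure (mb (fs i)) A) = 0"
  proof (rule mb_identity[OF _ _ A])
    fix i :: nat assume "i < 4"
    then have "i \<in> {0,1,2,3}" by auto
    then show "fs i \<in> Fb" using fg by (auto simp: fs_def intro!: Fb_add Fb_scale)
  next
    fix \<phi> assume "\<phi> \<in> F" "Cc \<phi>"
    then have p: "\<phi> \<in> Fb" by (rule Cc_Fb)
    show "(\<Sum>i<4. a i * Lam (fs i) \<phi>) = 0"
      using fg p Bl_sym[of g f \<phi>] by (simp add: a_def fs_def eval_nat_numeral Lam_eq_Bl Bl_add Bl_addr Bl_scale Bl_scaler Fb_scale Fb_add)
        (simp add: algebra_simps power2_eq_square)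
  qed
  then show "measure (mb (\<lambda>x. f x + t * g x)) A = (1 - t) * measure (mb f) A + t * measure (mb (\<lambda>x. f x + g x)) A
      + (t\<^sup>2 - t) * measure (mb g) A"
    by (simp add: a_def fs_def eval_nat_numeral) (simp add: algebra_simps)
qed (auto intro!: Fb_add Fb_scale)

end

section \<open>Energy measures as quadratic forms\<close>

lemma LIMSEQ_zero_squeeze:
  fixes x y :: "nat \<Rightarrow> real"
  assumes "\<And>n. 0 \<le> x n" "\<And>n. x n \<le> y n" "y \<longlonglongrightarrow> 0"
  shows "x \<longlonglongrightarrow> 0"
  by (rule tendsto_sandwich[OF _ _ tendsto_const assms(3)]) (use assms in auto)

context reg_dform begin

text \<open>These are exactly the approximating sequences over which the definition of
  \<open>emeas\<close> quantifies.\<close>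

definition E1conv :: "(nat \<Rightarrow> 'a \<Rightarrow> real) \<Rightarrow> ('a \<Rightarrow> real) \<Rightarrow> bool" where
  "E1conv u f \<longleftrightarrow> (\<forall>n. u n \<in> Fb) \<and> (\<lambda>n. E1norm m E (\<lambda>x. u n x - f x)) \<longlonglongrightarrow> 0"

lemma E_plus_le: "f \<in> F \<Longrightarrow> g \<in> F \<Longrightarrow> E (\<lambda>x. f x + g x) (\<lambda>x. f x + g x) \<le> 2 * E f f + 2 * E g g"
  using E_nonneg[OF F_diff, of f g] by (simp add: E_lin)

lemma E_minus_le: "f \<in> F \<Longrightarrow> g \<in> F \<Longrightarrow> E (\<lambda>x. f x - g x) (\<lambda>x. f x - g x) \<le> 2 * E f f + 2 * E g g"
  using E_nonneg[OF F_add, of f g] by (simp add: E_lin)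

lemma E1conv_E:
  assumes "E1conv u f" "f \<in> F"
  shows "(\<lambda>n. E (\<lambda>x. u n x - f x) (\<lambda>x. u n x - f x)) \<longlonglongrightarrow> 0"
  using assms E1norm_tendsto_iff[of "\<lambda>n x. u n x - f x"] by (auto simp: E1conv_def F_diff Fb_F)

lemma E1conv_ex:
  assumes "f \<in> F"
  obtains u where "E1conv u f"
proof -
  have "\<exists>g\<in>F. Cc g \<and> E1norm m E (\<lambda>x. f x - g x) < inverse (real (Suc n))" for n
    using F_approx[OF assms, of "inverse (real (Suc n))"] by (metis inverse_positive_iff_positive of_nat_0_less_iff zero_less_Suc)
  then obtain u where u: "\<And>n. u n \<in> F" "\<And>n. Cc (u n)" "\<And>n. E1norm m E (\<lambda>x. f x - u n x) < inverse (real (Suc n))"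
    by metis
  have "(\<lambda>n. E1norm m E (\<lambda>x. u n x - f x)) \<longlonglongrightarrow> 0"
  proof (rule tendsto_sandwich[OF _ _ tendsto_const LIMSEQ_inverse_real_of_nat])
    show "\<forall>\<^sub>F n in sequentially. 0 \<le> E1norm m E (\<lambda>x. u n x - f x)"
      using E1norm_nonneg[OF F_diff[OF u(1) assms]] by simp
    show "\<forall>\<^sub>F n in sequentially. E1norm m E (\<lambda>x. u n x - f x) \<le> inverse (real (Suc n))"
      using u(3) E1dist_commute[OF u(1) assms] by (simp add: less_imp_le)
  qed
  then have "E1conv u f" using u Cc_Fb by (auto simp: E1conv_def)
  then show ?thesis by (rule that)
qed

lemma E1conv_add:
  assumes "E1conv u f" "E1conv v g" "f \<in> F" "g \<in> F"
  shows "E1conv (\<lambda>n x. u n x + v n x) (\<lambda>x. f x + g x)"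
proof -
  have uv: "u n \<in> Fb" "v n \<in> Fb" for n using assms by (auto simp: E1conv_def)
  let ?a = "\<lambda>n x. u n x - f x" and ?b = "\<lambda>n x. v n x - g x"
  have ab: "?a n \<in> F" "?b n \<in> F" for n using uv assms by (auto intro: F_diff Fb_F)
  have eq: "(\<lambda>x. u n x + v n x - (f x + g x)) = (\<lambda>x. ?a n x + ?b n x)" for n by auto
  have "(\<lambda>n. E1norm m E (?a n) + E1norm m E (?b n)) \<longlonglongrightarrow> 0 + 0"
    using assms by (intro tendsto_add) (simp_all add: E1conv_def)
  then have lim: "(\<lambda>n. E1norm m E (?a n) + E1norm m E (?b n)) \<longlonglongrightarrow> 0" by simp
  have "(\<lambda>n. E1norm m E (\<lambda>x. ?a n x + ?b n x)) \<longlonglongrightarrow> 0"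
    by (rule LIMSEQ_zero_squeeze[OF E1norm_nonneg[OF F_add[OF ab]] E1norm_triangle[OF ab] lim])
  then show ?thesis unfolding E1conv_def eq using uv by (auto intro: Fb_add)
qed

lemma E1conv_scale:
  assumes "E1conv u f" "f \<in> F"
  shows "E1conv (\<lambda>n x. c * u n x) (\<lambda>x. c * f x)"
proof -
  have u: "u n \<in> Fb" for n using assms by (auto simp: E1conv_def)
  have "(\<lambda>x. u n x - f x) \<in> F" for n using u assms by (auto intro: F_diff Fb_F)
  then have "E1norm m E (\<lambda>x. c * u n x - c * f x) = \<bar>c\<bar> * E1norm m E (\<lambda>x. u n x - f x)" for n
    using E1norm_scale[of "\<lambda>x. u n x - f x" c] by (simp add: right_diff_distrib)
  moreover have "(\<lambda>n. \<bar>c\<bar> * E1norm m E (\<lambda>x. u n x - f x)) \<longlonglongrightarrow> 0"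
    using assms by (intro tendsto_mult_right_zero) (simp add: E1conv_def)
  ultimately show ?thesis unfolding E1conv_def using u by (simp add: Fb_scale)
qed

lemma mb_diff_le:
  assumes "u \<in> Fb" "v \<in> Fb" "A \<in> sets borel"
  shows "\<bar>measure (mb u) A - measure (mb v) A\<bar> \<le>
     4 * (sqrt (E v v) * sqrt (E (\<lambda>x. u x - v x) (\<lambda>x. u x - v x))) + 2 * E (\<lambda>x. u x - v x) (\<lambda>x. u x - v x)"
proof -
  interpret quad Fb "\<lambda>f. measure (mb f) A" by (rule quad_mb[OF assms(3)])
  let ?d = "\<lambda>x. u x - v x"
  have d: "?d \<in> Fb" using assms by (intro Fb_diff)
  have "sqrt (measure (mb v) A) * sqrt (measure (mb ?d) A) \<le> sqrt (2 * E v v) * sqrt (2 * E ?d ?d)"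
    using mb_mass[OF assms(2,3)] mb_mass[OF d assms(3)] E_nonneg[OF Fb_F[OF assms(2)]] by (intro mult_mono) auto
  also have "\<dots> = 2 * (sqrt (E v v) * sqrt (E ?d ?d))" by (simp add: real_sqrt_mult)
  finally show ?thesis using q_diff_le[OF assms(1,2)] mb_mass[OF d assms(3)] by linarith
qed

text \<open>Uniformity in \<open>A\<close> will give countable additivity of the limit. Allowing two
  sequences yields independence of the approximation, and with \<open>u = v\<close> the Cauchy
  property.\<close>

lemma mb_unif:
  assumes u: "E1conv u f" and v: "E1conv v f" and f: "f \<in> F" and e: "e > 0"
  shows "\<exists>N. \<forall>i\<ge>N. \<forall>j\<ge>N. \<forall>A\<in>sets borel. \<bar>measure (mb (u i)) A - measure (mb (v j)) A\<bar> < e"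
proof -
  have uv: "u n \<in> Fb" "v n \<in> Fb" for n using u v by (auto simp: E1conv_def)
  define B where "B = 2 * E f f + 2"
  have B: "B > 0" using E_nonneg[OF f] by (simp add: B_def)
  \<comment> \<open>These bounds make \<open>4 * sqrt (B * (4 * s))\<close> and
    \<open>2 * (4 * s)\<close> at most \<open>e / 4\<close> each; \<open>s \<le> 1\<close> keeps the
    energy of \<open>v j\<close> at most \<open>B\<close>.\<close>
  define s where "s = min 1 (min (e / 32) (e\<^sup>2 / (1024 * B)))"
  have s: "s > 0" "s \<le> 1" "s \<le> e / 32" "s \<le> e\<^sup>2 / (1024 * B)" using e B by (auto simp: s_def)
  obtain N1 where N1: "\<And>n. n \<ge> N1 \<Longrightarrow> norm (E (\<lambda>x. u n x - f x) (\<lambda>x. u n x - f x) - 0) < s"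
    using LIMSEQ_D[OF E1conv_E[OF u f] s(1)] by blast
  obtain N2 where N2: "\<And>n. n \<ge> N2 \<Longrightarrow> norm (E (\<lambda>x. v n x - f x) (\<lambda>x. v n x - f x) - 0) < s"
    using LIMSEQ_D[OF E1conv_E[OF v f] s(1)] by blast
  have "\<bar>measure (mb (u i)) A - measure (mb (v j)) A\<bar> < e" if "i \<ge> max N1 N2" "j \<ge> max N1 N2" "A \<in> sets borel" for i j A
  proof -
    let ?a = "\<lambda>x. u i x - f x" and ?b = "\<lambda>x. v j x - f x" and ?d = "\<lambda>x. u i x - v j x"
    have ab: "?a \<in> F" "?b \<in> F" using uv f by (auto intro: F_diff Fb_F)
    have 1: "E ?a ?a < s" "E ?b ?b < s" using N1[of i] N2[of j] that by auto
    have "E (\<lambda>x. ?a x - ?b x) (\<lambda>x. ?a x - ?b x) \<le> 2 * E ?a ?a + 2 * E ?b ?b" by (rule E_minus_le[OF ab])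
    then have d: "E ?d ?d \<le> 4 * s" using 1 by simp
    have "E (\<lambda>x. ?b x + f x) (\<lambda>x. ?b x + f x) \<le> 2 * E ?b ?b + 2 * E f f" by (rule E_plus_le[OF ab(2) f])
    then have v: "E (v j) (v j) \<le> B" using 1 s by (simp add: B_def)
    have d0: "0 \<le> E ?d ?d" using uv by (intro E_nonneg F_diff Fb_F)
    have "sqrt (E (v j) (v j)) * sqrt (E ?d ?d) \<le> sqrt B * sqrt (4 * s)"
      using v d d0 B by (intro mult_mono) auto
    also have "\<dots> = sqrt (B * (4 * s))" by (simp add: real_sqrt_mult)
    also have "\<dots> \<le> sqrt ((e / 16)\<^sup>2)"
    proof -
      have "B * s \<le> B * (e\<^sup>2 / (1024 * B))" using s(4) B by (intro mult_left_mono) auto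
      also have "\<dots> = e\<^sup>2 / 1024" using B by simp
      finally show ?thesis by (simp add: power_divide)
    qed
    also have "\<dots> = e / 16" using e by simp
    finally have "4 * (sqrt (E (v j) (v j)) * sqrt (E ?d ?d)) + 2 * E ?d ?d \<le> 4 * (e / 16) + 2 * (4 * s)"
      using d by linarith
    also have "\<dots> \<le> e / 4 + e / 4" using s by simp
    also have "\<dots> < e" using e by simp
    finally show ?thesis using mb_diff_le[OF uv(1) uv(2) that(3), of i j] by linarith
  qed
  then show ?thesis by blast
qed

text \<open>Finite additivity survives setwise limits. Continuity at the empty set is inherited from
  a single approximating measure that is close uniformly over all Borel sets.\<close>

lemma emeas_ex:
  assumes f: "f \<in> F"
  shows "\<exists>\<mu>. sets \<mu> = sets borel \<and> finite_measure \<mu> \<and>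
      (\<forall>u. E1conv u f \<longrightarrow> (\<forall>A\<in>sets borel. (\<lambda>n. measure (mb (u n)) A) \<longlonglongrightarrow> measure \<mu> A))"
proof -
  obtain u where u: "E1conv u f" using E1conv_ex[OF f] .
  have uF: "u n \<in> Fb" for n using u by (simp add: E1conv_def)
  note fin = fin_mb[OF uF] and st = sets_mb[OF uF]
  define M where "M A = lim (\<lambda>n. measure (mb (u n)) A)" for A
  have M: "(\<lambda>n. measure (mb (u n)) A) \<longlonglongrightarrow> M A" if "A \<in> sets borel" for A
  proof -
    have "Cauchy (\<lambda>n. measure (mb (u n)) A)"
      using mb_unif[OF u u f] that by (intro CauchyI) (auto; meson)
    then show ?thesis unfolding M_def by (simp add: Cauchy_convergent_iff convergent_LIMSEQ_iff)
  qed
  have M_close: "\<exists>n. \<forall>A\<in>sets borel. \<bar>measure (mb (u n)) A - M A\<bar> \<le> e" if e0: "e > 0" for e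
  proof -
    obtain N where N: "\<And>i j A. i \<ge> N \<Longrightarrow> j \<ge> N \<Longrightarrow> A \<in> sets borel \<Longrightarrow> \<bar>measure (mb (u i)) A - measure (mb (u j)) A\<bar> < e"
      using mb_unif[OF u u f e0] by blast
    have "\<bar>measure (mb (u N)) A - M A\<bar> \<le> e" if A: "A \<in> sets borel" for A
    proof (rule LIMSEQ_le_const2)
      show "(\<lambda>j. \<bar>measure (mb (u N)) A - measure (mb (u j)) A\<bar>) \<longlonglongrightarrow> \<bar>measure (mb (u N)) A - M A\<bar>"
        by (intro tendsto_intros M A)
      show "\<exists>K. \<forall>j\<ge>K. \<bar>measure (mb (u N)) A - measure (mb (u j)) A\<bar> \<le> e"
        using N[OF order_refl _ A] by (intro exI[of _ N]) (auto intro: less_imp_le)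
    qed
    then show ?thesis by blast
  qed
  have M_nonneg: "0 \<le> M A" if "A \<in> sets borel" for A
    by (rule LIMSEQ_le_const[OF M[OF that]]) auto
  define \<mu> :: "'a measure" where "\<mu> = measure_of UNIV (sets borel) (\<lambda>A. ennreal (M A))"
  have sa: "sigma_algebra UNIV (sets (borel :: 'a measure))"
    using sets.sigma_algebra_axioms[of "borel :: 'a measure"] by simp
  interpret S: sigma_algebra UNIV "sets (borel :: 'a measure)" by (rule sa)
  have M_add: "M (A \<union> B) = M A + M B" if "A \<in> sets borel" "B \<in> sets borel" "A \<inter> B = {}" for A B
  proof -
    have "(\<lambda>n. measure (mb (u n)) A + measure (mb (u n)) B) \<longlonglongrightarrow> M A + M B"
      by (intro tendsto_intros M that)
    moreover have "measure (mb (u n)) A + measure (mb (u n)) B = measure (mb (u n)) (A \<union> B)" for n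
      using that st by (intro finite_measure.finite_measure_Union[OF fin, symmetric]) auto
    ultimately have "(\<lambda>n. measure (mb (u n)) (A \<union> B)) \<longlonglongrightarrow> M A + M B" by simp
    then show ?thesis using LIMSEQ_unique[OF M] that by blast
  qed
  have "M {} = 0" using M[of "{}"] by (simp add: LIMSEQ_const_iff)
  then have pos: "positive (sets borel) (\<lambda>A. ennreal (M A))" by (simp add: positive_def)
  have "countably_additive (sets borel) (\<lambda>A. ennreal (M A))"
  proof (rule S.empty_continuous_imp_countably_additive[OF pos])
    show "additive (sets borel) (\<lambda>A. ennreal (M A))"
      using M_add M_nonneg by (auto simp: additive_def)
    fix A :: "nat \<Rightarrow> 'a set" assume A: "range A \<subseteq> sets borel" "decseq A" "(\<Inter>i. A i) = {}"
    have Ai: "A i \<in> sets borel" for i using A by auto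
    have "(\<lambda>i. M (A i)) \<longlonglongrightarrow> 0"
    proof (rule LIMSEQ_I)
      fix e :: real assume e: "e > 0"
      obtain n where n: "\<And>A. A \<in> sets borel \<Longrightarrow> \<bar>measure (mb (u n)) A - M A\<bar> \<le> e / 2"
        using M_close[of "e/2"] e by auto
      interpret finite_measure "mb (u n)" by (rule fin)
      have "(\<lambda>i. measure (mb (u n)) (A i)) \<longlonglongrightarrow> measure (mb (u n)) (\<Inter>i. A i)"
        using A st by (intro finite_Lim_measure_decseq) auto
      then have "(\<lambda>i. measure (mb (u n)) (A i)) \<longlonglongrightarrow> 0" using A(3) by simp
      from LIMSEQ_D[OF this, of "e/2"] e obtain N where N: "\<And>i. i \<ge> N \<Longrightarrow> measure (mb (u n)) (A i) < e / 2" by auto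
      have "norm (M (A i) - 0) < e" if "i \<ge> N" for i
        using N[OF that] n[OF Ai, of i] M_nonneg[OF Ai, of i] unfolding real_norm_def by linarith
      then show "\<exists>N. \<forall>i\<ge>N. norm (M (A i) - 0) < e" by blast
    qed
    then show "(\<lambda>i. ennreal (M (A i))) \<longlonglongrightarrow> 0" using tendsto_ennrealI by fastforce
  qed auto
  then have em: "emeasure \<mu> A = ennreal (M A)" if "A \<in> sets borel" for A
    unfolding \<mu>_def using pos sa that by (intro emeasure_measure_of_sigma)
  have s\<mu>: "sets \<mu> = sets borel" unfolding \<mu>_def using S.sets_measure_of_eq by simp
  have sp: "space \<mu> = UNIV" unfolding \<mu>_def by (simp add: space_measure_of_conv)
  have "finite_measure \<mu>" by standard (simp add: em sp)
  moreover have "(\<lambda>n. measure (mb (v n)) A) \<longlonglongrightarrow> measure \<mu> A" if v: "E1conv v f" and A: "A \<in> sets borel" for v A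
  proof -
    have "(\<lambda>n. measure (mb (v n)) A - measure (mb (u n)) A) \<longlonglongrightarrow> 0"
    proof (rule LIMSEQ_I)
      fix e :: real assume "e > 0"
      from mb_unif[OF v u f this] A show "\<exists>N. \<forall>n\<ge>N. norm (measure (mb (v n)) A - measure (mb (u n)) A - 0) < e"
        by auto
    qed
    from tendsto_add[OF this M[OF A]] have "(\<lambda>n. measure (mb (v n)) A) \<longlonglongrightarrow> M A" by simp
    moreover have "measure \<mu> A = M A" using em[OF A] M_nonneg[OF A] by (simp add: measure_def)
    ultimately show ?thesis by simp
  qed
  ultimately show ?thesis using s\<mu> by blast
qed

abbreviation "em \<equiv> emeas m F E"

lemma em:
  assumes "f \<in> F"
  shows sets_em: "sets (em f) = sets borel" and fin_em: "finite_measure (em f)"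
    and em_lim: "E1conv u f \<Longrightarrow> A \<in> sets borel \<Longrightarrow> (\<lambda>n. measure (mb (u n)) A) \<longlonglongrightarrow> measure (em f) A"
proof -
  have *: "E1conv u f \<longleftrightarrow> (\<forall>n. u n \<in> F \<and> bounded (range (u n))) \<and> (\<lambda>n. E1norm m E (\<lambda>x. u n x - f x)) \<longlonglongrightarrow> 0" for u
    by (simp add: E1conv_def Fb_def)
  have "\<exists>\<mu>. sets \<mu> = sets borel \<and> finite_measure \<mu> \<and>
      (\<forall>u. (\<forall>n. u n \<in> F \<and> bounded (range (u n))) \<longrightarrow> (\<lambda>n. E1norm m E (\<lambda>x. u n x - f x)) \<longlonglongrightarrow> 0 \<longrightarrow>
      (\<forall>A\<in>sets borel. (\<lambda>n. measure (mb (u n)) A) \<longlonglongrightarrow> measure \<mu> A))"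
    using emeas_ex[OF assms] unfolding * imp_conjL .
  from someI_ex[OF this, folded emeas_def]
  have "sets (em f) = sets borel \<and> finite_measure (em f) \<and> (\<forall>u. E1conv u f \<longrightarrow>
      (\<forall>A\<in>sets borel. (\<lambda>n. measure (mb (u n)) A) \<longlonglongrightarrow> measure (em f) A))"
    unfolding * imp_conjL .
  then show "sets (em f) = sets borel" "finite_measure (em f)"
     "E1conv u f \<Longrightarrow> A \<in> sets borel \<Longrightarrow> (\<lambda>n. measure (mb (u n)) A) \<longlonglongrightarrow> measure (em f) A" by blast+
qed

lemma em_mass:
  assumes f: "f \<in> F" and A: "A \<in> sets borel"
  shows "measure (em f) A \<le> 2 * E f f"
proof -
  obtain u where u: "E1conv u f" using E1conv_ex[OF f] .
  have uF: "u n \<in> Fb" for n using u by (simp add: E1conv_def)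
  let ?d = "\<lambda>n x. u n x - f x"
  have d: "?d n \<in> F" for n using uF f by (auto intro: F_diff Fb_F)
  \<comment> \<open>In this form the energy of \<open>u n\<close> converges term by term.\<close>
  have "E (u n) (u n) = 2 * E (u n) f - E f f + E (?d n) (?d n)" for n
    using uF[of n] f by (simp add: E_lin Fb_F E_sym[of f "u n"])
  moreover have "(\<lambda>n. 2 * E (u n) f - E f f + E (?d n) (?d n)) \<longlonglongrightarrow> 2 * E f f - E f f + 0"
    using u uF f by (intro tendsto_intros E_tendsto E1conv_E) (auto simp: E1conv_def Fb_F)
  ultimately have "(\<lambda>n. 2 * E (u n) (u n)) \<longlonglongrightarrow> 2 * E f f" by (intro tendsto_intros) simp
  from LIMSEQ_le[OF em_lim[OF f u A] this] show ?thesis using mb_mass[OF uF A] by blast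
qed

lemma quad_em:
  assumes A: "A \<in> sets borel"
  shows "quad F (\<lambda>f. measure (em f) A)"
proof
  interpret q: quad Fb "\<lambda>f. measure (mb f) A" by (rule quad_mb[OF A])
  fix f g assume f: "f \<in> F" and g: "g \<in> F"
  obtain u where u: "E1conv u f" using E1conv_ex[OF f] .
  obtain v where v: "E1conv v g" using E1conv_ex[OF g] .
  have uv: "u n \<in> Fb" "v n \<in> Fb" for n using u v by (auto simp: E1conv_def)
  {
    fix h assume h: "h \<in> F"
    obtain w where w: "E1conv w h" using E1conv_ex[OF h] .
    have wF: "w n \<in> Fb" for n using w by (auto simp: E1conv_def)
    let ?q = "\<lambda>f. measure (mb f) A"
    have "(\<lambda>n. ?q (\<lambda>x. u n x + v n x + w n x) + ?q (u n) + ?q (v n) + ?q (w n)) \<longlonglongrightarrow>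
       measure (em (\<lambda>x. f x + g x + h x)) A + measure (em f) A + measure (em g) A + measure (em h) A"
      by (intro tendsto_add em_lim F_add E1conv_add u v w f g h A)
    moreover have "(\<lambda>n. ?q (\<lambda>x. u n x + v n x) + ?q (\<lambda>x. v n x + w n x) + ?q (\<lambda>x. u n x + w n x)) \<longlonglongrightarrow>
       measure (em (\<lambda>x. f x + g x)) A + measure (em (\<lambda>x. g x + h x)) A + measure (em (\<lambda>x. f x + h x)) A"
      by (intro tendsto_add em_lim F_add E1conv_add u v w f g h A)
    ultimately show "measure (em (\<lambda>x. f x + g x + h x)) A + measure (em f) A + measure (em g) A + measure (em h) A =
       measure (em (\<lambda>x. f x + g x)) A + measure (em (\<lambda>x. g x + h x)) A + measure (em (\<lambda>x. f x + h x)) A"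
      unfolding q.q_add3[OF uv wF] by (rule LIMSEQ_unique)
  }
  fix t
  have "(\<lambda>n. measure (mb (\<lambda>x. u n x + t * v n x)) A) \<longlonglongrightarrow> measure (em (\<lambda>x. f x + t * g x)) A"
    by (intro em_lim F_add F_scale E1conv_add E1conv_scale u v f g A)
  moreover have "(\<lambda>n. (1 - t) * measure (mb (u n)) A + t * measure (mb (\<lambda>x. u n x + v n x)) A + (t\<^sup>2 - t) * measure (mb (v n)) A)
     \<longlonglongrightarrow> (1 - t) * measure (em f) A + t * measure (em (\<lambda>x. f x + g x)) A + (t\<^sup>2 - t) * measure (em g) A"
    by (intro tendsto_add tendsto_mult_left em_lim F_add E1conv_add u v f g A)
  ultimately show "measure (em (\<lambda>x. f x + t * g x)) A =
      (1 - t) * measure (em f) A + t * measure (em (\<lambda>x. f x + g x)) A + (t\<^sup>2 - t) * measure (em g) A"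
    unfolding q.q_line[OF uv] by (rule LIMSEQ_unique)
qed (auto intro: F_add F_scale)

end

section \<open>Densities of energy measures\<close>

text \<open>Matrices are functions of two indices, of which only those below \<open>n\<close> count,
  so that tuples can be restricted and reindexed without conversion.\<close>

definition psd :: "nat \<Rightarrow> (nat \<Rightarrow> nat \<Rightarrow> real) \<Rightarrow> bool" where
  "psd n A \<longleftrightarrow> (\<forall>i<n. \<forall>j<n. A i j = A j i) \<and> (\<forall>c. 0 \<le> (\<Sum>i<n. \<Sum>j<n. c i * c j * A i j))"

locale reg_dform_dom = reg_dform m F E
  for m :: "'a::{metric_space, second_countable_topology} measure" and F E +
  fixes \<nu> :: "'a measure"
  assumes dom: "energy_dominant m F E \<nu>"
begin

lemma sets_nu[measurable_cong]: "sets \<nu> = sets borel"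
  using dom by (simp add: energy_dominant_def)

lemma space_nu[simp]: "space \<nu> = UNIV"
  using sets_eq_imp_space_eq[OF sets_nu] by simp

lemma sf_nu: "sigma_finite_measure \<nu>"
  using dom by (simp add: energy_dominant_def)

text \<open>A real-valued version of the energy density. Versions for different functions are
  unrelated pointwise, so each relation between them carries its own null set.\<close>

definition z :: "('a \<Rightarrow> real) \<Rightarrow> 'a \<Rightarrow> real" where
  "z f x = enn2real (RN_deriv \<nu> (em f) x)"

abbreviation e :: "('a \<Rightarrow> real) \<Rightarrow> ('a \<Rightarrow> real) \<Rightarrow> 'a \<Rightarrow> real" where
  "e \<equiv> edens m F E \<nu>"

lemma e_z: "e f g x = (z (\<lambda>x. f x + g x) x - z f x - z g x) / 2"
  unfolding edens_def z_def ..

lemma z_meas[measurable]: "z f \<in> borel_measurable \<nu>"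
  unfolding z_def by measurable

lemma e_meas[measurable]: "e f g \<in> borel_measurable \<nu>"
  unfolding e_z by measurable

lemma z_nonneg: "0 \<le> z f x"
  unfolding z_def by simp

lemma em_density:
  assumes f: "f \<in> F"
  shows "em f = density \<nu> (\<lambda>x. ennreal (z f x))"
proof -
  interpret sigma_finite_measure \<nu> by (rule sf_nu)
  have ac: "absolutely_continuous \<nu> (em f)" using dom f by (simp add: energy_dominant_def)
  have st: "sets (em f) = sets \<nu>" using sets_em[OF f] sets_nu by simp
  have sf: "sigma_finite_measure (em f)"
    using fin_em[OF f] by (simp add: finite_measure_def)
  have "AE x in \<nu>. RN_deriv \<nu> (em f) x \<noteq> \<infinity>" by (rule RN_deriv_finite[OF sf ac st])
  then have "AE x in \<nu>. RN_deriv \<nu> (em f) x = ennreal (z f x)"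
    by eventually_elim (simp add: z_def less_top)
  then have "density \<nu> (RN_deriv \<nu> (em f)) = density \<nu> (\<lambda>x. ennreal (z f x))"
    by (intro density_cong) auto
  then show ?thesis using density_RN_deriv[OF ac st] by simp
qed

lemma z_integrable:
  assumes f: "f \<in> F"
  shows "integrable \<nu> (z f)"
proof (rule integrableI_nonneg)
  interpret finite_measure "em f" by (rule fin_em[OF f])
  have "(\<integral>\<^sup>+ x. ennreal (z f x) \<partial>\<nu>) = emeasure (em f) (space \<nu>)"
    using emeasure_density[of "\<lambda>x. ennreal (z f x)" \<nu> "space \<nu>"] em_density[OF f]
    by simp
  also have "\<dots> < \<infinity>" by (simp add: less_top[symmetric])
  finally show "(\<integral>\<^sup>+ x. ennreal (z f x) \<partial>\<nu>) < \<infinity>" .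
qed (auto simp: z_nonneg)

lemma z_set_integral:
  assumes f: "f \<in> F" and A: "A \<in> sets \<nu>"
  shows "(\<integral>x\<in>A. z f x \<partial>\<nu>) = measure (em f) A"
proof -
  interpret finite_measure "em f" by (rule fin_em[OF f])
  have "emeasure (em f) A = (\<integral>\<^sup>+x. ennreal (z f x) * indicator A x \<partial>\<nu>)"
    using emeasure_density[of "\<lambda>x. ennreal (z f x)" \<nu> A] em_density[OF f] A by simp
  also have "\<dots> = (\<integral>\<^sup>+x. ennreal (indicator A x * z f x) \<partial>\<nu>)"
    by (intro nn_integral_cong) (auto simp: indicator_def)
  also have "\<dots> = ennreal (\<integral>x. indicator A x * z f x \<partial>\<nu>)"
    using A z_integrable[OF f] z_nonneg
      integrable_real_mult_indicator[OF A z_integrable[OF f]]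
    by (intro nn_integral_eq_integral) (auto simp: mult.commute)
  finally have "ennreal (measure (em f) A) = ennreal (\<integral>x. indicator A x * z f x \<partial>\<nu>)"
    by (simp add: emeasure_eq_measure)
  moreover have "0 \<le> (\<integral>x. indicator A x * z f x \<partial>\<nu>)" using z_nonneg by (intro Bochner_Integration.integral_nonneg) auto
  ultimately show ?thesis by (simp add: set_lebesgue_integral_def)
qed

lemma z_integral_le: "f \<in> F \<Longrightarrow> integral\<^sup>L \<nu> (z f) \<le> 2 * E f f"
  using z_set_integral[of f "space \<nu>"] em_mass[of f UNIV] z_integrable[of f] by (simp add: set_lebesgue_integral_def)

section \<open>Relations between densities almost everywhere\<close>

lemma z_setint: "f \<in> F \<Longrightarrow> A \<in> sets \<nu> \<Longrightarrow> set_integrable \<nu> A (z f)"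
  unfolding set_integrable_def by (intro integrable_mult_indicator z_integrable) auto

text \<open>By \<open>quad_em\<close> both sides have the same integral over every measurable set,
  which determines an integrable function up to a null set.\<close>

lemma z_add3:
  assumes "f \<in> F" "g \<in> F" "h \<in> F"
  shows "AE x in \<nu>. z (\<lambda>x. f x + g x + h x) x + z f x + z g x + z h x =
    z (\<lambda>x. f x + g x) x + z (\<lambda>x. g x + h x) x + z (\<lambda>x. f x + h x) x"
proof (rule density_unique_real)
  note F = F_add[OF F_add[OF assms(1,2)] assms(3)] F_add[OF assms(1,2)] F_add[OF assms(2,3)] F_add[OF assms(1,3)] assms
  show "integrable \<nu> (\<lambda>x. z (\<lambda>x. f x + g x + h x) x + z f x + z g x + z h x)"
    "integrable \<nu> (\<lambda>x. z (\<lambda>x. f x + g x) x + z (\<lambda>x. g x + h x) x + z (\<lambda>x. f x + h x) x)"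
    using F[THEN z_integrable] by simp_all
  fix A assume A: "A \<in> sets \<nu>"
  then interpret quad F "\<lambda>f. measure (em f) A" by (intro quad_em) (simp add: sets_nu)
  note si = F[THEN z_setint, OF A] and sv = F[THEN z_set_integral, OF A]
  show "(\<integral>x\<in>A. (z (\<lambda>x. f x + g x + h x) x + z f x + z g x + z h x) \<partial>\<nu>) =
    (\<integral>x\<in>A. (z (\<lambda>x. f x + g x) x + z (\<lambda>x. g x + h x) x + z (\<lambda>x. f x + h x) x) \<partial>\<nu>)"
    using si q_add3[OF assms] by (simp add: set_integral_add sv)
qed

lemma z_line:
  assumes "f \<in> F" "g \<in> F"
  shows "AE x in \<nu>. z (\<lambda>x. f x + t * g x) x = (1 - t) * z f x + t * z (\<lambda>x. f x + g x) x + (t\<^sup>2 - t) * z g x"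
proof (rule density_unique_real)
  note F = F_add[OF assms(1) F_scale[OF assms(2)], of t] F_add[OF assms(1,2)] assms
  show "integrable \<nu> (z (\<lambda>x. f x + t * g x))"
    "integrable \<nu> (\<lambda>x. (1 - t) * z f x + t * z (\<lambda>x. f x + g x) x + (t\<^sup>2 - t) * z g x)"
    using F[THEN z_integrable] by simp_all
  fix A assume A: "A \<in> sets \<nu>"
  then interpret quad F "\<lambda>f. measure (em f) A" by (intro quad_em) (simp add: sets_nu)
  note si = F[THEN z_setint, OF A] and sv = F[THEN z_set_integral, OF A]
  show "(\<integral>x\<in>A. z (\<lambda>x. f x + t * g x) x \<partial>\<nu>) = 
    (\<integral>x\<in>A. ((1 - t) * z f x + t * z (\<lambda>x. f x + g x) x + (t\<^sup>2 - t) * z g x) \<partial>\<nu>)"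
    using si q_line[OF assms, of t] by (simp add: set_integral_add sv)
qed

text \<open>For three zero functions the identity says that four times the density equals three
  times the density.\<close>

lemma z_zero: "AE x in \<nu>. z (\<lambda>x. 0) x = 0"
  using z_add3[OF F_zero F_zero F_zero] by eventually_elim simp

lemma z_scale: 
  assumes "f \<in> F"
  shows "AE x in \<nu>. z (\<lambda>x. t * f x) x = t\<^sup>2 * z f x"
  using z_line[OF F_zero assms, of t] z_zero by eventually_elim (simp add: algebra_simps)

lemma e_sym: "e f g x = e g f x"
  unfolding e_z by (simp add: add.commute)

lemma e_self:
  assumes "f \<in> F"
  shows "AE x in \<nu>. e f f x = z f x"
  using z_scale[OF assms, of 2] unfolding e_z by eventually_elim simp

lemma e_zero: 
  assumes "g \<in> F"
  shows "AE x in \<nu>. e (\<lambda>x. 0) g x = 0"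
  using z_zero unfolding e_z by eventually_elim simp

lemma e_add:
  assumes "f \<in> F" "g \<in> F" "h \<in> F"
  shows "AE x in \<nu>. e (\<lambda>x. f x + g x) h x = e f h x + e g h x"
  using z_add3[OF assms] unfolding e_z by eventually_elim (simp add: field_simps)

lemma e_scale:
  assumes "f \<in> F" "g \<in> F"
  shows "AE x in \<nu>. e (\<lambda>x. t * f x) g x = t * e f g x"
proof -
  have eq: "(\<lambda>x. t * f x + g x) = (\<lambda>x. g x + t * f x)" "(\<lambda>x. f x + g x) = (\<lambda>x. g x + f x)"
    by (auto simp: add.commute)
  show ?thesis
    using z_line[OF assms(2,1), of t] z_scale[OF assms(1), of t] unfolding e_z eq
    by eventually_elim (simp add: field_simps)
qed

lemma e_sum:
  assumes "\<And>i. i < n \<Longrightarrow> fs i \<in> F" "g \<in> F"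
  shows "AE x in \<nu>. e (\<lambda>x. \<Sum>i<n. c i * fs i x) g x = (\<Sum>i<(n::nat). c i * e (fs i) g x)"
  using assms(1)
proof (induction n)
  case 0
  then show ?case using e_zero[OF assms(2)] by simp
next
  case (Suc n)
  have "AE x in \<nu>. e (\<lambda>x. \<Sum>i<n. c i * fs i x) g x = (\<Sum>i<n. c i * e (fs i) g x)" using Suc by simp
  moreover have "AE x in \<nu>. e (\<lambda>x. (\<Sum>i<n. c i * fs i x) + c n * fs n x) g x
      = e (\<lambda>x. \<Sum>i<n. c i * fs i x) g x + e (\<lambda>x. c n * fs n x) g x"
    using Suc.prems by (intro e_add F_sum F_scale assms(2)) auto
  moreover have "AE x in \<nu>. e (\<lambda>x. c n * fs n x) g x = c n * e (fs n) g x"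
    using Suc.prems by (intro e_scale assms(2)) auto
  ultimately show ?case by eventually_elim simp
qed

lemma e_sum2:
  assumes "\<And>i. i < n \<Longrightarrow> fs i \<in> F"
  shows "AE x in \<nu>. e (\<lambda>x. \<Sum>i<n. c i * fs i x) (\<lambda>x. \<Sum>i<n. d i * fs i x) x =
    (\<Sum>i<(n::nat). \<Sum>j<n. c i * d j * e (fs i) (fs j) x)"
proof -
  have s: "(\<lambda>x. \<Sum>i<n. d i * fs i x) \<in> F" using assms by (intro F_sum F_scale) auto
  have "AE x in \<nu>. e (\<lambda>x. \<Sum>i<n. c i * fs i x) (\<lambda>x. \<Sum>i<n. d i * fs i x) x =
     (\<Sum>i<n. c i * e (fs i) (\<lambda>x. \<Sum>i<n. d i * fs i x) x)"
    using assms s by (rule e_sum)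
  moreover have "AE x in \<nu>. \<forall>i\<in>{..<n}. e (\<lambda>x. \<Sum>j<n. d j * fs j x) (fs i) x = (\<Sum>j<n. d j * e (fs j) (fs i) x)"
    using assms by (intro AE_finite_allI e_sum) auto
  ultimately show ?thesis
  proof eventually_elim
    case (elim x)
    have "e (fs i) (\<lambda>x. \<Sum>i<n. d i * fs i x) x = (\<Sum>j<n. d j * e (fs i) (fs j) x)" if "i < n" for i
      using elim(2) that e_sym[of "fs i" "\<lambda>x. \<Sum>i<n. d i * fs i x"] e_sym[of "fs i"] by simp
    then show ?case unfolding elim(1) by (simp add: sum_distrib_left mult.assoc)
  qed
qed

text \<open>Rational coefficients suffice by density, which leaves only countably many null sets.\<close>

lemma psd_AE:
  assumes fs: "\<And>i. i < n \<Longrightarrow> fs i \<in> F"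
  shows "AE x in \<nu>. psd n (\<lambda>i j. e (fs i) (fs j) x)"
proof -
  have "AE x in \<nu>. 0 \<le> (\<Sum>i<n. \<Sum>j<n. c i * c j * e (fs i) (fs j) x)" for c
  proof -
    have "(\<lambda>x. \<Sum>i<n. c i * fs i x) \<in> F" using fs by (intro F_sum F_scale) auto
    from e_self[OF this] have 1: "AE x in \<nu>. e (\<lambda>x. \<Sum>i<n. c i * fs i x) (\<lambda>x. \<Sum>i<n. c i * fs i x) x
       = z (\<lambda>x. \<Sum>i<n. c i * fs i x) x" .
    have 2: "AE x in \<nu>. e (\<lambda>x. \<Sum>i<n. c i * fs i x) (\<lambda>x. \<Sum>i<n. c i * fs i x) x =
       (\<Sum>i<n. \<Sum>j<n. c i * c j * e (fs i) (fs j) x)"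
      by (rule e_sum2) (rule fs)
    from 1 2 show ?thesis
    proof eventually_elim
      case (elim x)
      show ?case unfolding elim(2)[symmetric] elim(1) by (rule z_nonneg)
    qed
  qed
  then have "AE x in \<nu>. \<forall>l::rat list. 0 \<le> (\<Sum>i<n. \<Sum>j<n. of_rat (l ! i) * of_rat (l ! j) * e (fs i) (fs j) x)"
    by (subst AE_all_countable) auto
  then show ?thesis
  proof eventually_elim
    case (elim x)
    have "0 \<le> (\<Sum>i<n. \<Sum>j<n. c i * c j * e (fs i) (fs j) x)" for c
    proof -
      have "\<exists>q::rat. c i < of_rat q \<and> of_rat q < c i + inverse (real (Suc k))" for i k
        using of_rat_dense[of "c i" "c i + inverse (real (Suc k))"] by simp
      then obtain q :: "nat \<Rightarrow> nat \<Rightarrow> rat" where q: "\<And>i k. c i < of_rat (q i k)" "\<And>i k. of_rat (q i k) < c i + inverse (real (Suc k))"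
        by metis
      have lim: "(\<lambda>k. real_of_rat (q i k)) \<longlonglongrightarrow> c i" for i
      proof (rule tendsto_sandwich[of "\<lambda>_. c i" _ _ "\<lambda>k. c i + inverse (real (Suc k))"])
        show "(\<lambda>k. c i + inverse (real (Suc k))) \<longlonglongrightarrow> c i"
          using tendsto_add[OF tendsto_const LIMSEQ_inverse_real_of_nat, of "c i"] by simp
      qed (use q in \<open>auto intro!: always_eventually less_imp_le simp del: of_nat_Suc\<close>)
      show ?thesis
      proof (rule LIMSEQ_le_const)
        show "(\<lambda>k. \<Sum>i<n. \<Sum>j<n. real_of_rat (q i k) * real_of_rat (q j k) * e (fs i) (fs j) x) \<longlonglongrightarrow>
          (\<Sum>i<n. \<Sum>j<n. c i * c j * e (fs i) (fs j) x)"
          by (intro tendsto_intros lim)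
        have "0 \<le> (\<Sum>i<n. \<Sum>j<n. real_of_rat (q i k) * real_of_rat (q j k) * e (fs i) (fs j) x)" for k
          using elim[rule_format, of "map (\<lambda>i. q i k) [0..<n]"] by simp
        then show "\<exists>N. \<forall>k\<ge>N. 0 \<le> (\<Sum>i<n. \<Sum>j<n. real_of_rat (q i k) * real_of_rat (q j k) * e (fs i) (fs j) x)" by blast
      qed
    qed
    then show ?case unfolding psd_def using e_sym by blast
  qed
qed

text \<open>Summable energies make the sum of the densities integrable, hence finite almost
  everywhere. Convergence of the energies alone would give this only along a subsequence.\<close>

lemma z_diff_tendsto:
  assumes u: "\<And>j. u j \<in> F" and f: "f \<in> F" and s: "summable (\<lambda>j. E (\<lambda>x. u j x - f x) (\<lambda>x. u j x - f x))"
  shows "AE x in \<nu>. (\<lambda>j. z (\<lambda>x. u j x - f x) x) \<longlonglongrightarrow> 0"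
proof -
  let ?d = "\<lambda>j x. u j x - f x"
  have d: "?d j \<in> F" for j using u f by (rule F_diff)
  have "(\<integral>\<^sup>+x. (\<Sum>j. ennreal (z (?d j) x)) \<partial>\<nu>) = (\<Sum>j. \<integral>\<^sup>+x. ennreal (z (?d j) x) \<partial>\<nu>)"
    by (rule nn_integral_suminf) measurable
  also have "\<dots> \<le> (\<Sum>j. ennreal (2 * E (?d j) (?d j)))"
  proof (rule suminf_le)
    fix j
    have "(\<integral>\<^sup>+x. ennreal (z (?d j) x) \<partial>\<nu>) = ennreal (integral\<^sup>L \<nu> (z (?d j)))"
      by (intro nn_integral_eq_integral z_integrable d) (simp add: z_nonneg)
    also have "\<dots> \<le> ennreal (2 * E (?d j) (?d j))" by (intro ennreal_leI z_integral_le d)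
    finally show "(\<integral>\<^sup>+x. ennreal (z (?d j) x) \<partial>\<nu>) \<le> ennreal (2 * E (?d j) (?d j))" .
  qed auto
  also have "\<dots> < \<infinity>"
  proof -
    have "summable (\<lambda>j. 2 * E (?d j) (?d j))" using s by (rule summable_mult)
    then have "(\<Sum>j. ennreal (2 * E (?d j) (?d j))) = ennreal (\<Sum>j. 2 * E (?d j) (?d j))"
      using E_nonneg[OF d] by (intro suminf_ennreal2) auto
    then show ?thesis by simp
  qed
  finally have "AE x in \<nu>. (\<Sum>j. ennreal (z (?d j) x)) \<noteq> \<infinity>"
    by (intro nn_integral_noteq_infinite) auto
  then show ?thesis
  proof eventually_elim
    case (elim x)
    then have "summable (\<lambda>j. z (?d j) x)"
      by (intro summable_suminf_not_top z_nonneg) simp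
    then show ?case by (rule summable_LIMSEQ_zero)
  qed
qed

lemma e_tendsto:
  assumes u: "\<And>j. u j \<in> F" and f: "f \<in> F" and g: "g \<in> F"
    and s: "summable (\<lambda>j. E (\<lambda>x. u j x - f x) (\<lambda>x. u j x - f x))"
  shows "AE x in \<nu>. (\<lambda>j. e (u j) g x) \<longlonglongrightarrow> e f g x"
    and "AE x in \<nu>. (\<lambda>j. z (u j) x) \<longlonglongrightarrow> z f x"
proof -
  let ?d = "\<lambda>j x. u j x - f x"
  have d: "?d j \<in> F" for j using u f by (rule F_diff)
  have CS: "AE x in \<nu>. \<forall>j. \<bar>e (?d j) h x\<bar> \<le> sqrt (z (?d j) x) * sqrt (z h x)" if h: "h \<in> F" for h
  proof (subst AE_all_countable, rule allI)
    fix j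
    \<comment> \<open>Positivity of this 2 by 2 matrix holds for all coefficients off a single null
      set, so Cauchy-Schwarz can be derived at a fixed point.\<close>
    define fs where "fs i = (if i = 0 then ?d j else h)" for i :: nat
    have "AE x in \<nu>. psd 2 (\<lambda>i j. e (fs i) (fs j) x)" using d h by (intro psd_AE) (auto simp: fs_def)
    with e_self[OF d[of j]] e_self[OF h]
    show "AE x in \<nu>. \<bar>e (?d j) h x\<bar> \<le> sqrt (z (?d j) x) * sqrt (z h x)"
    proof eventually_elim
      case (elim x)
      have "(e (?d j) h x)\<^sup>2 \<le> z (?d j) x * z h x"
      proof (rule sq_le_of_quadratic_nonneg)
        fix t :: real
        have "0 \<le> (\<Sum>a<2. \<Sum>b<2. (if a = 0 then 1 else t) * (if b = 0 then 1 else t) * e (fs a) (fs b) x)"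
          by (rule elim(3)[unfolded psd_def, THEN conjunct2, rule_format, of "\<lambda>a. if a = 0 then 1 else t"])
        also have "\<dots> = z (?d j) x + 2 * t * e (?d j) h x + t\<^sup>2 * z h x"
          using elim(1,2) e_sym[of h "?d j" x]
          by (simp add: fs_def numeral_2_eq_2 power2_eq_square)
        finally show "0 \<le> z (?d j) x + 2 * t * e (?d j) h x + t\<^sup>2 * z h x" .
      qed
      then show ?case by (metis real_sqrt_abs real_sqrt_le_iff real_sqrt_mult)
    qed
  qed
  have lim0: "AE x in \<nu>. (\<lambda>j. e (?d j) h x) \<longlonglongrightarrow> 0" if h: "h \<in> F" for h
    using CS[OF h] z_diff_tendsto[OF u f s]
  proof eventually_elim
    case (elim x)
    have "(\<lambda>j. sqrt (z (?d j) x) * sqrt (z h x)) \<longlonglongrightarrow> sqrt 0 * sqrt (z h x)"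
      by (intro tendsto_mult tendsto_real_sqrt tendsto_const elim(2))
    then have lim: "(\<lambda>j. sqrt (z (?d j) x) * sqrt (z h x)) \<longlonglongrightarrow> 0" by simp
    show ?case by (rule Lim_null_comparison[OF _ lim]) (use elim(1) in simp)
  qed
  have split: "AE x in \<nu>. \<forall>j. e (u j) h x = e (?d j) h x + e f h x" if h: "h \<in> F" for h
  proof (subst AE_all_countable, rule allI)
    fix j show "AE x in \<nu>. e (u j) h x = e (?d j) h x + e f h x"
      using e_add[OF d[of j] f h] by simp
  qed
  show "AE x in \<nu>. (\<lambda>j. e (u j) g x) \<longlonglongrightarrow> e f g x"
    using lim0[OF g] split[OF g]
    by eventually_elim (auto intro: tendsto_eq_intros)
  have "AE x in \<nu>. \<forall>j. z (u j) x = z (?d j) x + 2 * e (?d j) f x + z f x"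
  proof (subst AE_all_countable, rule allI)
    fix j show "AE x in \<nu>. z (u j) x = z (?d j) x + 2 * e (?d j) f x + z f x"
      by (simp add: e_z field_simps)
  qed
  with lim0[OF f] z_diff_tendsto[OF u f s]
  show "AE x in \<nu>. (\<lambda>j. z (u j) x) \<longlonglongrightarrow> z f x"
    by eventually_elim (auto intro!: tendsto_eq_intros)
qed

end

section \<open>Gram determinants\<close>

lemma psd_sym: "psd n A \<Longrightarrow> i < n \<Longrightarrow> j < n \<Longrightarrow> A i j = A j i"
  by (simp add: psd_def)

lemma psd_nonneg: "psd n A \<Longrightarrow> 0 \<le> (\<Sum>i<n. \<Sum>j<n. c i * c j * A i j)"
  by (simp add: psd_def)

text \<open>A zero of a nonnegative form is a minimum, so all its directional derivatives vanish;
  the perturbation changes only coordinate \<open>k\<close>.\<close>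

lemma psd_null:
  assumes A: "psd n A" and c: "(\<Sum>i<n. \<Sum>j<n. c i * c j * A i j) = 0" and k: "k < n"
  shows "(\<Sum>i<n. c i * A i k) = 0"
proof -
  let ?b = "\<Sum>i<n. c i * A i k"
  have "?b\<^sup>2 \<le> 0 * A k k"
  proof (rule sq_le_of_quadratic_nonneg)
    fix t
    define \<delta> :: "nat \<Rightarrow> real" where "\<delta> i = (if i = k then t else 0)" for i
    have s: "(\<Sum>i<n. \<delta> i * x i) = t * x k" for x :: "nat \<Rightarrow> real"
    proof -
      have "(\<Sum>i<n. \<delta> i * x i) = (\<Sum>i<n. if i = k then t * x i else 0)"
        by (intro sum.cong) (auto simp: \<delta>_def)
      then show ?thesis using k by simp
    qed
    have "(\<Sum>i<n. \<Sum>j<n. (c i + \<delta> i) * (c j + \<delta> j) * A i j) =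
       (\<Sum>i<n. \<Sum>j<n. c i * c j * A i j) + (\<Sum>i<n. c i * (\<Sum>j<n. \<delta> j * A i j))
       + (\<Sum>i<n. \<delta> i * (\<Sum>j<n. c j * A i j)) + (\<Sum>i<n. \<delta> i * (\<Sum>j<n. \<delta> j * A i j))"
    proof -
      have "(c i + \<delta> i) * (c j + \<delta> j) * A i j =
        c i * c j * A i j + c i * (\<delta> j * A i j) + \<delta> i * (c j * A i j) + \<delta> i * (\<delta> j * A i j)" for i j
        by (simp add: algebra_simps)
      then show ?thesis by (simp only: sum.distrib sum_distrib_left)
    qed
    also have "\<dots> = 0 + (\<Sum>i<n. c i * (t * A i k)) + t * (\<Sum>j<n. c j * A k j) + t * (t * A k k)"
      unfolding s c ..
    also have "(\<Sum>i<n. c i * (t * A i k)) = t * ?b" by (simp add: sum_distrib_left mult.left_commute)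
    also have "(\<Sum>j<n. c j * A k j) = ?b" using psd_sym[OF A k] by (intro sum.cong) auto
    finally have "(\<Sum>i<n. \<Sum>j<n. (c i + \<delta> i) * (c j + \<delta> j) * A i j) = 0 + 2 * t * ?b + t\<^sup>2 * A k k"
      by (simp add: power2_eq_square)
    then show "0 \<le> 0 + 2 * t * ?b + t\<^sup>2 * A k k"
      using psd_nonneg[OF A, of "\<lambda>i. c i + \<delta> i"] by simp
  qed
  then show ?thesis by simp
qed

definition gdet :: "nat \<Rightarrow> (nat \<Rightarrow> nat \<Rightarrow> real) \<Rightarrow> real" where
  "gdet n A = det (mat n n (\<lambda>(i, j). A i j))"

lemma gdet_cong: "(\<And>i j. i < n \<Longrightarrow> j < n \<Longrightarrow> A i j = B i j) \<Longrightarrow> gdet n A = gdet n B"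
  unfolding gdet_def by (rule arg_cong[where f=det]) (auto intro!: eq_matI)

lemma gdet_zero_iff: "gdet n A = 0 \<longleftrightarrow> (\<exists>c. (\<exists>i<n. c i \<noteq> 0) \<and> (\<forall>i<n. (\<Sum>j<n. A i j * c j) = 0))"
proof -
  let ?M = "mat n n (\<lambda>(i, j). A i j)"
  have M: "?M \<in> carrier_mat n n" by simp
  have prod: "(?M *\<^sub>v v) $ i = (\<Sum>j<n. A i j * v $ j)" if "v \<in> carrier_vec n" "i < n" for v i
    using that by (simp add: mult_mat_vec_def scalar_prod_def atLeast0LessThan)
  show ?thesis unfolding gdet_def det_0_iff_vec_prod_zero_field[OF M]
  proof
    assume "\<exists>v. v \<in> carrier_vec n \<and> v \<noteq> 0\<^sub>v n \<and> ?M *\<^sub>v v = 0\<^sub>v n"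
    then obtain v where v: "v \<in> carrier_vec n" "v \<noteq> 0\<^sub>v n" "?M *\<^sub>v v = 0\<^sub>v n" by blast
    have "\<exists>i<n. v $ i \<noteq> 0"
    proof (rule ccontr)
      assume "\<not> (\<exists>i<n. v $ i \<noteq> 0)"
      then have "v = 0\<^sub>v n" using v(1) by (intro eq_vecI) auto
      with v(2) show False by simp
    qed
    moreover have "\<forall>i<n. (\<Sum>j<n. A i j * v $ j) = 0" using prod[OF v(1)] v(3) by simp
    ultimately show "\<exists>c. (\<exists>i<n. c i \<noteq> 0) \<and> (\<forall>i<n. (\<Sum>j<n. A i j * c j) = 0)"
      by (intro exI[of _ "\<lambda>i. v $ i"]) auto
  next
    assume "\<exists>c. (\<exists>i<n. c i \<noteq> 0) \<and> (\<forall>i<n. (\<Sum>j<n. A i j * c j) = 0)"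
    then obtain c i where c: "i < n" "c i \<noteq> 0" "\<And>i. i < n \<Longrightarrow> (\<Sum>j<n. A i j * c j) = 0" by blast
    have v: "vec n c \<in> carrier_vec n" by simp
    have "vec n c \<noteq> 0\<^sub>v n" using c(1,2) by (metis index_vec index_zero_vec(1))
    moreover have "?M *\<^sub>v vec n c = 0\<^sub>v n"
      by (rule eq_vecI) (use prod[OF v] c(3) in auto)
    ultimately show "\<exists>v. v \<in> carrier_vec n \<and> v \<noteq> 0\<^sub>v n \<and> ?M *\<^sub>v v = 0\<^sub>v n" using v by blast
  qed
qed

text \<open>Nondegeneracy upgrades semidefiniteness to definiteness, since a zero of the form is a
  null vector of the matrix.\<close>

lemma psd_gdet_pos:
  assumes "psd n A" "gdet n A \<noteq> 0" "(\<Sum>i<n. \<Sum>j<n. c i * c j * A i j) = 0" "i < n"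
  shows "c i = 0"
proof (rule ccontr)
  assume "c i \<noteq> 0"
  moreover have "(\<Sum>j<n. A k j * c j) = 0" if "k < n" for k
  proof -
    have "(\<Sum>j<n. A k j * c j) = (\<Sum>j<n. c j * A j k)"
      using psd_sym[OF assms(1) that] by (intro sum.cong) auto
    then show ?thesis using psd_null[OF assms(1,3) that] by simp
  qed
  ultimately show False using assms(2,4) gdet_zero_iff[of n A] by blast
qed

lemma gdet_nonzeroI:
  assumes "\<And>c. (\<Sum>i<n. \<Sum>j<n. c i * c j * A i j) = 0 \<Longrightarrow> \<forall>i<n. c i = 0"
  shows "gdet n A \<noteq> 0"
proof
  assume "gdet n A = 0"
  then obtain c i where c: "i < n" "c i \<noteq> 0" "\<And>i. i < n \<Longrightarrow> (\<Sum>j<n. A i j * c j) = 0"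
    unfolding gdet_zero_iff by blast
  have "(\<Sum>i<n. \<Sum>j<n. c i * c j * A i j) = (\<Sum>i<n. c i * (\<Sum>j<n. A i j * c j))"
    by (simp add: sum_distrib_left mult_ac)
  also have "\<dots> = 0" using c(3) by simp
  finally show False using assms[of c] c(1,2) by blast
qed

text \<open>The system is padded with zero rows to a square matrix. Its row \<open>r\<close> is
  zero, so the transpose annihilates the unit vector \<open>r\<close> and the determinant
  vanishes.\<close>

lemma underdetermined_solution:
  fixes a :: "nat \<Rightarrow> nat \<Rightarrow> real"
  assumes "r < s"
  obtains d k where "k < s" "d k \<noteq> 0" "\<And>j. j < r \<Longrightarrow> (\<Sum>k<s. a j k * d k) = 0"
proof -
  let ?A = "\<lambda>j k. if j < r then a j k else 0"
  have "gdet s ?A = 0"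
  proof -
    define M where "M = mat s s (\<lambda>(i, j). ?A i j)"
    have M: "M \<in> carrier_mat s s" by (simp add: M_def)
    have "det M = det (transpose_mat M)" by (rule det_transpose[OF M, symmetric])
    also have "\<dots> = 0"
    proof (subst det_0_iff_vec_prod_zero_field)
      show "transpose_mat M \<in> carrier_mat s s" using M by simp
      have "unit_vec s r \<noteq> (0\<^sub>v s :: real vec)" using assms by (metis index_unit_vec(1) index_zero_vec(1) zero_neq_one)
      moreover have "transpose_mat M *\<^sub>v unit_vec s r = 0\<^sub>v s"
        using assms by (intro eq_vecI) (auto simp: M_def)
      ultimately show "\<exists>v. v \<in> carrier_vec s \<and> v \<noteq> 0\<^sub>v s \<and> transpose_mat M *\<^sub>v v = 0\<^sub>v s"
        using unit_vec_carrier by blast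
    qed
    finally show ?thesis by (simp add: gdet_def M_def)
  qed
  then obtain d k where d: "k < s" "d k \<noteq> 0" "\<And>i. i < s \<Longrightarrow> (\<Sum>j<s. ?A i j * d j) = 0"
    unfolding gdet_zero_iff by blast
  have "(\<Sum>k<s. a j k * d k) = 0" if "j < r" for j
    using d(3)[of j] that assms by simp
  with d(1,2) show thesis by (rule that)
qed

text \<open>\<open>curve r i t j\<close> lists the coordinates of the \<open>j\<close>-th vector of the perturbed system: a basis vector for
  \<open>j < r\<close>, and for \<open>j = r\<close> the point of the moment curve whose \<open>i + k\<close>-th coordinate is \<open>t ^ k\<close>.\<close>

definition curve :: "nat \<Rightarrow> nat \<Rightarrow> real \<Rightarrow> nat \<Rightarrow> nat \<Rightarrow> real" where
  "curve r i t j a = (if j < r then (if a = j then 1 else 0) else if a < i then 0 else t ^ (a - i))"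

definition curve_gram :: "nat \<Rightarrow> (nat \<Rightarrow> nat \<Rightarrow> real) \<Rightarrow> nat \<Rightarrow> nat \<Rightarrow> real \<Rightarrow> nat \<Rightarrow> nat \<Rightarrow> real" where
  "curve_gram M A r i t j l = (\<Sum>a<M. \<Sum>b<M. curve r i t j a * curve r i t l b * A a b)"

text \<open>The form of a Gram matrix at \<open>c\<close> is the form of \<open>A\<close> at the
  combination of the vectors \<open>C j\<close> with coefficients \<open>c j\<close>. Here
  \<open>C\<close> is arbitrary, so the curve and the selection of coordinates are both
  covered.\<close>

lemma gram_quadratic_form:
  fixes A C :: "nat \<Rightarrow> nat \<Rightarrow> real"
  shows "(\<Sum>j<n. \<Sum>l<n. c j * c l * (\<Sum>a<M. \<Sum>b<M. C j a * C l b * A a b)) =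
   (\<Sum>a<M. \<Sum>b<M. (\<Sum>j<n. c j * C j a) * (\<Sum>l<n. c l * C l b) * A a b)"
proof -
  let ?f = "\<lambda>j l a b. (c j * C j a) * (c l * C l b) * A a b"
  have "(\<Sum>j<n. \<Sum>l<n. c j * c l * (\<Sum>a<M. \<Sum>b<M. C j a * C l b * A a b)) =
    (\<Sum>j<n. \<Sum>l<n. \<Sum>a<M. \<Sum>b<M. ?f j l a b)"
    by (simp add: sum_distrib_left mult_ac)
  also have "\<dots> = (\<Sum>j<n. \<Sum>a<M. \<Sum>l<n. \<Sum>b<M. ?f j l a b)" by (rule sum.cong[OF refl], rule sum.swap)
  also have "\<dots> = (\<Sum>a<M. \<Sum>j<n. \<Sum>l<n. \<Sum>b<M. ?f j l a b)" by (rule sum.swap)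
  also have "\<dots> = (\<Sum>a<M. \<Sum>j<n. \<Sum>b<M. \<Sum>l<n. ?f j l a b)"
    by (rule sum.cong[OF refl], rule sum.cong[OF refl], rule sum.swap)
  also have "\<dots> = (\<Sum>a<M. \<Sum>b<M. \<Sum>j<n. \<Sum>l<n. ?f j l a b)" by (rule sum.cong[OF refl], rule sum.swap)
  also have "\<dots> = (\<Sum>a<M. \<Sum>b<M. (\<Sum>j<n. c j * C j a) * (\<Sum>l<n. c l * C l b) * A a b)"
    by (simp only: sum_product) (simp only: sum_distrib_right)
  finally show ?thesis .
qed

text \<open>The reindexed matrix is the Gram matrix of the unit vectors at the positions
  \<open>ls\<close>, which may repeat.\<close>

lemma psd_reindex:
  assumes A: "psd M A" and ls: "\<And>k. k < s \<Longrightarrow> ls k < M"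
  shows "psd s (\<lambda>k l. A (ls k) (ls l))"
  unfolding psd_def
proof (intro conjI allI impI)
  fix c
  let ?C = "\<lambda>k a. if a = ls k then 1 else 0 :: real"
  have "(\<Sum>a<M. \<Sum>b<M. ?C k a * ?C l b * A a b) = A (ls k) (ls l)" if "k < s" "l < s" for k l
  proof -
    have del: "(\<Sum>a<M. (if a = k then 1 else 0) * f a) = f k" if "k < M" for f :: "nat \<Rightarrow> real" and k
    proof -
      have "(\<Sum>a<M. (if a = k then 1 else 0) * f a) = (\<Sum>a<M. if a = k then f a else 0)"
        by (intro sum.cong) auto
      then show ?thesis using that by simp
    qed
    have "(\<Sum>a<M. \<Sum>b<M. ?C k a * ?C l b * A a b) = (\<Sum>a<M. ?C k a * (\<Sum>b<M. ?C l b * A a b))"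
      by (simp only: sum_distrib_left mult.assoc)
    also have "\<dots> = A (ls k) (ls l)" by (simp only: del ls that)
    finally show ?thesis .
  qed
  then have "(\<Sum>k<s. \<Sum>l<s. c k * c l * A (ls k) (ls l)) =
     (\<Sum>k<s. \<Sum>l<s. c k * c l * (\<Sum>a<M. \<Sum>b<M. ?C k a * ?C l b * A a b))"
    by (intro sum.cong refl) simp
  also have "\<dots> \<ge> 0" unfolding gram_quadratic_form by (rule psd_nonneg[OF A])
  finally show "0 \<le> (\<Sum>k<s. \<Sum>l<s. c k * c l * A (ls k) (ls l))" .
qed (use psd_sym[OF A] ls in auto)

text \<open>Among the more than \<open>r\<close> independent vectors \<open>ls\<close> some combination \<open>\<Sum>k. d k * ls k\<close> is orthogonal to the first
  \<open>r\<close> basis vectors but not null. Wherever the perturbed system is dependent, the point of the curve is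
  orthogonal to this combination, which is a nonzero polynomial condition on \<open>t\<close>.\<close>

lemma curve_gram_singular:
  assumes A: "psd (Suc (i + N)) A" and r: "r \<le> i" and G: "gdet r A \<noteq> 0"
    and s: "r < s" and ls: "\<And>k. k < s \<Longrightarrow> i < ls k \<and> ls k \<le> i + N"
    and P: "gdet s (\<lambda>k l. A (ls k) (ls l)) \<noteq> 0"
  shows "finite {t. gdet (Suc r) (curve_gram (Suc (i + N)) A r i t) = 0}"
    "card {t. gdet (Suc r) (curve_gram (Suc (i + N)) A r i t) = 0} \<le> N"
proof -
  let ?M = "Suc (i + N)"
  obtain d k0 where d: "k0 < s" "d k0 \<noteq> 0" "\<And>j. j < r \<Longrightarrow> (\<Sum>k<s. A j (ls k) * d k) = 0"
    using underdetermined_solution[OF s, of "\<lambda>j k. A j (ls k)"] by metis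
  \<comment> \<open>The pairing of the basis vector \<open>a\<close> with the combination given by
    \<open>d\<close>; it is zero for \<open>a < r\<close>.\<close>
  define \<omega> where "\<omega> a = (\<Sum>k<s. A a (ls k) * d k)" for a
  have lsM: "ls k < ?M" if "k < s" for k using ls[OF that] by simp
  have psd_ls: "psd s (\<lambda>k l. A (ls k) (ls l))"
    by (rule psd_reindex[OF A lsM])
  \<comment> \<open>Otherwise the combination would be orthogonal to each of its own constituents,
    hence null, contrary to the nonzero minor.\<close>
  have "\<exists>a. i < a \<and> a \<le> i + N \<and> \<omega> a \<noteq> 0"
  proof (rule ccontr)
    assume "\<not> ?thesis"
    then have "\<omega> (ls l) = 0" if "l < s" for l using ls[OF that] by blast
    then have "(\<Sum>l<s. d l * \<omega> (ls l)) = 0" by simp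
    then have "(\<Sum>l<s. \<Sum>k<s. d l * d k * A (ls l) (ls k)) = 0"
      unfolding \<omega>_def by (simp add: sum_distrib_left mult_ac)
    from psd_gdet_pos[OF psd_ls P this d(1)] d(2) show False by simp
  qed
  then obtain a where a: "i < a" "a \<le> i + N" "\<omega> a \<noteq> 0" by blast
  then have nz: "\<exists>k\<le>N. \<omega> (i + k) \<noteq> 0" by (intro exI[of _ "a - i"]) auto
  \<comment> \<open>The polynomial is the pairing of the curve with the combination; the term
    \<open>k = 0\<close> belongs to the base point of the curve.\<close>
  let ?Z = "{t. (\<Sum>k\<le>N. \<omega> (i + k) * t ^ k) = 0}"
  have Z: "finite ?Z" "card ?Z \<le> N" using polyfun_rootbound[of N "\<lambda>k. \<omega> (i + k)"] nz by auto
  have sub: "{t. gdet (Suc r) (curve_gram ?M A r i t) = 0} \<subseteq> ?Z"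
  proof
    fix t assume "t \<in> {t. gdet (Suc r) (curve_gram ?M A r i t) = 0}"
    then have "\<not> (\<forall>c. (\<Sum>j<Suc r. \<Sum>l<Suc r. c j * c l * curve_gram ?M A r i t j l) = 0 \<longrightarrow> (\<forall>j<Suc r. c j = 0))"
      using gdet_nonzeroI[where n="Suc r" and A="curve_gram ?M A r i t"] by blast
    then obtain c j0 where c: "(\<Sum>j<Suc r. \<Sum>l<Suc r. c j * c l * curve_gram ?M A r i t j l) = 0"
      "j0 < Suc r" "c j0 \<noteq> 0" by blast
    define y where "y a = (\<Sum>j<Suc r. c j * curve r i t j a)" for a
    have y: "y a = (if a < r then c a else if a < i then 0 else c r * t ^ (a - i))" for a
    proof -
      have "(\<Sum>j<r. c j * curve r i t j a) = (\<Sum>j<r. if a = j then c j else 0)"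
        by (intro sum.cong refl) (auto simp: curve_def)
      then show ?thesis using r by (auto simp: y_def curve_def)
    qed
    have Q: "(\<Sum>a<?M. \<Sum>b<?M. y a * y b * A a b) = 0"
      using c(1) unfolding curve_gram_def gram_quadratic_form y_def .
    note null = psd_null[OF A Q]
    \<comment> \<open>Otherwise the dependence would involve only the first \<open>r\<close> basis
      vectors, which are independent by \<open>G\<close>.\<close>
    have "c r \<noteq> 0"
    proof
      assume cr: "c r = 0"
      have ext: "(\<Sum>a<?M. y a * f a) = (\<Sum>a<r. c a * f a)" for f :: "nat \<Rightarrow> real"
      proof -
        have "(\<Sum>a<?M. y a * f a) = (\<Sum>a<r. y a * f a)"
          using r y cr by (intro sum.mono_neutral_right) auto
        then show ?thesis using y by simp
      qed
      have "(\<Sum>a<?M. \<Sum>b<?M. y a * y b * A a b) = (\<Sum>a<?M. y a * (\<Sum>b<?M. y b * A a b))"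
        by (simp add: sum_distrib_left mult.assoc del: sum.lessThan_Suc)
      also have "\<dots> = (\<Sum>a<r. \<Sum>b<r. c a * c b * A a b)"
        unfolding ext by (simp add: sum_distrib_left mult.assoc)
      finally have "(\<Sum>a<r. \<Sum>b<r. c a * c b * A a b) = 0" using Q by simp
      moreover have "psd r A"
        using psd_reindex[OF A, of r "\<lambda>k. k"] r by simp
      ultimately have "c j = 0" if "j < r" for j using psd_gdet_pos[OF _ G] that by blast
      with cr c(2,3) show False using less_SucE by blast
    qed
    have "(\<Sum>k<s. (\<Sum>a<?M. y a * A a (ls k)) * d k) = 0"
      using null[OF lsM] by (intro sum.neutral) auto
    also have "(\<Sum>k<s. (\<Sum>a<?M. y a * A a (ls k)) * d k) = (\<Sum>a<?M. y a * \<omega> a)"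
      unfolding \<omega>_def sum_distrib_left sum_distrib_right by (subst sum.swap) (simp only: mult.assoc)
    also have "\<dots> = (\<Sum>a\<in>{i..<?M}. y a * \<omega> a)"
    proof (rule sum.mono_neutral_right)
      show "\<forall>a\<in>{..<?M} - {i..<?M}. y a * \<omega> a = 0"
        using d(3) y by (auto simp: \<omega>_def)
    qed auto
    also have "\<dots> = (\<Sum>k\<le>N. y (i + k) * \<omega> (i + k))"
      by (rule sum.reindex_bij_witness[of _ "\<lambda>k. i + k" "\<lambda>a. a - i"]) auto
    also have "\<dots> = (\<Sum>k\<le>N. c r * (\<omega> (i + k) * t ^ k))"
      using r y by (intro sum.cong refl) auto
    also have "\<dots> = c r * (\<Sum>k\<le>N. \<omega> (i + k) * t ^ k)" by (simp add: sum_distrib_left)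
    finally show "t \<in> ?Z" using \<open>c r \<noteq> 0\<close> by simp
  qed
  show "finite {t. gdet (Suc r) (curve_gram ?M A r i t) = 0}" using sub Z(1) by (rule finite_subset)
  show "card {t. gdet (Suc r) (curve_gram ?M A r i t) = 0} \<le> N"
    using card_mono[OF Z(1) sub] Z(2) by simp
qed

text \<open>A maximal independent set of columns indexes the minor: a null vector of the minor is a null vector
  of the quadratic form, hence of the matrix.\<close>

lemma psd_principal_minor:
  assumes A: "psd N A" and r: "r = vec_space.rank N (mat N N (\<lambda>(i, j). A i j))"
  obtains ls where "length ls = r" "set ls \<subseteq> {..<N}" "gdet r (\<lambda>k l. A (ls ! k) (ls ! l)) \<noteq> 0"
proof -
  interpret vec_space "TYPE(real)" N .
  let ?M = "mat N N (\<lambda>(i, j). A i j)"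
  have M: "?M \<in> carrier_mat N N" by simp
  let ?P = "\<lambda>T. T \<subseteq> set (cols ?M) \<and> lin_indpt T"
  have "?P {}" by (auto simp: lin_dep_def)
  then obtain S where S: "finite S" "maximal S ?P"
    using maximal_exists_superset[of "set (cols ?M)" ?P "{}"] by auto
  have Sr: "card S = r" unfolding r using rank_card_indpt[OF M S(2)] by simp
  have S2: "S \<subseteq> set (cols ?M)" "lin_indpt S" using S(2) by (auto simp: maximal_def)
  obtain vs where vs: "set vs = S" "distinct vs" using finite_distinct_list[OF S(1)] by blast
  have len: "length vs = r" using Sr vs distinct_card by fastforce
  have "\<exists>a<N. v = col ?M a" if "v \<in> S" for v
  proof -
    have "S \<subseteq> col ?M ` {0..<N}" using S2(1) unfolding cols_def set_map set_upt dim_col_mat .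
    then show ?thesis using that by (metis atLeastLessThan_iff imageE subsetD)
  qed
  then obtain a where a: "\<And>v. v \<in> S \<Longrightarrow> a v < N" "\<And>v. v \<in> S \<Longrightarrow> v = col ?M (a v)" by metis
  define ls where "ls = map a vs"
  have vsk: "vs ! k \<in> S" if "k < r" for k using that vs len by (metis nth_mem)
  have lsk: "ls ! k < N" "vs ! k = col ?M (ls ! k)" if "k < r" for k
    using a vsk[OF that] that len by (simp_all add: ls_def)
  have "gdet r (\<lambda>k l. A (ls ! k) (ls ! l)) \<noteq> 0"
  proof
    assume "gdet r (\<lambda>k l. A (ls ! k) (ls ! l)) = 0"
    then obtain c k0 where c: "k0 < r" "c k0 \<noteq> 0" "\<And>k. k < r \<Longrightarrow> (\<Sum>l<r. A (ls ! k) (ls ! l) * c l) = 0"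
      unfolding gdet_zero_iff by blast
    \<comment> \<open>The null vector of the minor, extended by zero to all \<open>N\<close>
      coordinates.\<close>
    define y where "y i = (\<Sum>k<r. if ls ! k = i then c k else 0)" for i
    have ext: "(\<Sum>i<N. y i * f i) = (\<Sum>k<r. c k * f (ls ! k))" for f :: "nat \<Rightarrow> real"
    proof -
      have "(\<Sum>i<N. y i * f i) = (\<Sum>k<r. \<Sum>i<N. (if ls ! k = i then c k * f i else 0))"
        unfolding y_def sum_distrib_right by (subst sum.swap) (auto intro!: sum.cong)
      also have "\<dots> = (\<Sum>k<r. c k * f (ls ! k))" using lsk(1) by (intro sum.cong) auto
      finally show ?thesis .
    qed
    have "(\<Sum>i<N. \<Sum>j<N. y i * y j * A i j) = (\<Sum>i<N. y i * (\<Sum>j<N. y j * A i j))"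
      by (simp only: sum_distrib_left mult.assoc)
    also have "\<dots> = (\<Sum>k<r. c k * (\<Sum>l<r. c l * A (ls ! k) (ls ! l)))" unfolding ext ..
    also have "\<dots> = 0" using c(3) by (simp add: mult.commute)
    finally have Q: "(\<Sum>i<N. \<Sum>j<N. y i * y j * A i j) = 0" .
    have row: "(\<Sum>k<r. c k * A (ls ! k) j) = 0" if "j < N" for j
      using psd_null[OF A Q that] unfolding ext .
    \<comment> \<open>Linear combinations run over the set of columns, so coefficients are looked up
      by vector instead of position.\<close>
    define idx where "idx v = (THE k. k < r \<and> vs ! k = v)" for v
    have idx: "idx (vs ! k) = k" if "k < r" for k
      unfolding idx_def using that vs(2) len by (intro the_equality) (auto simp: nth_eq_iff_index_eq)
    have Sc: "S \<subseteq> carrier_vec N" using S2(1) cols_dim[of ?M] by auto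
    have "lincomb (\<lambda>v. c (idx v)) S = 0\<^sub>v N"
    proof (rule eq_vecI)
      show "dim_vec (lincomb (\<lambda>v. c (idx v)) S) = dim_vec (0\<^sub>v N)"
        using lincomb_dim[OF S(1) Sc] by simp
      fix j assume "j < dim_vec (0\<^sub>v N)"
      then have j: "j < N" by simp
      have "lincomb (\<lambda>v. c (idx v)) S $ j = (\<Sum>v\<in>S. c (idx v) * v $ j)"
        using lincomb_index[OF j Sc] by simp
      also have "\<dots> = (\<Sum>k<r. c (idx (vs ! k)) * (vs ! k) $ j)"
        by (rule sum.reindex_bij_betw[symmetric]) (use bij_betw_nth[OF vs(2), of "{..<r}" S] vs len in auto)
      also have "\<dots> = (\<Sum>k<r. c k * A (ls ! k) j)"
        using idx lsk j psd_sym[OF A] by (intro sum.cong) auto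
      also have "\<dots> = 0" by (rule row[OF j])
      finally show "lincomb (\<lambda>v. c (idx v)) S $ j = 0\<^sub>v N $ j" using j by simp
    qed
    moreover have "vs ! k0 \<in> S" "c (idx (vs ! k0)) \<noteq> 0" using vsk idx c(1,2) by auto
    ultimately have "lin_dep S"
      unfolding lin_dep_def using S(1) by (intro exI[of _ S] exI[of _ "\<lambda>v. c (idx v)"] exI[of _ "vs ! k0"]) auto
    with S2(2) show False by simp
  qed
  moreover have "set ls \<subseteq> {..<N}" using a(1) vs(1) by (auto simp: ls_def)
  ultimately show thesis using that[of ls] len by (simp add: ls_def)
qed

section \<open>Essential unions and a Baire category argument\<close>

text \<open>As a polynomial in the entries the determinant inherits convergence and measurability
  from them.\<close>

lemma gdet_expand: "gdet n A = (\<Sum>\<pi> | \<pi> permutes {0..<n}. signof \<pi> * (\<Prod>i = 0..<n. A i (\<pi> i)))"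
proof -
  have "gdet n A = (\<Sum>\<pi> | \<pi> permutes {0..<n}. signof \<pi> * (\<Prod>i = 0..<n. mat n n (\<lambda>(i, j). A i j) $$ (i, \<pi> i)))"
    unfolding gdet_def by (rule det_def') simp
  also have "\<dots> = (\<Sum>\<pi> | \<pi> permutes {0..<n}. signof \<pi> * (\<Prod>i = 0..<n. A i (\<pi> i)))"
  proof (rule sum.cong[OF refl])
    fix \<pi> assume "\<pi> \<in> {\<pi>. \<pi> permutes {0..<n}}"
    then have "\<pi> i < n" if "i < n" for i using permutes_in_image[of \<pi> "{0..<n}" i] that by simp
    then show "signof \<pi> * (\<Prod>i = 0..<n. mat n n (\<lambda>(i, j). A i j) $$ (i, \<pi> i)) = signof \<pi> * (\<Prod>i = 0..<n. A i (\<pi> i))"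
      by (intro arg_cong2[where f="(*)"] prod.cong refl) auto
  qed
  finally show ?thesis .
qed

lemma gdet_tendsto:
  assumes "\<And>i j. i < n \<Longrightarrow> j < n \<Longrightarrow> ((\<lambda>k. A k i j) \<longlongrightarrow> L i j) F"
  shows "((\<lambda>k. gdet n (A k)) \<longlongrightarrow> gdet n L) F"
  unfolding gdet_expand
proof (intro tendsto_sum tendsto_mult_left tendsto_prod)
  fix \<pi> i assume "\<pi> \<in> {\<pi>. \<pi> permutes {0..<n}}" "i \<in> {0..<n}"
  then show "((\<lambda>k. A k i (\<pi> i)) \<longlongrightarrow> L i (\<pi> i)) F"
    using permutes_in_image[of \<pi> "{0..<n}" i] by (intro assms) auto
qed

lemma gdet_measurable:
  assumes "\<And>i j. (\<lambda>x. A x i j) \<in> borel_measurable M"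
  shows "(\<lambda>x. gdet n (A x)) \<in> borel_measurable M"
  unfolding gdet_expand using assms by measurable

lemma sigma_finite_equivalent_finite:
  assumes "sigma_finite_measure M"
  obtains N where "finite_measure N" "sets N = sets M" "\<And>P. (AE x in N. P x) \<longleftrightarrow> (AE x in M. P x)"
proof -
  interpret sigma_finite_measure M by fact
  obtain h where h: "h \<in> borel_measurable M" "integral\<^sup>N M h \<noteq> \<infinity>" "\<forall>x\<in>space M. 0 < h x \<and> h x < \<infinity>"
    using Ex_finite_integrable_function by blast
  show thesis
  proof (rule that[of "density M h"])
    have "emeasure (density M h) (space M) = integral\<^sup>N M h"
      using h(1) by (subst emeasure_density) (auto intro!: nn_integral_cong)
    then show "finite_measure (density M h)" using h(2) by (intro finite_measureI) simp
    show "(AE x in density M h. P x) \<longleftrightarrow> (AE x in M. P x)" for P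
      unfolding AE_density[OF h(1)] using h(3) by (intro AE_cong) auto
  qed simp
qed

text \<open>Exhaustion: among unions of countable subfamilies the measure attains its supremum, and
  a member adding positive mass to a maximal union would exceed it. The union of the whole family
  may fail to be measurable.\<close>

lemma essential_union:
  assumes "finite_measure N" and S: "\<And>i. i \<in> I \<Longrightarrow> S i \<in> sets N"
  obtains J where "countable J" "J \<subseteq> I" "\<And>i. i \<in> I \<Longrightarrow> AE x in N. x \<in> S i \<longrightarrow> (\<exists>j\<in>J. x \<in> S j)"
proof -
  interpret finite_measure N by fact
  define \<C> where "\<C> = {J. countable J \<and> J \<subseteq> I}"
  define m where "m J = measure N (\<Union>j\<in>J. S j)" for J
  have UJ: "(\<Union>j\<in>J. S j) \<in> sets N" if "J \<in> \<C>" for J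
    using that S by (intro sets.countable_UN') (auto simp: \<C>_def)
  have bdd: "bdd_above (m ` \<C>)"
    using bounded_measure by (auto simp: m_def intro!: bdd_aboveI[of _ "measure N (space N)"])
  define s where "s = Sup (m ` \<C>)"
  have ne: "m ` \<C> \<noteq> {}" by (auto simp: \<C>_def intro: exI[of _ "{}"])
  have "\<exists>J\<in>\<C>. s - inverse (real (Suc k)) < m J" for k
    using less_cSup_iff[OF ne bdd, of "s - inverse (real (Suc k))"] by (simp add: s_def[symmetric])
  then obtain J where J: "\<And>k. J k \<in> \<C>" "\<And>k. s - inverse (real (Suc k)) < m (J k)" by metis
  define U where "U = (\<Union>k. J k)"
  have U: "U \<in> \<C>" using J(1) by (auto simp: \<C>_def U_def)
  have "s - inverse (real (Suc k)) \<le> m U" for k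
  proof -
    have "m (J k) \<le> m U" unfolding m_def by (intro finite_measure_mono UJ U) (auto simp: U_def)
    with J(2)[of k] show ?thesis by simp
  qed
  moreover have "(\<lambda>k. s - inverse (real (Suc k))) \<longlonglongrightarrow> s - 0"
    by (intro tendsto_diff tendsto_const LIMSEQ_inverse_real_of_nat)
  ultimately have sU: "s \<le> m U" by (intro LIMSEQ_le_const2[of _ s]) auto
  show thesis
  proof (rule that[of U])
    show "countable U" "U \<subseteq> I" using U by (auto simp: \<C>_def)
    fix i assume i: "i \<in> I"
    let ?D = "S i - (\<Union>j\<in>U. S j)"
    have D: "?D \<in> sets N" using S[OF i] UJ[OF U] by auto
    have "insert i U \<in> \<C>" using U i by (auto simp: \<C>_def)
    then have "m (insert i U) \<le> s" unfolding s_def using bdd by (intro cSup_upper) auto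
    moreover have "m (insert i U) = m U + measure N ?D"
    proof -
      have eq: "(\<Union>j\<in>insert i U. S j) = (\<Union>j\<in>U. S j) \<union> ?D" by auto
      show ?thesis unfolding m_def eq using UJ[OF U] D by (intro finite_measure_Union) auto
    qed
    ultimately have "measure N ?D = 0" using sU measure_nonneg[of N ?D] by linarith
    then have "?D \<in> null_sets N" using D by (intro null_setsI) (simp_all add: emeasure_eq_measure)
    from AE_not_in[OF this] show "AE x in N. x \<in> S i \<longrightarrow> (\<exists>j\<in>U. x \<in> S j)" by eventually_elim auto
  qed
qed

section \<open>Baire category in the domain of the form\<close>

context dform begin

text \<open>\<open>F\<close> is a set of functions with a seminorm that vanishes on null functions,
  not a complete metric space as a type, so the nested balls are constructed by hand.\<close>

lemma F_Baire:
  fixes P :: "nat \<Rightarrow> ('a \<Rightarrow> real) \<Rightarrow> bool"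
  assumes open_P: "\<And>k u. u \<in> F \<Longrightarrow> P k u \<Longrightarrow> \<exists>\<delta>>0. \<forall>v\<in>F. E1norm m E (\<lambda>x. v x - u x) < \<delta> \<longrightarrow> P k v"
    and dense_P: "\<And>k u \<delta>. u \<in> F \<Longrightarrow> \<delta> > 0 \<Longrightarrow> \<exists>v\<in>F. E1norm m E (\<lambda>x. v x - u x) < \<delta> \<and> P k v"
    and f: "f \<in> F" and e: "e > 0"
  obtains u where "u \<in> F" "E1norm m E (\<lambda>x. u x - f x) < e" "\<And>k. P k u"
proof -
  let ?d = "\<lambda>u v. E1norm m E (\<lambda>x. u x - v x)"
  \<comment> \<open>The pair holds centre and radius. The condition is imposed on the ball of twice
    the radius, because the limit is known only to lie in the closed ball.\<close>
  have "\<exists>w. \<forall>k. (fst (w k) \<in> F \<and> 0 < snd (w k) \<and> (k = 0 \<longrightarrow> w k = (f, e / 2))) \<and>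
    (?d (fst (w (Suc k))) (fst (w k)) < snd (w k) / 2 \<and> snd (w (Suc k)) \<le> snd (w k) / 2 \<and>
     (\<forall>v\<in>F. ?d v (fst (w (Suc k))) < 2 * snd (w (Suc k)) \<longrightarrow> P k v))"
  proof (rule dependent_nat_choice)
    show "\<exists>w. fst w \<in> F \<and> 0 < snd w \<and> (0 = (0::nat) \<longrightarrow> w = (f, e / 2))"
      using f e by (intro exI[of _ "(f, e / 2)"]) simp
    fix w :: "('a \<Rightarrow> real) \<times> real" and k :: nat
    assume w: "fst w \<in> F \<and> 0 < snd w \<and> (k = 0 \<longrightarrow> w = (f, e / 2))"
    then obtain u where u: "u \<in> F" "?d u (fst w) < snd w / 2" "P k u"
      using dense_P[of "fst w" "snd w / 2" k] by auto
    obtain \<delta> where \<delta>: "\<delta> > 0" "\<And>v. v \<in> F \<Longrightarrow> ?d v u < \<delta> \<Longrightarrow> P k v" using open_P[OF u(1,3)] by blast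
    show "\<exists>w'. (fst w' \<in> F \<and> 0 < snd w' \<and> (Suc k = 0 \<longrightarrow> w' = (f, e / 2))) \<and>
      ?d (fst w') (fst w) < snd w / 2 \<and> snd w' \<le> snd w / 2 \<and> (\<forall>v\<in>F. ?d v (fst w') < 2 * snd w' \<longrightarrow> P k v)"
      using u \<delta> w by (intro exI[of _ "(u, min (snd w / 2) (\<delta> / 2))"]) auto
  qed
  then obtain w where w: "\<And>k. fst (w k) \<in> F" "\<And>k. 0 < snd (w k)" "w 0 = (f, e / 2)"
    "\<And>k. ?d (fst (w (Suc k))) (fst (w k)) < snd (w k) / 2" "\<And>k. snd (w (Suc k)) \<le> snd (w k) / 2"
    "\<And>k v. v \<in> F \<Longrightarrow> ?d v (fst (w (Suc k))) < 2 * snd (w (Suc k)) \<Longrightarrow> P k v" by blast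
  define u where "u k = fst (w k)" for k
  define r where "r k = snd (w k)" for k
  have u: "u k \<in> F" and r: "0 < r k" and step: "?d (u (Suc k)) (u k) < r k / 2" "r (Suc k) \<le> r k / 2" for k
    using w by (auto simp: u_def r_def)
  \<comment> \<open>Each step is shorter than half the radius, and the radius loses at least half,
    so the distance travelled is at most what the radius has lost.\<close>
  have near: "?d (u (k + j)) (u k) \<le> r k - r (k + j)" for k j
  proof (induction j)
    case 0 show ?case by (simp add: E1norm_zero)
  next
    case (Suc j)
    have "?d (u (Suc (k + j))) (u k) \<le> ?d (u (Suc (k + j))) (u (k + j)) + ?d (u (k + j)) (u k)"
      by (intro E1dist_triangle u)
    with Suc step[of "k + j"] show ?case by simp
  qed
  have near': "?d (u j) (u k) < r k" if "k \<le> j" for k j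
    using near[of k "j - k"] that r[of j] by simp
  have "r k \<le> e / 2 * (1 / 2) ^ k" for k
  proof (induction k)
    case 0 show ?case using w(3) by (simp add: r_def)
  next
    case (Suc k) then show ?case using step(2)[of k] by simp
  qed
  moreover have "(\<lambda>k. e / 2 * (1 / 2) ^ k) \<longlonglongrightarrow> 0"
    by (intro tendsto_mult_right_zero LIMSEQ_power_zero) simp
  ultimately have r0: "r \<longlonglongrightarrow> 0"
    by (rule LIMSEQ_zero_squeeze[OF less_imp_le[OF r]])
  obtain v where v: "v \<in> F" "(\<lambda>n. ?d (u n) v) \<longlonglongrightarrow> 0"
  proof (rule F_complete[OF u])
    fix \<epsilon> :: real assume \<epsilon>: "\<epsilon> > 0"
    then have "eventually (\<lambda>k. r k < \<epsilon> / 2) sequentially" by (intro order_tendstoD(2)[OF r0]) simp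
    then obtain k where k: "r k < \<epsilon> / 2" by (auto simp: eventually_sequentially)
    have "?d (u i) (u j) < \<epsilon>" if "i \<ge> k" "j \<ge> k" for i j
      using E1dist_triangle[OF u[of i] u[of k] u[of j]] near'[OF that(1)] near'[OF that(2)] E1dist_commute[OF u[of k] u[of j]] k
      by linarith
    then show "\<exists>N. \<forall>i\<ge>N. \<forall>j\<ge>N. ?d (u i) (u j) < \<epsilon>" by blast
  qed
  have lim: "?d v (u k) \<le> r k" for k
  proof (rule LIMSEQ_le_const)
    show "(\<lambda>n. ?d (u n) v + r k) \<longlonglongrightarrow> r k" using tendsto_add[OF v(2) tendsto_const, of "r k"] by simp
    have "?d v (u k) \<le> ?d (u n) v + r k" if "n \<ge> k" for n
      using E1dist_triangle[OF v(1) u[of n] u[of k]] E1dist_commute[OF v(1) u, of n] near'[OF that] by linarith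
    then show "\<exists>N. \<forall>n\<ge>N. ?d v (u k) \<le> ?d (u n) v + r k" by blast
  qed
  show thesis
  proof (rule that[OF v(1)])
    show "?d v f < e" using lim[of 0] w(3) e by (simp add: u_def r_def)
    show "P k v" for k using w(6)[OF v(1), of k] lim[of "Suc k"] r[of "Suc k"] by (simp add: u_def r_def)
  qed
qed

end

section \<open>Generic tuples\<close>

lemma invertible_mat_of_det:
  fixes A :: "'b::field mat"
  assumes A: "A \<in> carrier_mat n n" and d: "det A \<noteq> 0"
  shows "invertible_mat A"
proof -
  obtain B where B: "B \<in> carrier_mat n n" "B * A = 1\<^sub>m n" "A * B = 1\<^sub>m n"
    using det_non_zero_imp_unit[OF A d, of "()"] unfolding Units_def ring_mat_def by auto
  then show ?thesis using A unfolding invertible_mat_def inverts_mat_def by auto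
qed

lemma exists_small_term:
  fixes a :: "real \<Rightarrow> real"
  assumes "finite T" "card T = L" "L > 0" "(\<Sum>t\<in>T. a t) \<le> B"
  shows "\<exists>t\<in>T. a t \<le> B / L"
proof (rule ccontr)
  assume "\<not> ?thesis"
  then have "B / L < a t" if "t \<in> T" for t using that by force
  then have "(\<Sum>t\<in>T. B / L) < (\<Sum>t\<in>T. a t)"
    using assms by (intro sum_strict_mono) (auto simp: card_gt_0_iff)
  with assms show False by simp
qed

text \<open>\<open>N\<close> has the null sets of \<open>\<nu>\<close> but finite mass, so that
  exceptional sets can be compared in size.\<close>

locale reg_dform_medm = reg_dform_dom m F E \<nu>
  for m :: "'a::{metric_space, second_countable_topology} measure" and F E \<nu> +
  fixes N :: "'a measure"
  assumes medm: "medm m F E \<nu>"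
    and fin_N: "finite_measure N" and sets_N': "sets N = sets \<nu>"
    and AE_N: "(AE x in N. P x) \<longleftrightarrow> (AE x in \<nu>. P x)"
begin

lemma sets_N[measurable_cong]: "sets N = sets borel"
  using sets_N' sets_nu by simp

lemma space_N[simp]: "space N = UNIV"
  using sets_eq_imp_space_eq[OF sets_N] by simp

sublocale N: finite_measure N by (rule fin_N)

text \<open>The Gram determinant of the list for the energy density at \<open>x\<close>, almost
  everywhere a test of independence. Its value 1 for the empty list starts the induction.\<close>

definition dt :: "('a \<Rightarrow> real) list \<Rightarrow> 'a \<Rightarrow> real" where
  "dt fs x = gdet (length fs) (\<lambda>i j. e (fs ! i) (fs ! j) x)"

lemma dt_Nil[simp]: "dt [] x = 1"
  by (simp add: dt_def gdet_def)

lemma dt_single: "dt [f] x = e f f x"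
  by (simp add: dt_def gdet_expand)

lemma dt_meas[measurable]: "dt fs \<in> borel_measurable N"
  unfolding dt_def using e_meas by (intro gdet_measurable) (simp add: measurable_cong_sets[OF sets_N' refl])

lemma dt_set[measurable]: "{x. dt fs x \<noteq> 0} \<in> sets N"
proof -
  have "{x \<in> space N. dt fs x \<noteq> 0} \<in> sets N" by measurable
  then show ?thesis by simp
qed

lemma psd_list:
  assumes "set fs \<subseteq> F"
  shows "AE x in N. psd (length fs) (\<lambda>i j. e (fs ! i) (fs ! j) x)"
  unfolding AE_N using assms by (intro psd_AE) auto

text \<open>For each length, \<open>essential_union\<close> extracts countably many tuples from the
  uncountable family of all tuples; the sequence enumerates their entries. It comes from the measure
  of the independence sets, not from a dense subset of \<open>F\<close>.\<close>

lemma exists_universal_sequence: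
  obtains h :: "nat \<Rightarrow> 'a \<Rightarrow> real" where "\<And>k. h k \<in> F"
    "\<And>fs. set fs \<subseteq> F \<Longrightarrow> AE x in N. dt fs x \<noteq> 0 \<longrightarrow> (\<exists>ls. length ls = length fs \<and> dt (map h ls) x \<noteq> 0)"
proof -
  let ?I = "\<lambda>r. {fs. set fs \<subseteq> F \<and> length fs = r}"
  have "\<exists>J. countable J \<and> J \<subseteq> ?I r \<and> (\<forall>fs\<in>?I r. AE x in N. x \<in> {x. dt fs x \<noteq> 0} \<longrightarrow> (\<exists>gs\<in>J. x \<in> {x. dt gs x \<noteq> 0}))" for r
  proof (rule essential_union[where I="?I r" and S="\<lambda>fs. {x. dt fs x \<noteq> 0}", OF fin_N dt_set])
    fix J assume "countable J" "J \<subseteq> ?I r"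
      and "\<And>fs. fs \<in> ?I r \<Longrightarrow> AE x in N. x \<in> {x. dt fs x \<noteq> 0} \<longrightarrow> (\<exists>gs\<in>J. x \<in> {x. dt gs x \<noteq> 0})"
    then show ?thesis by (intro exI[of _ J] conjI ballI)
  qed
  then have "\<exists>J. \<forall>r. countable (J r) \<and> J r \<subseteq> ?I r \<and>
      (\<forall>fs\<in>?I r. AE x in N. x \<in> {x. dt fs x \<noteq> 0} \<longrightarrow> (\<exists>gs\<in>J r. x \<in> {x. dt gs x \<noteq> 0}))"
    by (intro choice allI)
  then obtain J where J': "\<forall>r. countable (J r) \<and> J r \<subseteq> ?I r \<and>
      (\<forall>fs\<in>?I r. AE x in N. x \<in> {x. dt fs x \<noteq> 0} \<longrightarrow> (\<exists>gs\<in>J r. x \<in> {x. dt gs x \<noteq> 0}))" ..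
  have J: "countable (J r)" "J r \<subseteq> ?I r"
    "fs \<in> ?I r \<Longrightarrow> AE x in N. x \<in> {x. dt fs x \<noteq> 0} \<longrightarrow> (\<exists>gs\<in>J r. x \<in> {x. dt gs x \<noteq> 0})" for r fs
    using J'[THEN spec, of r] by (simp_all only: simp_thms Ball_def)
  \<comment> \<open>The zero function guarantees that there is something to enumerate.\<close>
  define H where "H = insert (\<lambda>x. 0) (\<Union>r. \<Union>gs\<in>J r. set gs)"
  have "countable (\<Union>gs\<in>J r. set gs)" for r using J(1) by (rule countable_UN) (simp add: countable_finite)
  then have H: "countable H" "H \<noteq> {}" unfolding H_def by (auto intro: countable_UN[OF countableI_type])
  define h where "h = from_nat_into H"
  have rh: "range h = H" unfolding h_def using H by (intro range_from_nat_into)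
  show thesis
  proof (rule that[of h])
    have "H \<subseteq> F" using J(2) by (fastforce simp: H_def)
    then show "h k \<in> F" for k using rh by auto
    fix fs assume fs: "set fs \<subseteq> F"
    then have "AE x in N. x \<in> {x. dt fs x \<noteq> 0} \<longrightarrow> (\<exists>gs\<in>J (length fs). x \<in> {x. dt gs x \<noteq> 0})" by (intro J(3)) simp
    then show "AE x in N. dt fs x \<noteq> 0 \<longrightarrow> (\<exists>ls. length ls = length fs \<and> dt (map h ls) x \<noteq> 0)"
    proof eventually_elim
      case (elim x)
      show ?case
      proof
        assume "dt fs x \<noteq> 0"
        then obtain gs where gs: "gs \<in> J (length fs)" "dt gs x \<noteq> 0" using elim by auto
        have "set gs \<subseteq> range h" unfolding rh H_def using gs(1) by auto
        then obtain ls where "gs = map h ls" by (metis ex_map_conv subsetD rangeE)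
        moreover have "length gs = length fs" using J(2) gs(1) by blast
        ultimately show "\<exists>ls. length ls = length fs \<and> dt (map h ls) x \<noteq> 0" using gs(2) by auto
      qed
    qed
  qed
qed

end

locale universal_sequence = reg_dform_medm m F E \<nu> N
  for m :: "'a::{metric_space, second_countable_topology} measure" and F E \<nu> N +
  fixes h :: "nat \<Rightarrow> 'a \<Rightarrow> real"
  assumes h_F: "h k \<in> F"
    and h_univ: "set fs \<subseteq> F \<Longrightarrow> AE x in N. dt fs x \<noteq> 0 \<longrightarrow> (\<exists>ls. length ls = length fs \<and> dt (map h ls) x \<noteq> 0)"
begin

text \<open>\<open>B r\<close> consists of the points at which more than \<open>r\<close> of the functions \<open>h k\<close> are linearly independent for the
  energy density; \<open>Bm r K\<close> uses only the first \<open>K\<close> of them.\<close>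

definition B :: "nat \<Rightarrow> 'a set" where
  "B r = {x. \<exists>ls. r < length ls \<and> dt (map h ls) x \<noteq> 0}"

definition Bm :: "nat \<Rightarrow> nat \<Rightarrow> 'a set" where
  "Bm r K = {x. \<exists>ls. r < length ls \<and> set ls \<subseteq> {..<K} \<and> dt (map h ls) x \<noteq> 0}"

lemma Bm_sets[measurable]: "Bm r K \<in> sets N"
proof -
  have "Bm r K = (\<Union>ls\<in>{ls. r < length ls \<and> set ls \<subseteq> {..<K}}. {x. dt (map h ls) x \<noteq> 0})"
    by (auto simp: Bm_def)
  then show ?thesis by (auto intro!: sets.countable_UN')
qed

lemma B_Bm: "B r = (\<Union>K. Bm r K)"
proof -
  have "\<exists>K. set ls \<subseteq> {..<K}" for ls :: "nat list"
    by (rule exI[of _ "Suc (Max (set ls))"]) (auto simp: less_Suc_eq_le)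
  note fin = this
  show ?thesis
  proof
    show "B r \<subseteq> (\<Union>K. Bm r K)"
    proof
      fix x assume "x \<in> B r"
      then obtain ls where ls: "r < length ls" "dt (map h ls) x \<noteq> 0" unfolding B_def by blast
      obtain K where "set ls \<subseteq> {..<K}" using fin by blast
      with ls have "x \<in> Bm r K" unfolding Bm_def by blast
      then show "x \<in> (\<Union>K. Bm r K)" by blast
    qed
    show "(\<Union>K. Bm r K) \<subseteq> B r" unfolding B_def Bm_def by blast
  qed
qed

lemma Bm_mono: "incseq (Bm r)"
proof (rule monoI)
  fix K L :: nat assume "K \<le> L"
  then have "{..<K} \<subseteq> {..<L}" by auto
  note sub = this
  show "Bm r K \<subseteq> Bm r L"
  proof
    fix x assume "x \<in> Bm r K"
    then obtain ls where ls: "r < length ls" "set ls \<subseteq> {..<K}" "dt (map h ls) x \<noteq> 0"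
      unfolding Bm_def by blast
    have "set ls \<subseteq> {..<L}" using ls(2) sub by (rule order_trans)
    with ls show "x \<in> Bm r L" by (auto simp: Bm_def)
  qed
qed

lemma B_sets[measurable]: "B r \<in> sets N"
  unfolding B_Bm by (intro sets.countable_UN) auto

lemma B_mono: "r \<le> s \<Longrightarrow> B s \<subseteq> B r"
  unfolding B_def by (intro Collect_mono impI) (elim exE conjE, intro exI conjI, rule le_less_trans)

lemma B_approx:
  assumes "\<eta> > 0"
  shows "\<exists>K0. \<forall>K\<ge>K0. measure N (B r - Bm r K) < \<eta>"
proof -
  have "(\<lambda>K. measure N (Bm r K)) \<longlonglongrightarrow> measure N (B r)"
    unfolding B_Bm by (intro N.finite_Lim_measure_incseq Bm_mono) auto
  from LIMSEQ_D[OF this assms] obtain K0 where K0: "\<And>K. K \<ge> K0 \<Longrightarrow> \<bar>measure N (Bm r K) - measure N (B r)\<bar> < \<eta>" by auto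
  have "measure N (B r - Bm r K) = measure N (B r) - measure N (Bm r K)" for K
    by (intro N.finite_measure_Diff) (auto simp: B_Bm)
  then show ?thesis using K0 by (intro exI[of _ K0]) (auto simp: abs_less_iff)
qed

text \<open>Otherwise the restriction of \<open>N\<close> to \<open>B 0\<close> would be energy-dominant, contradicting the minimality of \<open>\<nu>\<close>.\<close>

lemma B0_full: "AE x in N. x \<in> B 0"
proof -
  let ?\<nu> = "density N (indicator (B 0))"
  \<comment> \<open>Universality for lists of one element: a nonzero energy density forces some
    \<open>h k\<close> to have one too.\<close>
  have nz: "AE x in \<nu>. x \<notin> B 0 \<longrightarrow> z f x = 0" if f: "f \<in> F" for f
  proof -
    have "AE x in \<nu>. dt [f] x \<noteq> 0 \<longrightarrow> (\<exists>ls. length ls = length [f] \<and> dt (map h ls) x \<noteq> 0)"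
      using h_univ[of "[f]"] f by (simp add: AE_N)
    with e_self[OF f] show ?thesis
    proof eventually_elim
      case (elim x)
      have "x \<in> B 0" if nz: "z f x \<noteq> 0"
      proof -
        obtain ls where ls: "length ls = Suc 0" "dt (map h ls) x \<noteq> 0" using elim nz by (auto simp: dt_single)
        then have "0 < length ls" by simp
        with ls(2) show ?thesis unfolding B_def by blast
      qed
      then show ?case by blast
    qed
  qed
  have "energy_dominant m F E ?\<nu>"
    unfolding energy_dominant_def
  proof (intro conjI ballI)
    have "finite_measure ?\<nu>"
      by (rule finite_measureI) (simp add: emeasure_density N.emeasure_eq_measure)
    then show "sigma_finite_measure ?\<nu>" by (simp add: finite_measure_def)
    show "sets ?\<nu> = sets borel" by (simp add: sets_N)
    fix f assume f: "f \<in> F"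
    show "absolutely_continuous ?\<nu> (em f)"
      unfolding absolutely_continuous_def
    proof
      fix A assume A: "A \<in> null_sets ?\<nu>"
      then have A': "A \<in> sets N" by auto
      have "AE x in ?\<nu>. x \<notin> A" using A by (rule AE_not_in)
      then have "AE x in N. x \<in> B 0 \<longrightarrow> x \<notin> A"
        by (subst (asm) AE_density) (auto simp: indicator_def)
      then have "AE x in \<nu>. x \<in> B 0 \<longrightarrow> x \<notin> A" by (simp add: AE_N)
      with nz[OF f] have "AE x in \<nu>. ennreal (z f x) * indicator A x = 0"
        by eventually_elim (auto simp: indicator_def)
      then have "(\<integral>\<^sup>+x. ennreal (z f x) * indicator A x \<partial>\<nu>) = 0"
        using A' by (subst nn_integral_0_iff_AE) (auto simp: sets_N')
      moreover have "emeasure (em f) A = (\<integral>\<^sup>+x. ennreal (z f x) * indicator A x \<partial>\<nu>)"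
        using emeasure_density[of "\<lambda>x. ennreal (z f x)" \<nu> A] em_density[OF f] A' by (simp add: sets_N')
      ultimately show "A \<in> null_sets (em f)"
        using A' sets_em[OF f] sets_N by (intro null_setsI) auto
    qed
  qed
  then have "absolutely_continuous ?\<nu> \<nu>" using medm by (simp add: medm_def)
  moreover have "- B 0 \<in> null_sets ?\<nu>"
  proof (rule null_setsI)
    have C: "- B 0 \<in> sets N" using sets.compl_sets[OF B_sets[of 0]] by (simp add: Compl_eq_Diff_UNIV)
    then show "- B 0 \<in> sets ?\<nu>" by simp
    have "(\<integral>\<^sup>+x. indicator (B 0) x * indicator (- B 0) x \<partial>N) = (\<integral>\<^sup>+x. 0 \<partial>N)"
      by (intro nn_integral_cong) (auto simp: indicator_def)
    then show "emeasure ?\<nu> (- B 0) = 0" using C by (subst emeasure_density) auto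
  qed
  ultimately have "- B 0 \<in> null_sets \<nu>" unfolding absolutely_continuous_def by blast
  from AE_not_in[OF this] have "AE x in \<nu>. x \<in> B 0" by eventually_elim auto
  then show ?thesis by (simp add: AE_N)
qed

text \<open>This bound is what the minimality of \<open>p\<close> is compared with. A matrix of rank
  \<open>r\<close> has an independent subfamily of size \<open>r\<close>, hence by universality so
  has \<open>h\<close>, which puts the point into \<open>B s\<close> for all \<open>s < r\<close>.
  Counting below \<open>n\<close> loses nothing, as ranks are at most \<open>n\<close> almost
  everywhere.\<close>

lemma rank_bound_B:
  assumes p: "rank_bound m F E \<nu> p" and pn: "AE x in \<nu>. p x \<le> enat n"
  shows "rank_bound m F E \<nu> (\<lambda>x. enat (card {r. r < n \<and> x \<in> B r}))"
  unfolding rank_bound_def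
proof (intro conjI allI impI)
  let ?q = "\<lambda>x. enat (card {r. r < n \<and> x \<in> B r})"
  have "?q \<in> measurable \<nu> (count_space UNIV)"
  proof (subst measurable_count_space_eq2_countable, safe)
    fix a :: enat
    define s where "s x = (\<Sum>r<n. indicator (B r) x :: real)" for x
    have s: "s x = real (card {r. r < n \<and> x \<in> B r})" for x
    proof -
      have "s x = (\<Sum>r\<in>{r. r < n \<and> x \<in> B r}. 1)"
        unfolding s_def by (rule sum.mono_neutral_cong_right) (auto simp: indicator_def)
      then show ?thesis by simp
    qed
    have "s \<in> borel_measurable N" unfolding s_def by measurable
    then have "s \<in> borel_measurable \<nu>" by (simp add: measurable_cong_sets[OF sets_N' refl])
    then have 1: "{x \<in> space \<nu>. s x = real k} \<in> sets \<nu>" for k by measurable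
    show "?q -` {a} \<inter> space \<nu> \<in> sets \<nu>"
    proof (cases a)
      case (enat k)
      have "?q -` {a} \<inter> space \<nu> = {x \<in> space \<nu>. s x = real k}" unfolding s enat by auto
      then show ?thesis using 1 by simp
    next
      case infinity
      then have "?q -` {a} \<inter> space \<nu> = {}" by auto
      then show ?thesis by simp
    qed
  qed auto
  then show "?q \<in> measurable (completion \<nu>) (count_space UNIV)" by (rule measurable_completion)
  fix M :: nat and fs :: "nat \<Rightarrow> 'a \<Rightarrow> real" assume fs: "\<forall>i<M. fs i \<in> F"
  have "AE x in \<nu>. enat (vec_space.rank M (energy_matrix m F E \<nu> M fs x)) \<le> p x"
    using p fs unfolding rank_bound_def by blast
  moreover have "AE x in \<nu>. psd M (\<lambda>i j. e (fs i) (fs j) x)" using fs by (intro psd_AE) auto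
  moreover have "AE x in \<nu>. \<forall>js\<in>{js. set js \<subseteq> {..<M}}. dt (map fs js) x \<noteq> 0 \<longrightarrow>
     (\<exists>ls. length ls = length js \<and> dt (map h ls) x \<noteq> 0)"
  proof (subst AE_ball_countable)
    show "\<forall>js\<in>{js. set js \<subseteq> {..<M}}. AE x in \<nu>. dt (map fs js) x \<noteq> 0 \<longrightarrow>
     (\<exists>ls. length ls = length js \<and> dt (map h ls) x \<noteq> 0)"
    proof safe
      fix js assume "set js \<subseteq> {..<M}"
      then have "set (map fs js) \<subseteq> F" using fs by auto
      from h_univ[OF this] show "AE x in \<nu>. dt (map fs js) x \<noteq> 0 \<longrightarrow>
     (\<exists>ls. length ls = length js \<and> dt (map h ls) x \<noteq> 0)" by (simp add: AE_N)
    qed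
  qed auto
  ultimately show "AE x in \<nu>. enat (vec_space.rank M (energy_matrix m F E \<nu> M fs x)) \<le> ?q x"
    using pn
  proof eventually_elim
    case (elim x)
    define r where "r = vec_space.rank M (energy_matrix m F E \<nu> M fs x)"
    have "enat r \<le> enat n" using elim(1,4) unfolding r_def by (rule order_trans)
    then have rn: "r \<le> n" by simp
    obtain ls where ls: "length ls = r" "set ls \<subseteq> {..<M}" "gdet r (\<lambda>k l. e (fs (ls ! k)) (fs (ls ! l)) x) \<noteq> 0"
      using psd_principal_minor[OF elim(2) r_def[unfolded energy_matrix_def]] by metis
    have "dt (map fs ls) x = gdet r (\<lambda>k l. e (fs (ls ! k)) (fs (ls ! l)) x)"
      unfolding dt_def length_map ls(1) by (intro gdet_cong) (auto simp: ls(1))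
    then obtain ls' where "length ls' = r" "dt (map h ls') x \<noteq> 0" using elim(3) ls by auto
    then have "{..<r} \<subseteq> {s. s < n \<and> x \<in> B s}" using rn by (auto simp: B_def)
    then have "card {..<r} \<le> card {s. s < n \<and> x \<in> B s}" by (intro card_mono) auto
    then show ?case unfolding r_def by simp
  qed
qed

text \<open>The points that admit one more independent direction which \<open>u\<close> fails to
  supply. For the empty list these are, up to a null set, the points of \<open>B 0\<close> where the
  energy density of \<open>u\<close> vanishes.\<close>

definition bad :: "('a \<Rightarrow> real) list \<Rightarrow> ('a \<Rightarrow> real) \<Rightarrow> 'a set" where
  "bad gl u = {x \<in> B (length gl). dt (gl @ [u]) x = 0}"

lemma bad_sets[measurable]: "bad gl u \<in> sets N"
proof -
  have "bad gl u = B (length gl) - {x. dt (gl @ [u]) x \<noteq> 0}" by (auto simp: bad_def)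
  then show ?thesis by simp
qed

text \<open>Otherwise some sequence converges rapidly to \<open>u\<close> with bad sets of mass at
  least \<open>\<eta>\<close>. The determinants converge along it almost everywhere, so the limit
  superior of these sets, still of mass at least \<open>\<eta>\<close>, lies in
  \<open>bad gl u\<close> up to a null set.\<close>

lemma bad_open:
  assumes gl: "set gl \<subseteq> F" and u: "u \<in> F" and b: "measure N (bad gl u) < \<eta>"
  shows "\<exists>\<delta>>0. \<forall>v\<in>F. E1norm m E (\<lambda>x. v x - u x) < \<delta> \<longrightarrow> measure N (bad gl v) < \<eta>"
proof (rule ccontr)
  assume contra: "\<not> ?thesis"
  \<comment> \<open>The geometric rate makes the energies of the differences summable, as almost
    everywhere convergence of the densities requires.\<close>
  have "\<exists>v\<in>F. E1norm m E (\<lambda>x. v x - u x) < (1/2) ^ j \<and> \<eta> \<le> measure N (bad gl v)" for j :: nat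
  proof -
    have "(1/2::real) ^ j > 0" by simp
    with contra show ?thesis by (meson not_le)
  qed
  then obtain v where v: "\<And>j. v j \<in> F" "\<And>j. E1norm m E (\<lambda>x. v j x - u x) < (1/2) ^ j"
    "\<And>j. \<eta> \<le> measure N (bad gl (v j))" by metis
  have d: "(\<lambda>x. v j x - u x) \<in> F" for j using v u by (intro F_diff)
  have s: "summable (\<lambda>j. E (\<lambda>x. v j x - u x) (\<lambda>x. v j x - u x))"
  proof (rule summable_comparison_test)
    have "E (\<lambda>x. v j x - u x) (\<lambda>x. v j x - u x) \<le> (1/4) ^ j" for j
    proof -
      have "E (\<lambda>x. v j x - u x) (\<lambda>x. v j x - u x) \<le> (E1norm m E (\<lambda>x. v j x - u x))\<^sup>2"
        unfolding E1norm_sq[OF d] using ip_nonneg[of "\<lambda>x. v j x - u x"] by linarith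
      also have "\<dots> \<le> ((1/2) ^ j)\<^sup>2"
        using v(2)[of j] E1norm_nonneg[OF d] by (intro power_mono) auto
      also have "\<dots> = (1/4) ^ j" by (simp add: power2_eq_square power_mult_distrib[symmetric])
      finally show ?thesis .
    qed
    then show "\<exists>K. \<forall>j\<ge>K. norm (E (\<lambda>x. v j x - u x) (\<lambda>x. v j x - u x)) \<le> (1/4) ^ j"
      using E_nonneg[OF d] by auto
    show "summable (\<lambda>j. (1/4::real) ^ j)" by (rule summable_geometric) simp
  qed
  have "AE x in \<nu>. \<forall>g\<in>set gl. (\<lambda>j. e (v j) g x) \<longlonglongrightarrow> e u g x"
    using gl by (intro AE_finite_allI e_tendsto(1)[OF v(1) u _ s]) auto
  moreover have "AE x in \<nu>. \<forall>j. e (v j) (v j) x = z (v j) x"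
    by (subst AE_all_countable) (intro allI e_self v)
  ultimately have "AE x in \<nu>. (\<lambda>j. dt (gl @ [v j]) x) \<longlonglongrightarrow> dt (gl @ [u]) x"
    using e_self[OF u] e_tendsto(2)[OF v(1) u u s]
  proof eventually_elim
    case (elim x)
    have "(\<lambda>j. e ((gl @ [v j]) ! k) ((gl @ [v j]) ! l) x) \<longlonglongrightarrow> e ((gl @ [u]) ! k) ((gl @ [u]) ! l) x"
      if "k < Suc (length gl)" "l < Suc (length gl)" for k l
      using that elim e_sym[of "gl ! k" _ x]
      by (cases "k < length gl"; cases "l < length gl") (auto simp: nth_append)
    then show ?case unfolding dt_def by (simp, intro gdet_tendsto) simp
  qed
  then have lim: "AE x in N. (\<lambda>j. dt (gl @ [v j]) x) \<longlonglongrightarrow> dt (gl @ [u]) x" by (simp add: AE_N)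
  define W where "W k = (\<Union>j\<in>{k..}. bad gl (v j))" for k
  have W: "W k \<in> sets N" for k unfolding W_def by (intro sets.countable_UN') auto
  have "decseq W" unfolding W_def decseq_def by (force)
  then have "(\<lambda>k. measure N (W k)) \<longlonglongrightarrow> measure N (\<Inter>k. W k)"
    using W by (intro N.finite_Lim_measure_decseq) auto
  moreover have "\<eta> \<le> measure N (W k)" for k
  proof -
    have "measure N (bad gl (v k)) \<le> measure N (W k)"
      by (intro N.finite_measure_mono W) (auto simp: W_def)
    with v(3)[of k] show ?thesis by simp
  qed
  ultimately have "\<eta> \<le> measure N (\<Inter>k. W k)" by (intro LIMSEQ_le_const) auto
  also have "measure N (\<Inter>k. W k) \<le> measure N (bad gl u)"
  proof (rule N.finite_measure_mono_AE)
    show "AE x in N. x \<in> (\<Inter>k. W k) \<longrightarrow> x \<in> bad gl u"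
      using lim
    proof eventually_elim
      case (elim x)
      show ?case
      proof
        assume x: "x \<in> (\<Inter>k. W k)"
        then have xB: "x \<in> B (length gl)" by (auto simp: W_def bad_def)
        have "dt (gl @ [u]) x = 0"
        proof (rule ccontr)
          assume "dt (gl @ [u]) x \<noteq> 0"
          from tendsto_imp_eventually_ne[OF elim this]
          obtain k where "\<And>j. j \<ge> k \<Longrightarrow> dt (gl @ [v j]) x \<noteq> 0" by (auto simp: eventually_sequentially)
          moreover have "x \<in> W k" using x by blast
          ultimately show False by (auto simp: W_def bad_def)
        qed
        with xB show "x \<in> bad gl u" by (simp add: bad_def)
      qed
    qed
  qed auto
  finally show False using b by simp
qed

text \<open>The exponents start at 1, leaving the power 0 to \<open>u\<close>; this matches the
  coordinates of \<open>curve\<close>.\<close>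

definition moment :: "nat \<Rightarrow> ('a \<Rightarrow> real) \<Rightarrow> real \<Rightarrow> 'a \<Rightarrow> real" where
  "moment K u t x = u x + (\<Sum>k<K. t ^ Suc k * h k x)"

lemma moment_F: "u \<in> F \<Longrightarrow> moment K u t \<in> F"
  unfolding moment_def by (intro F_add F_sum F_scale h_F)

lemma moment_dist:
  assumes "u \<in> F" "0 \<le> t" "t \<le> 1"
  shows "E1norm m E (\<lambda>x. moment K u t x - u x) \<le> t * (\<Sum>k<K. E1norm m E (h k))"
proof -
  have "E1norm m E (\<lambda>x. moment K u t x - u x) = E1norm m E (\<lambda>x. \<Sum>k<K. t ^ Suc k * h k x)"
    by (simp add: moment_def)
  also have "\<dots> \<le> (\<Sum>k<K. E1norm m E (\<lambda>x. t ^ Suc k * h k x))"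
    by (intro E1norm_sum_le F_scale h_F)
  also have "\<dots> \<le> (\<Sum>k<K. t * E1norm m E (h k))"
  proof (rule sum_mono)
    fix k
    have "t ^ Suc k \<le> t" using assms(2,3) power_le_one[of t k] by (simp add: mult_left_le)
    then show "E1norm m E (\<lambda>x. t ^ Suc k * h k x) \<le> t * E1norm m E (h k)"
      unfolding E1norm_scale[OF h_F] using assms(2) E1norm_nonneg[OF h_F] by (intro mult_right_mono) auto
  qed
  finally show ?thesis by (simp add: sum_distrib_left)
qed

text \<open>Almost every point lies in at most \<open>K\<close> of the sets, because it can only do so for the roots \<open>t\<close> of a
  nonzero polynomial of degree \<open>K\<close>.\<close>

lemma sum_bad_le:
  assumes gl: "set gl \<subseteq> F" and u: "u \<in> F" and T: "finite T"
    and good: "AE x in N. x \<in> B (length gl) \<longrightarrow> dt gl x \<noteq> 0"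
  shows "(\<Sum>t\<in>T. measure N (bad gl (moment K u t) \<inter> Bm (length gl) K)) \<le> real K * measure N UNIV"
proof -
  define r where "r = length gl"
  \<comment> \<open>The positions below \<open>r\<close> hold \<open>gl\<close>, position
    \<open>r\<close> holds \<open>u\<close>, and \<open>r + 1 + k\<close> holds \<open>h k\<close>;
    hence \<open>curve\<close> is used with \<open>i = r\<close>.\<close>
  define fam where "fam = gl @ [u] @ map h [0..<K]"
  have len: "length fam = Suc (r + K)" by (simp add: fam_def r_def)
  have fam_F: "set fam \<subseteq> F" using gl u h_F by (auto simp: fam_def)
  let ?M = "Suc (r + K)"
  let ?A = "\<lambda>x a b. e (fam ! a) (fam ! b) x"
  have famF: "fam ! a \<in> F" if "a < ?M" for a using fam_F len that by auto
  have fam_gl: "fam ! j = gl ! j" if "j < r" for j using that by (simp add: fam_def r_def nth_append)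
  have fam_u: "fam ! r = u" by (simp add: fam_def r_def nth_append)
  have fam_h: "fam ! (Suc r + k) = h k" if "k < K" for k using that by (simp add: fam_def r_def nth_append)
  have mom: "(\<Sum>a<?M. curve r r t r a * (fam ! a) x) = moment K u t x" for t x
  proof -
    have "(\<Sum>a<?M. curve r r t r a * (fam ! a) x) = (\<Sum>a\<in>{r..<?M}. t ^ (a - r) * (fam ! a) x)"
      by (rule sum.mono_neutral_cong_right) (auto simp: curve_def)
    also have "\<dots> = (\<Sum>k<Suc K. t ^ k * (fam ! (r + k)) x)"
      by (rule sum.reindex_bij_witness[of _ "\<lambda>k. r + k" "\<lambda>a. a - r"]) auto
    also have "\<dots> = moment K u t x"
      unfolding sum.lessThan_Suc_shift moment_def using fam_u fam_h by simp
    finally show ?thesis .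
  qed
  have gls: "(\<Sum>a<?M. curve r r t j a * (fam ! a) x) = (gl ! j) x" if "j < r" for j t x
  proof -
    have "(\<Sum>a<?M. curve r r t j a * (fam ! a) x) = (\<Sum>a<?M. if a = j then (fam ! a) x else 0)"
      using that by (intro sum.cong) (auto simp: curve_def)
    then show ?thesis using that fam_gl by simp
  qed
  have vec: "(gl @ [moment K u t]) ! j = (\<lambda>x. \<Sum>a<?M. curve r r t j a * (fam ! a) x)" if "j < Suc r" for j t
    using that mom[of t] gls[of j t] by (cases "j < r") (auto simp: nth_append r_def less_Suc_eq)
  have "AE x in \<nu>. dt (gl @ [moment K u t]) x = gdet (Suc r) (curve_gram ?M (?A x) r r t)" for t
  proof -
    have "AE x in \<nu>. \<forall>j\<in>{..<Suc r}. \<forall>l\<in>{..<Suc r}. e ((gl @ [moment K u t]) ! j) ((gl @ [moment K u t]) ! l) x =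
        curve_gram ?M (?A x) r r t j l"
    proof (intro AE_finite_allI finite_lessThan)
      fix j l assume "j \<in> {..<Suc r}" "l \<in> {..<Suc r}"
      then show "AE x in \<nu>. e ((gl @ [moment K u t]) ! j) ((gl @ [moment K u t]) ! l) x =
        curve_gram ?M (?A x) r r t j l"
        unfolding curve_gram_def using e_sum2[of ?M "\<lambda>a. fam ! a" "curve r r t j" "curve r r t l"] famF
        by (simp only: vec lessThan_iff)
    qed
    then show ?thesis
    proof eventually_elim
      case (elim x)
      then show ?case unfolding dt_def r_def by (simp, intro gdet_cong) auto
    qed
  qed
  then have "AE x in N. \<forall>t\<in>T. dt (gl @ [moment K u t]) x = gdet (Suc r) (curve_gram ?M (?A x) r r t)"
    using T by (simp add: AE_N AE_finite_all)
  moreover have "AE x in N. psd ?M (?A x)" using psd_list[OF fam_F] by (simp add: len)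
  \<comment> \<open>A single null set suffices since \<open>T\<close> is finite; integrating this
    count bounds the sum of the measures.\<close>
  ultimately have le: "AE x in N. (\<Sum>t\<in>T. indicator (bad gl (moment K u t) \<inter> Bm r K) x) \<le> real K"
    using good
  proof eventually_elim
    case (elim x)
    show ?case
    proof (cases "x \<in> Bm r K")
      case False then show ?thesis by simp
    next
      case True
      then obtain ls where ls: "r < length ls" "set ls \<subseteq> {..<K}" "dt (map h ls) x \<noteq> 0" by (auto simp: Bm_def)
      have "x \<in> B r" using True by (auto simp: B_Bm)
      then have G: "gdet r (?A x) \<noteq> 0"
        using elim(3) fam_gl gdet_cong[of r "?A x" "\<lambda>i j. e (gl ! i) (gl ! j) x"] by (simp add: dt_def r_def)
      define js where "js k = Suc r + ls ! k" for k
      have lsK: "ls ! k < K" if "k < length ls" for k using ls(2) that nth_mem by blast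
      have "gdet (length ls) (\<lambda>k l. ?A x (js k) (js l)) = dt (map h ls) x"
        unfolding dt_def length_map by (rule gdet_cong) (simp add: js_def fam_h[OF lsK, simplified])
      then have P: "gdet (length ls) (\<lambda>k l. ?A x (js k) (js l)) \<noteq> 0" using ls(3) by simp
      have bnd: "r < js k \<and> js k \<le> r + K" if "k < length ls" for k using lsK[OF that] by (simp add: js_def)
      note sing = curve_gram_singular[OF elim(2) order_refl G ls(1) bnd P]
      have "(\<Sum>t\<in>T. indicator (bad gl (moment K u t) \<inter> Bm r K) x) = real (card {t\<in>T. x \<in> bad gl (moment K u t)})"
      proof -
        have "(\<Sum>t\<in>T. indicator (bad gl (moment K u t) \<inter> Bm r K) x) = (\<Sum>t\<in>{t\<in>T. x \<in> bad gl (moment K u t)}. 1::real)"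
          using T True by (intro sum.mono_neutral_cong_right) (auto simp: indicator_def)
        then show ?thesis by simp
      qed
      also have "card {t\<in>T. x \<in> bad gl (moment K u t)} \<le> card {t. gdet (Suc r) (curve_gram ?M (?A x) r r t) = 0}"
        using elim(1) by (intro card_mono sing(1)) (auto simp: bad_def)
      then have "real (card {t\<in>T. x \<in> bad gl (moment K u t)}) \<le> real K" using sing(2) by simp
      finally show ?thesis .
    qed
  qed
  have "(\<Sum>t\<in>T. measure N (bad gl (moment K u t) \<inter> Bm r K)) =
     integral\<^sup>L N (\<lambda>x. \<Sum>t\<in>T. indicator (bad gl (moment K u t) \<inter> Bm r K) x)"
    by (subst Bochner_Integration.integral_sum) (auto simp: less_top[symmetric])
  also have "\<dots> \<le> integral\<^sup>L N (\<lambda>x. real K)"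
    using le by (intro integral_mono_AE Bochner_Integration.integrable_sum integrable_real_indicator) (auto simp: less_top[symmetric])
  also have "\<dots> = real K * measure N UNIV" by (simp add: mult.commute)
  finally show ?thesis by (simp add: r_def)
qed

text \<open>The order of choices matters: \<open>K\<close> leaves little of the sets
  \<open>B\<close> uncovered, \<open>t0\<close> keeps the curve close to \<open>u\<close>, and only
  then is the number \<open>L\<close> of parameters made large against a bound that depends on
  \<open>K\<close> but not on \<open>L\<close>.\<close>

lemma bad_dense:
  assumes gl: "set gl \<subseteq> F" and u: "u \<in> F" and good: "AE x in N. x \<in> B (length gl) \<longrightarrow> dt gl x \<noteq> 0"
    and \<delta>: "\<delta> > 0" and \<eta>: "\<eta> > 0"
  shows "\<exists>v\<in>F. E1norm m E (\<lambda>x. v x - u x) < \<delta> \<and> measure N (bad gl v) < \<eta> \<and> measure N (bad [] v) < \<eta>"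
proof -
  let ?r = "length gl"
  have \<eta>2: "\<eta> / 2 > 0" using \<eta> by simp
  obtain K1 where K1: "\<And>K. K \<ge> K1 \<Longrightarrow> measure N (B ?r - Bm ?r K) < \<eta> / 2" using B_approx[OF \<eta>2] by blast
  obtain K2 where K2: "\<And>K. K \<ge> K2 \<Longrightarrow> measure N (B 0 - Bm 0 K) < \<eta> / 2" using B_approx[OF \<eta>2] by blast
  define K where "K = max K1 K2"
  define H where "H = (\<Sum>k<K. E1norm m E (h k))"
  have H: "0 \<le> H" unfolding H_def using E1norm_nonneg[OF h_F] by (intro sum_nonneg)
  define t0 where "t0 = min 1 (\<delta> / (2 * (H + 1)))"
  have t0: "0 < t0" "t0 \<le> 1" "t0 * H < \<delta>"
  proof -
    show "0 < t0" "t0 \<le> 1" using \<delta> H by (auto simp: t0_def)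
    have "t0 * H \<le> \<delta> / (2 * (H + 1)) * (H + 1)" using H \<delta> by (intro mult_mono) (auto simp: t0_def)
    also have "\<dots> = \<delta> / 2" using H by (simp add: field_simps)
    finally show "t0 * H < \<delta>" using \<delta> by simp
  qed
  \<comment> \<open>The factor 2 accounts for \<open>gl\<close> and the empty list, for which one
    common parameter is sought.\<close>
  define C where "C = 2 * (real K * measure N UNIV)"
  obtain L0 where L0: "C / (\<eta> / 2) < real L0" using reals_Archimedean2 by blast
  define L where "L = Suc L0"
  have "C / (\<eta> / 2) < real L" using L0 by (simp add: L_def)
  then have L: "C / real L < \<eta> / 2" "L > 0" using \<eta> by (auto simp: L_def field_simps)
  define T where "T = (\<lambda>k. t0 / real (Suc k)) ` {..<L}"
  have "inj_on (\<lambda>k. t0 / real (Suc k)) {..<L}" using t0(1) by (auto simp: inj_on_def field_simps)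
  then have T: "finite T" "card T = L" by (auto simp: T_def card_image)
  have Tt: "0 \<le> t \<and> t \<le> t0" if "t \<in> T" for t
    using that t0(1) by (auto simp: T_def field_simps mult_left_le)
  let ?a = "\<lambda>t. measure N (bad gl (moment K u t) \<inter> Bm ?r K) + measure N (bad [] (moment K u t) \<inter> Bm 0 K)"
  have "(\<Sum>t\<in>T. ?a t) \<le> C"
    using sum_bad_le[OF gl u T(1) good, of K] sum_bad_le[of "[]", OF _ u T(1), of K]
    by (simp add: sum.distrib C_def)
  then obtain t where t: "t \<in> T" "?a t \<le> C / L" using exists_small_term[OF T L(2)] by blast
  let ?v = "moment K u t"
  have ba: "measure N (bad g ?v) < \<eta>" if "measure N (bad g ?v \<inter> Bm (length g) K) < \<eta> / 2"
    "measure N (B (length g) - Bm (length g) K) < \<eta> / 2" for g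
  proof -
    have "measure N (bad g ?v) \<le> measure N ((bad g ?v \<inter> Bm (length g) K) \<union> (B (length g) - Bm (length g) K))"
      by (intro N.finite_measure_mono) (auto simp: bad_def)
    also have "\<dots> \<le> measure N (bad g ?v \<inter> Bm (length g) K) + measure N (B (length g) - Bm (length g) K)"
      by (rule measure_Un_le) auto
    finally show ?thesis using that by simp
  qed
  have a2: "?a t < \<eta> / 2" using t(2) L(1) by linarith
  have a21: "measure N (bad gl ?v \<inter> Bm ?r K) < \<eta> / 2"
    using a2 measure_nonneg[of N "bad [] ?v \<inter> Bm 0 K"] by linarith
  have a22: "measure N (bad [] ?v \<inter> Bm 0 K) < \<eta> / 2"
    using a2 measure_nonneg[of N "bad gl ?v \<inter> Bm ?r K"] by linarith
  have "measure N (bad gl ?v) < \<eta>" by (rule ba[OF a21 K1]) (simp add: K_def)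
  moreover have "measure N (bad [] ?v) < \<eta>" using ba[of "[]"] a22 K2[of K] by (simp add: K_def)
  moreover have "E1norm m E (\<lambda>x. ?v x - u x) < \<delta>"
  proof -
    have "E1norm m E (\<lambda>x. ?v x - u x) \<le> t * H"
      unfolding H_def using Tt[OF t(1)] t0(2) by (intro moment_dist[OF u]) auto
    also have "\<dots> \<le> t0 * H" using Tt[OF t(1)] H by (intro mult_right_mono) auto
    finally show ?thesis using t0(3) by simp
  qed
  ultimately show ?thesis using moment_F[OF u] by blast
qed

text \<open>Both requirements enter one sequence of open dense conditions, so that a single function
  meets them together. The last conclusion uses that \<open>B 0\<close> has full measure.\<close>

lemma extend_generic:
  assumes gl: "set gl \<subseteq> F" and f: "f \<in> F" and good: "AE x in N. x \<in> B (length gl) \<longrightarrow> dt gl x \<noteq> 0" and \<epsilon>: "\<epsilon> > 0"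
  obtains u where "u \<in> F" "E1norm m E (\<lambda>x. u x - f x) < \<epsilon>"
    "AE x in N. x \<in> B (length gl) \<longrightarrow> dt (gl @ [u]) x \<noteq> 0" "AE x in N. z u x > 0"
proof -
  define P where "P k v \<longleftrightarrow> measure N (bad gl v) < inverse (real (Suc k)) \<and> measure N (bad [] v) < inverse (real (Suc k))" for k v
  have inv: "0 < inverse (real (Suc k))" for k by simp
  obtain u where u: "u \<in> F" "E1norm m E (\<lambda>x. u x - f x) < \<epsilon>" "\<And>k. P k u"
  proof (rule F_Baire[of P, OF _ _ f \<epsilon>])
    fix k u assume u: "u \<in> F" "P k u"
    obtain d1 where d1: "d1 > 0" "\<forall>v\<in>F. E1norm m E (\<lambda>x. v x - u x) < d1 \<longrightarrow> measure N (bad gl v) < inverse (real (Suc k))"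
      using bad_open[OF gl u(1)] u(2) unfolding P_def by blast
    obtain d2 where d2: "d2 > 0" "\<forall>v\<in>F. E1norm m E (\<lambda>x. v x - u x) < d2 \<longrightarrow> measure N (bad [] v) < inverse (real (Suc k))"
      using bad_open[of "[]", OF _ u(1)] u(2) unfolding P_def by auto
    show "\<exists>\<delta>>0. \<forall>v\<in>F. E1norm m E (\<lambda>x. v x - u x) < \<delta> \<longrightarrow> P k v"
      using d1 d2 by (intro exI[of _ "min d1 d2"]) (auto simp: P_def)
  next
    fix k u and \<delta> :: real assume "u \<in> F" "\<delta> > 0"
    from bad_dense[OF gl this(1) good this(2) inv]
    show "\<exists>v\<in>F. E1norm m E (\<lambda>x. v x - u x) < \<delta> \<and> P k v" unfolding P_def by blast
  next
    fix u assume "u \<in> F" "E1norm m E (\<lambda>x. u x - f x) < \<epsilon>" "\<And>k. P k u"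
    then show thesis by (rule that)
  qed
  have null: "AE x in N. x \<notin> bad g u" if "\<And>k. measure N (bad g u) < inverse (real (Suc k))" for g
  proof -
    have "measure N (bad g u) \<le> 0"
      by (rule LIMSEQ_le_const[OF LIMSEQ_inverse_real_of_nat]) (use that in \<open>auto intro: less_imp_le\<close>)
    then have "measure N (bad g u) = 0" using measure_nonneg[of N "bad g u"] by linarith
    then have "bad g u \<in> null_sets N" by (intro null_setsI) (auto simp: N.emeasure_eq_measure)
    then show ?thesis by (rule AE_not_in)
  qed
  show thesis
  proof (rule that[OF u(1,2)])
    have "AE x in N. x \<notin> bad gl u" using u(3) by (intro null) (simp add: P_def)
    then show "AE x in N. x \<in> B (length gl) \<longrightarrow> dt (gl @ [u]) x \<noteq> 0"
      by eventually_elim (auto simp: bad_def)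
    have "AE x in N. x \<notin> bad [] u" using u(3) by (intro null) (simp add: P_def)
    moreover have "AE x in N. e u u x = z u x" using e_self[OF u(1)] by (simp add: AE_N)
    ultimately show "AE x in N. z u x > 0"
      using B0_full
    proof eventually_elim
      case (elim x)
      then have "z u x \<noteq> 0" by (auto simp: bad_def dt_single)
      then show ?case using z_nonneg[of u x] by simp
    qed
  qed
qed

text \<open>Independence of the first \<open>r + 1\<close> components on \<open>B r\<close> is
  recorded for every \<open>r\<close>, since different points use different leading minors.\<close>

lemma exists_generic:
  assumes f: "\<And>j. j < n \<Longrightarrow> f j \<in> F" and \<epsilon>: "\<epsilon> > 0"
  obtains gl where "length gl = n" "set gl \<subseteq> F" "\<And>j. j < n \<Longrightarrow> E1norm m E (\<lambda>x. (gl ! j) x - f j x) < \<epsilon>"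
    "\<And>r. r < n \<Longrightarrow> AE x in N. x \<in> B r \<longrightarrow> dt (take (Suc r) gl) x \<noteq> 0" "\<And>j. j < n \<Longrightarrow> AE x in N. z (gl ! j) x > 0"
proof -
  have "i \<le> n \<Longrightarrow> \<exists>gl. length gl = i \<and> set gl \<subseteq> F \<and> (\<forall>j<i. E1norm m E (\<lambda>x. (gl ! j) x - f j x) < \<epsilon>) \<and>
    (\<forall>r<i. AE x in N. x \<in> B r \<longrightarrow> dt (take (Suc r) gl) x \<noteq> 0) \<and> (\<forall>j<i. AE x in N. z (gl ! j) x > 0)" for i
  proof (induction i)
    case 0 show ?case by (intro exI[of _ "[]"]) simp
  next
    case (Suc i)
    then obtain gl where gl: "length gl = i" "set gl \<subseteq> F" "\<And>j. j < i \<Longrightarrow> E1norm m E (\<lambda>x. (gl ! j) x - f j x) < \<epsilon>"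
      "\<And>r. r < i \<Longrightarrow> AE x in N. x \<in> B r \<longrightarrow> dt (take (Suc r) gl) x \<noteq> 0" "\<And>j. j < i \<Longrightarrow> AE x in N. z (gl ! j) x > 0"
      by auto
    have good: "AE x in N. x \<in> B (length gl) \<longrightarrow> dt gl x \<noteq> 0"
    proof (cases i)
      case 0 then show ?thesis using gl(1) by simp
    next
      case (Suc k)
      then have "AE x in N. x \<in> B k \<longrightarrow> dt gl x \<noteq> 0" using gl(4)[of k] gl(1) by simp
      \<comment> \<open>The sets \<open>B\<close> decrease, so what is known on \<open>B k\<close>
        holds on the smaller set \<open>B i\<close>.\<close>
      then show ?thesis by eventually_elim (use B_mono[of k i] gl(1) Suc in auto)
    qed
    have fi: "f i \<in> F" using f Suc.prems by simp
    obtain u where u: "u \<in> F" "E1norm m E (\<lambda>x. u x - f i x) < \<epsilon>"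
      "AE x in N. x \<in> B (length gl) \<longrightarrow> dt (gl @ [u]) x \<noteq> 0" "AE x in N. z u x > 0"
      by (rule extend_generic[OF gl(2) fi good \<epsilon>])
    show ?case
    proof (intro exI[of _ "gl @ [u]"] conjI allI impI)
      show "length (gl @ [u]) = Suc i" "set (gl @ [u]) \<subseteq> F" using gl u by auto
      show "E1norm m E (\<lambda>x. ((gl @ [u]) ! j) x - f j x) < \<epsilon>" if "j < Suc i" for j
        using that gl(1,3) u(2) by (cases "j < i") (auto simp: nth_append less_Suc_eq)
      show "AE x in N. x \<in> B r \<longrightarrow> dt (take (Suc r) (gl @ [u])) x \<noteq> 0" if "r < Suc i" for r
        using that gl(1,4) u(3) by (cases "r < i") (auto simp: less_Suc_eq)
      show "AE x in N. 0 < z ((gl @ [u]) ! j) x" if "j < Suc i" for j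
        using that gl(1,5) u(4) by (cases "j < i") (auto simp: nth_append less_Suc_eq)
    qed
  qed
  from this[OF order_refl] show thesis using that by blast
qed

text \<open>Positivity of the density makes \<open>\<nu>\<close> absolutely continuous with respect
  to \<open>em g\<close>, so energy dominance is inherited. Minimality is immediate, as an
  energy-dominant measure dominates \<open>em g\<close> by definition.\<close>

lemma medm_em:
  assumes g: "g \<in> F" and pos: "AE x in N. z g x > 0"
  shows "medm m F E (em g)"
proof -
  have ac: "absolutely_continuous (em g) \<nu>"
    unfolding absolutely_continuous_def
  proof
    fix A assume A: "A \<in> null_sets (em g)"
    then have A': "A \<in> sets \<nu>" using sets_em[OF g] sets_nu by (auto dest: null_setsD2)
    have "AE x in density \<nu> (\<lambda>x. ennreal (z g x)). x \<notin> A"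
      using AE_not_in[OF A] unfolding em_density[OF g] .
    then have "AE x in \<nu>. 0 < ennreal (z g x) \<longrightarrow> x \<notin> A" by (subst (asm) AE_density) auto
    moreover have "AE x in \<nu>. z g x > 0" using pos by (simp add: AE_N)
    ultimately have "AE x in \<nu>. x \<notin> A" by eventually_elim auto
    then show "A \<in> null_sets \<nu>" using A' AE_iff_null_sets by blast
  qed
  show ?thesis
    unfolding medm_def energy_dominant_def
  proof (intro conjI ballI allI impI)
    show "sigma_finite_measure (em g)" using fin_em[OF g] by (simp add: finite_measure_def)
    show "sets (em g) = sets borel" by (rule sets_em[OF g])
    show "absolutely_continuous (em g) (em f)" if "f \<in> F" for f
      using ac dom that unfolding energy_dominant_def absolutely_continuous_def by blast
    show "absolutely_continuous \<nu>' (em g)"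
      if "sigma_finite_measure \<nu>' \<and> sets \<nu>' = sets borel \<and> (\<forall>f\<in>F. absolutely_continuous \<nu>' (em f))" for \<nu>'
      using that g by blast
  qed
qed

theorem Ghat_dense:
  assumes p: "pointwise_index m F E \<nu> p" and n: "dindex \<nu> p = enat n"
  shows "dense_in_Fn m F E n (Ghat m F E \<nu> p n)"
  unfolding dense_in_Fn_def
proof (intro allI impI)
  fix f :: "nat \<Rightarrow> 'a \<Rightarrow> real" and \<epsilon> :: real
  assume f: "\<forall>i<n. f i \<in> F" and \<epsilon>: "\<epsilon> > 0"
  obtain gl where gl: "length gl = n" "set gl \<subseteq> F" "\<And>j. j < n \<Longrightarrow> E1norm m E (\<lambda>x. (gl ! j) x - f j x) < \<epsilon>"
    "\<And>r. r < n \<Longrightarrow> AE x in N. x \<in> B r \<longrightarrow> dt (take (Suc r) gl) x \<noteq> 0" "\<And>j. j < n \<Longrightarrow> AE x in N. z (gl ! j) x > 0"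
  proof (rule exists_generic[of n f \<epsilon>])
    show "f j \<in> F" if "j < n" for j using f that by blast
    show "\<epsilon> > 0" by (rule \<epsilon>)
  qed (rule that)
  have glF: "gl ! j \<in> F" if "j < n" for j using gl(1,2) that by auto
  have rb: "rank_bound m F E \<nu> p" using p by (simp add: pointwise_index_def)
  \<comment> \<open>The least bound is attained because infinity is a bound.\<close>
  have "AE x in \<nu>. p x \<le> (LEAST k. AE x in \<nu>. p x \<le> k)"
    by (rule LeastI[of "\<lambda>k. AE x in \<nu>. p x \<le> k" \<infinity>]) simp
  then have pn: "AE x in \<nu>. p x \<le> enat n" using n by (simp add: dindex_def)
  have pq: "AE x in \<nu>. p x \<le> enat (card {r. r < n \<and> x \<in> B r})"
    using p rank_bound_B[OF rb pn] by (simp add: pointwise_index_def)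
  have dts: "AE x in \<nu>. \<forall>r\<in>{..<n}. x \<in> B r \<longrightarrow> dt (take (Suc r) gl) x \<noteq> 0"
    using gl(4) by (intro AE_finite_allI) (auto simp: AE_N)
  have "AE x in \<nu>. \<exists>k. p x = enat k \<and> k \<le> n \<and> invertible_mat (energy_matrix m F E \<nu> k (\<lambda>j. gl ! j) x)"
    using pn pq dts
  proof eventually_elim
    case (elim x)
    obtain k where k: "p x = enat k" "k \<le> n" using elim(1) by (cases "p x") auto
    have "gdet k (\<lambda>i j. e (gl ! i) (gl ! j) x) \<noteq> 0"
    proof (cases k)
      case 0 then show ?thesis by (simp add: gdet_def)
    next
      case (Suc r)
      \<comment> \<open>The sets decrease, so a point outside \<open>B r\<close> lies in at most
        \<open>r\<close> of them, whereas the count is at least \<open>p x = r + 1\<close>.\<close>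
      have "x \<in> B r"
      proof (rule ccontr)
        assume "x \<notin> B r"
        then have "s < r" if "x \<in> B s" for s using B_mono[of r s] that by (meson not_le subsetD)
        then have "{s. s < n \<and> x \<in> B s} \<subseteq> {..<r}" by blast
        then have "card {s. s < n \<and> x \<in> B s} \<le> r" using card_mono[of "{..<r}"] by fastforce
        then show False using elim(2) k Suc by simp
      qed
      then have "dt (take k gl) x \<noteq> 0" using elim(3) k(2) Suc by auto
      moreover have "dt (take k gl) x = gdet k (\<lambda>i j. e (gl ! i) (gl ! j) x)"
        using k(2) gl(1) unfolding dt_def by (simp, intro gdet_cong) auto
      ultimately show ?thesis by simp
    qed
    then have "invertible_mat (energy_matrix m F E \<nu> k (\<lambda>j. gl ! j) x)"
      unfolding energy_matrix_def gdet_def by (intro invertible_mat_of_det[of _ k]) auto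
    with k show ?case by blast
  qed
  then have "(\<lambda>j. gl ! j) \<in> Ghat m F E \<nu> p n"
    unfolding Ghat_def Gset_def using glF gl(5) medm_em by auto
  then show "\<exists>g\<in>Ghat m F E \<nu> p n. \<forall>i<n. E1norm m E (\<lambda>x. g i x - f i x) < \<epsilon>"
    using gl(3) by (intro bexI[of _ "\<lambda>j. gl ! j"]) auto
qed

end

theorem theorem3p1:
  fixes m :: "'a::{metric_space, second_countable_topology} measure"
    and F :: "('a \<Rightarrow> real) set"
    and E :: "('a \<Rightarrow> real) \<Rightarrow> ('a \<Rightarrow> real) \<Rightarrow> real"
    and \<nu> :: "'a measure"
    and p :: "'a \<Rightarrow> enat"
    and n :: nat
  assumes "locally_compact_space (euclidean :: 'a topology)"
    and "sets m = sets borel"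
    and "\<And>K. compact K \<Longrightarrow> emeasure m K < \<infinity>"
    and "\<And>U. open U \<Longrightarrow> U \<noteq> {} \<Longrightarrow> emeasure m U > 0"
    and "dirichlet_form m F E"
    and "regular_df m F E"
    and "strong_local m F E"
    and "medm m F E \<nu>"
    and "pointwise_index m F E \<nu> p"
    and "dindex \<nu> p = enat n"
    and "1 \<le> n"
  shows "dense_in_Fn m F E n (Gset m F E \<nu> p n) \<and> dense_in_Fn m F E n (Ghat m F E \<nu> p n)"
proof -
  have dom: "energy_dominant m F E \<nu>" using assms(8) by (simp add: medm_def)
  interpret D: reg_dform_dom m F E \<nu>
    using assms(1,2,5,6) dom by unfold_locales
  obtain N where N: "finite_measure N" "sets N = sets \<nu>" "\<And>P. (AE x in N. P x) \<longleftrightarrow> (AE x in \<nu>. P x)"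
    by (rule sigma_finite_equivalent_finite[OF D.sf_nu]) (rule that)
  interpret M: reg_dform_medm m F E \<nu> N
    by (intro reg_dform_medm.intro reg_dform_medm_axioms.intro D.reg_dform_dom_axioms assms(8) N)
  obtain h :: "nat \<Rightarrow> 'a \<Rightarrow> real" where h: "\<And>k. h k \<in> F"
    "\<And>fs. set fs \<subseteq> F \<Longrightarrow> AE x in N. M.dt fs x \<noteq> 0 \<longrightarrow> (\<exists>ls. length ls = length fs \<and> M.dt (map h ls) x \<noteq> 0)"
    by (rule M.exists_universal_sequence) (rule that)
  interpret U: universal_sequence m F E \<nu> N h
    using h by unfold_locales
  have hat: "dense_in_Fn m F E n (Ghat m F E \<nu> p n)"
    using assms(9,10) by (rule U.Ghat_dense)
  moreover have "Ghat m F E \<nu> p n \<subseteq> Gset m F E \<nu> p n" by (auto simp: Ghat_def)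
  ultimately show ?thesis unfolding dense_in_Fn_def by blast
qed

end
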